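(* Given a uniformly integrable sequence of graphexes $\mathcal W_n=(W_n,S_n,I_n,\mathbf\Omega_n)$ which converges to a graphex $\mathcal W=(W,S,I,\mathbf\Omega)$ in the weak kernel metric $\delta_\diamond$, the following are equivalent. (1) The graphex $\mathcal W$ is of the form $\mathcal W=(W,0,0,\mathbf\Omega)$ (i.e., $S=0$ almost everywhere and $I=0$). (2) $\|S_n\|_1\to0$ and $I_n\to0$, and the sequence of graphons $W_n$ is uniformly tail regular. (3) $\|S_n\|_1\to0$ and $I_n\to0$, and the sequence of graphons $W_n$ converges in the cut metric $\delta_\square$ (to some integrable graphon).
   Context: A graphex $\mathcal W=(W,S,I,\mathbf\Omega)$ consists of a $\sigma$-finite measure space $\mathbf\Omega=(\Omega,\mathcal F,\mu)$, a symmetric measurable $W\colon\Omega\times\Omega\to[0,1]$ (called a graphon over $\mathbf\Omega$), a measurable $S\colon\Omega\to\mathbb R_+=[0,\infty)$ and $I\in\mathbb R_+$, such that (1) $W(\cdot,x)$ is integrable for almost all $x$, and (2) there is a measurable $\Omega'\subseteq\Omega$ with $\mu(\Omega\setminus\Omega')<\infty$ and $\int_{\Omega'\times\Omega'}W+2\int_{\Omega'}S+2I<\infty$. Write $\|\mathcal W\|_1=\rho(\mathcal W)=\int W+2\int S+2I$. The marginal is $D_{\mathcal W}(x)=\int_\Omega W(x,y)\,d\mu(y)+S(x)$. A set $\mathcal S$ of graphexes is uniformly integrable if $\sup_{\mathcal W\in\mathcal S}\|\mathcal W\|_1<\infty$ and for every $\varepsilon>0$ there is a $D$ such that $\|D_{\mathcal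 W}1_{D_{\mathcal W}>D}\|_1<\varepsilon$ for all $\mathcal W\in\mathcal S$. $\mathcal W$ is in $L^1\cap L^2$ if both $W$ and $D_{\mathcal W}$ are in $L^1\cap L^2$. A set of integrable graphons is uniformly tail regular (has uniformly regular tails) if for every $\varepsilon>0$ there is an $M$ such that for each graphon $W$ in the set, over $(\Omega,\mathcal F,\mu)$ say, there is a measurable $\Omega_0\subseteq\Omega$ with $\mu(\Omega_0)\le M$ and $\|W\|_1-\|W|_{\Omega_0\times\Omega_0}\|_1\le\varepsilon$. A coupling of $\mu_1,\mu_2$ is a measure on $(\Omega_1\times\Omega_2,\mathcal F_1\times\mathcal F_2)$ with marginals $\mu_1,\mu_2$; $\pi_i\colon\Omega_1\times\Omega_2\to\Omega_i$ denotes the projection. A trivial extension of $\mathcal W$ is obtained by enlarging the $\sigma$-finite measure space $\Omega$ to a $\sigma$-finite $\Omega'\supseteq\Omega$ (with $\Omega$ measurable in $\Omega'$, $\sigma$-algebra and measure restricting to those of $\Omega$), extending $W$ by $0$ off $\Omega\times\Omega$ and $S$ by $0$ off $\Omega$, and keeping $I$ (and similarly for graphons). Cut metric: $\|U\|_\square=\sup_{S,T}|\int_{S\times T}U\,d\mu\,d\mu|$ over measurable $S,T\subseteq\Omega$. For integrable graphons $W_1,W_2$, $\delta_\square(W_1,W_2)=\inf_\mu\|W_1'(\pi_1(\cdot),\pi_1(\cdot))-W_2'(\pi_2(\cdot),\pi_2(\cdot))\|_{\square}$, where $W_i'$ are trivial extensions of $W_i$ to spaces of infinite total mass, the infimum is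 over all couplings $\mu$ of the two extended measures, and the cut norm is with respect to $\mu$ (the value does not depend on the choice of extensions). Weak kernel metric: $\|U\|_{2\to2}=\sup\{\int f(x)U(x,y)g(y)\,d\mu(x)\,d\mu(y):\|f\|_2=\|g\|_2=1\}$. For graphexes in $L^1\cap L^2$ on the same measure space, $$d_{2\to2}(\mathcal W_1,\mathcal W_2)=\max\Big(\|W_1-W_2\|_{2\to2},\ \sqrt{\|D_{\mathcal W_1}-D_{\mathcal W_2}\|_2},\ \sqrt[3]{|\rho(\mathcal W_1)-\rho(\mathcal W_2)|}\Big).$$ For $\mu_1(\Omega_1)=\mu_2(\Omega_2)$, $\widetilde\delta_{2\to2}(\mathcal W_1,\mathcal W_2)=\inf_\mu d_{2\to2}(\mathcal W_1^{\pi_1,\mu},\mathcal W_2^{\pi_2,\mu})$ over all couplings $\mu$, where $\mathcal W_i^{\pi_i,\mu}=(W_i(\pi_i(\cdot),\pi_i(\cdot)),S_i\circ\pi_i,I_i)$ over $(\Omega_1\times\Omega_2,\mathcal F_1\times\mathcal F_2,\mu)$. Then $\delta_{2\to2}(\mathcal W_1,\mathcal W_2)=\widetilde\delta_{2\to2}(\mathcal W_1',\mathcal W_2')$ where $\mathcal W_i'$ are trivial extensions of $\mathcal W_i$ to spaces of infinite total mass (the value does not depend on the choice of these extensions). For measures on the same measurable space and $r\ge0$, $\mu-r\le\mu'\le\mu$ means $\mu(B)-r\le\mu'(B)\le\mu(B)$ for all measurable $B$. For graphexes $\mathcal W_i$ over $(\Omega_i,\mathcal F_i,\mu_i)$, $\delta_\diamond(\mathcal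 W_1,\mathcal W_2)$ is the infimum of all real $c$ for which there exist measures $\widetilde\mu_i$ on $(\Omega_i,\mathcal F_i)$ such that the graphexes $\widetilde{\mathcal W}_i$ obtained from $\mathcal W_i$ by replacing $\mu_i$ by $\widetilde\mu_i$ are in $L^1\cap L^2$, $\mu_i-c^2\le\widetilde\mu_i\le\mu_i$ for $i=1,2$, and $\delta_{2\to2}(\widetilde{\mathcal W}_1,\widetilde{\mathcal W}_2)\le c$. *)

theory Defs
  imports "HOL-Analysis.Analysis"
begin

text \<open>A graphex \<open>(W, S, I, (\<Omega>, F, \<mu>))\<close> is a record; \<open>base\<close> is the measure space, \<open>kernel\<close> is \<open>W\<close>,
  \<open>star\<close> is \<open>S\<close> and \<open>dust\<close> is \<open>I\<close>. A graphon is given by its measure space and its kernel.\<close>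

record 'a graphex =
  base :: "'a measure"
  kernel :: "'a \<Rightarrow> 'a \<Rightarrow> real"
  star :: "'a \<Rightarrow> real"
  dust :: real

definition graphon :: "'a measure \<Rightarrow> ('a \<Rightarrow> 'a \<Rightarrow> real) \<Rightarrow> bool" where
  "graphon M W \<longleftrightarrow>
     sigma_finite_measure M \<and>
     case_prod W \<in> borel_measurable (M \<Otimes>\<^sub>M M) \<and>
     (\<forall>x\<in>space M. \<forall>y\<in>space M. W x y \<in> {0..1} \<and> W x y = W y x)"

definition integrable_graphon :: "'a measure \<Rightarrow> ('a \<Rightarrow> 'a \<Rightarrow> real) \<Rightarrow> bool" where
  "integrable_graphon M W \<longleftrightarrow> graphon M W \<and> integrable (M \<Otimes>\<^sub>M M) (case_prod W)"

definition graphex :: "'a graphex \<Rightarrow> bool" where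
  "graphex G \<longleftrightarrow>
     graphon (base G) (kernel G) \<and>
     star G \<in> borel_measurable (base G) \<and> (\<forall>x\<in>space (base G). 0 \<le> star G x) \<and>
     0 \<le> dust G \<and>
     (AE x in base G. integrable (base G) (\<lambda>y. kernel G y x)) \<and>
     (\<exists>A\<in>sets (base G). emeasure (base G) (space (base G) - A) < \<infinity> \<and>
        (\<integral>\<^sup>+p\<in>A \<times> A. ennreal (case_prod (kernel G) p) \<partial>(base G \<Otimes>\<^sub>M base G))
          + 2 * (\<integral>\<^sup>+x\<in>A. ennreal (star G x) \<partial>base G) + 2 * ennreal (dust G) < \<infinity>)"

text \<open>The quantity \<open>\<rho>(G) = \<parallel>G\<parallel>\<^sub>1\<close>.\<close>

definition rho :: "'a graphex \<Rightarrow> ennreal" where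
  "rho G = (\<integral>\<^sup>+p. ennreal (case_prod (kernel G) p) \<partial>(base G \<Otimes>\<^sub>M base G))
     + 2 * (\<integral>\<^sup>+x. ennreal (star G x) \<partial>base G) + 2 * ennreal (dust G)"

text \<open>The integral below is a Bochner integral, hence \<open>0\<close> at the points \<open>x\<close> where \<open>W(x, \<cdot>)\<close> is
  not integrable; for a graphex these form a null set.\<close>

definition marginal :: "'a graphex \<Rightarrow> 'a \<Rightarrow> real" where
  "marginal G x = (\<integral>y. kernel G x y \<partial>base G) + star G x"

definition unif_integrable :: "'a graphex set \<Rightarrow> bool" where
  "unif_integrable \<S> \<longleftrightarrow>
     (SUP G\<in>\<S>. rho G) < \<infinity> \<and>
     (\<forall>\<epsilon>>0. \<exists>D::real. \<forall>G\<in>\<S>.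
        (\<integral>\<^sup>+x. ennreal (marginal G x * indicator {x. marginal G x > D} x) \<partial>base G) < ennreal \<epsilon>)"

definition in_L1_L2 :: "'a measure \<Rightarrow> ('a \<Rightarrow> real) \<Rightarrow> bool" where
  "in_L1_L2 M f \<longleftrightarrow> integrable M f \<and> integrable M (\<lambda>x. (f x)\<^sup>2)"

definition graphex_L1_L2 :: "'a graphex \<Rightarrow> bool" where
  "graphex_L1_L2 G \<longleftrightarrow>
     in_L1_L2 (base G \<Otimes>\<^sub>M base G) (case_prod (kernel G)) \<and> in_L1_L2 (base G) (marginal G)"

definition unif_tail_regular :: "('a measure \<times> ('a \<Rightarrow> 'a \<Rightarrow> real)) set \<Rightarrow> bool" where
  "unif_tail_regular \<S> \<longleftrightarrow>
     (\<forall>(M, W)\<in>\<S>. integrable_graphon M W) \<and>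
     (\<forall>\<epsilon>>0. \<exists>m::real. \<forall>(M, W)\<in>\<S>. \<exists>A\<in>sets M. emeasure M A \<le> ennreal m \<and>
        (\<integral>p. case_prod W p \<partial>(M \<Otimes>\<^sub>M M))
          - (LINT p:A \<times> A|M \<Otimes>\<^sub>M M. case_prod W p) \<le> \<epsilon>)"

definition couplings :: "'a measure \<Rightarrow> 'b measure \<Rightarrow> ('a \<times> 'b) measure set" where
  "couplings M N = {\<mu>. sets \<mu> = sets (M \<Otimes>\<^sub>M N) \<and> distr \<mu> M fst = M \<and> distr \<mu> N snd = N}"

text \<open>Trivial extensions to a space of infinite total mass: the metrics below do not depend on
  the choice of the extension, and we always adjoin a disjoint copy of the real line with Lebesgue
  measure. The sets \<open>A <+> B\<close> already form a sigma-algebra.\<close>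

definition ext_space :: "'a measure \<Rightarrow> ('a + real) measure" where
  "ext_space M = measure_of (space M <+> UNIV)
     {A <+> B | A B. A \<in> sets M \<and> B \<in> sets lborel}
     (\<lambda>C. emeasure M (Inl -` C) + emeasure lborel (Inr -` C))"

definition ext_star :: "('a \<Rightarrow> real) \<Rightarrow> 'a + real \<Rightarrow> real" where
  "ext_star S p = (case p of Inl x \<Rightarrow> S x | Inr _ \<Rightarrow> 0)"

definition ext_kernel :: "('a \<Rightarrow> 'a \<Rightarrow> real) \<Rightarrow> 'a + real \<Rightarrow> 'a + real \<Rightarrow> real" where
  "ext_kernel W p q = (case (p, q) of (Inl x, Inl y) \<Rightarrow> W x y | _ \<Rightarrow> 0)"

definition ext_graphex :: "'a graphex \<Rightarrow> ('a + real) graphex" where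
  "ext_graphex G = \<lparr>base = ext_space (base G), kernel = ext_kernel (kernel G),
     star = ext_star (star G), dust = dust G\<rparr>"

definition cut_norm :: "'a measure \<Rightarrow> ('a \<Rightarrow> 'a \<Rightarrow> real) \<Rightarrow> ereal" where
  "cut_norm M U =
     (SUP (A, B)\<in>sets M \<times> sets M. ereal \<bar>LINT p:A \<times> B|M \<Otimes>\<^sub>M M. case_prod U p\<bar>)"

definition delta_cut ::
  "'a measure \<Rightarrow> ('a \<Rightarrow> 'a \<Rightarrow> real) \<Rightarrow> 'b measure \<Rightarrow> ('b \<Rightarrow> 'b \<Rightarrow> real) \<Rightarrow> ereal" where
  "delta_cut M\<^sub>1 W\<^sub>1 M\<^sub>2 W\<^sub>2 =
     (INF \<mu>\<in>couplings (ext_space M\<^sub>1) (ext_space M\<^sub>2).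
        cut_norm \<mu> (\<lambda>p q. ext_kernel W\<^sub>1 (fst p) (fst q) - ext_kernel W\<^sub>2 (snd p) (snd q)))"

definition L2_nrm :: "'a measure \<Rightarrow> ('a \<Rightarrow> real) \<Rightarrow> real" where
  "L2_nrm M f = sqrt (\<integral>x. (f x)\<^sup>2 \<partial>M)"

text \<open>A vanishing Bochner integral of a non-integrable function cannot interfere with the condition
  \<open>\<parallel>f\<parallel>\<^sub>2 = 1\<close>, so square integrability of \<open>f\<close> and \<open>g\<close> is implied.\<close>

definition norm_2_2 :: "'a measure \<Rightarrow> ('a \<Rightarrow> 'a \<Rightarrow> real) \<Rightarrow> ereal" where
  "norm_2_2 M U =
     (SUP (f, g)\<in>{(f, g). f \<in> borel_measurable M \<and> g \<in> borel_measurable M \<and>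
                           L2_nrm M f = 1 \<and> L2_nrm M g = 1}.
        ereal (\<integral>(x, y). f x * U x y * g y \<partial>(M \<Otimes>\<^sub>M M)))"

text \<open>The two graphexes are meant to live on the same measure space and to be in
  \<open>L\<^sup>1 \<inter> L\<^sup>2\<close>.\<close>

definition d_2_2 :: "'a graphex \<Rightarrow> 'a graphex \<Rightarrow> ereal" where
  "d_2_2 G H =
     max (norm_2_2 (base G) (\<lambda>x y. kernel G x y - kernel H x y))
       (max (ereal (sqrt (L2_nrm (base G) (\<lambda>x. marginal G x - marginal H x))))
            (ereal (root 3 \<bar>enn2real (rho G) - enn2real (rho H)\<bar>)))"

definition pullback :: "'b measure \<Rightarrow> ('b \<Rightarrow> 'a) \<Rightarrow> 'a graphex \<Rightarrow> 'b graphex" where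
  "pullback \<mu> \<pi> G = \<lparr>base = \<mu>, kernel = (\<lambda>p q. kernel G (\<pi> p) (\<pi> q)),
     star = star G \<circ> \<pi>, dust = dust G\<rparr>"

definition delta_tilde_2_2 :: "'a graphex \<Rightarrow> 'b graphex \<Rightarrow> ereal" where
  "delta_tilde_2_2 G H =
     (INF \<mu>\<in>couplings (base G) (base H). d_2_2 (pullback \<mu> fst G) (pullback \<mu> snd H))"

definition delta_2_2 :: "'a graphex \<Rightarrow> 'b graphex \<Rightarrow> ereal" where
  "delta_2_2 G H = delta_tilde_2_2 (ext_graphex G) (ext_graphex H)"

text \<open>\<open>measure_between M r M'\<close> is \<open>M - r \<le> M' \<le> M\<close>.\<close>

definition measure_between :: "'a measure \<Rightarrow> real \<Rightarrow> 'a measure \<Rightarrow> bool" where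
  "measure_between M r M' \<longleftrightarrow> sets M' = sets M \<and>
     (\<forall>B\<in>sets M. emeasure M B - ennreal r \<le> emeasure M' B \<and> emeasure M' B \<le> emeasure M B)"

definition delta_diamond :: "'a graphex \<Rightarrow> 'b graphex \<Rightarrow> ereal" where
  "delta_diamond G H = Inf {ereal c | c. \<exists>\<mu> \<nu>.
     measure_between (base G) (c\<^sup>2) \<mu> \<and> measure_between (base H) (c\<^sup>2) \<nu> \<and>
     graphex_L1_L2 (G\<lparr>base := \<mu>\<rparr>) \<and> graphex_L1_L2 (H\<lparr>base := \<nu>\<rparr>) \<and>
     delta_2_2 (G\<lparr>base := \<mu>\<rparr>) (H\<lparr>base := \<nu>\<rparr>) \<le> ereal c}"

end

theory Submission
  imports Defs
begin

text \<open>Let \<open>D\<close> denote the marginal of a graphex, so that \<open>\<rho> = \<integral> D + \<integral> S + 2 I\<close>. Closeness in \<open>\<delta>\<^sub>\<diamond>\<close> makes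
  the marginals close in \<open>L\<^sup>2\<close> along a coupling and the values of \<open>\<rho>\<close> close; hence the
  excess \<open>\<integral> (D - \<delta>)\<^sup>+\<close> and \<open>\<rho>\<close> pass to the limit up to a change of \<open>\<delta>\<close>, uniform integrability
  absorbing the effect of the removed mass. Comparing \<open>\<rho>\<close> with the excess for small \<open>\<delta>\<close> shows that
  \<open>S = 0\<close> and \<open>I = 0\<close> in the limit iff \<open>\<integral> min(D\<^sub>n, \<delta>) + \<integral> S\<^sub>n + 2 I\<^sub>n\<close> is small for small \<open>\<delta>\<close> and
  large \<open>n\<close>. For vanishing \<open>S\<^sub>n\<close> and \<open>I\<^sub>n\<close> this is uniform tail regularity, with \<open>{D\<^sub>n \<ge> \<delta>}\<close> as the sets
  of bounded measure, and it follows from cut convergence because cut closeness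
  compares the integrals of the marginals over all sets. Conversely, if it holds, then the pairs in which a
  degree exceeds \<open>\<delta>\<close> have bounded measure, on which the \<open>2 \<rightarrow> 2\<close> norm controls the
  cut norm, while all other pairs carry little mass; the removed mass is coupled to
  parts of the adjoined real lines.\<close>

section \<open>Sums of measures\<close>

text \<open>On a space of infinite measure, an L^2 bound on the difference of two degree functions
  says nothing about their L^1 distance: much mass can sit at points whose degrees tend to 0. Such
  mass survives in the limit only through \<rho>, as the second copy of \<integral> S and as 2 I.
  This is why degrees are compared through (D - \<delta>)^+: it is Lipschitz in D, it vanishes where
  D is small, and half of the threshold pays for the quadratic error of the L^2 comparison. The
  other source of error is the freedom to remove mass c^2 from the base. Since W \<le> 1, this
  lowers every degree by at most c^2, which only shifts the threshold; the edges lost with the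
  removed points have mass of order K c^2 plus the degree mass above K. So K is fixed first, by
  uniform integrability, and c afterwards. Degrees take values in \<open>ennreal\<close>: sums of
  base measures, Tonelli and truncated differences then behave uniformly, also before the limit is
  known to have finite mass. Real Bochner integrals occur only at the borders, where the given
  definitions are unfolded.\<close>

definition add_measure :: "'a measure \<Rightarrow> 'a measure \<Rightarrow> 'a measure" where
  "add_measure M N = measure_of (space M) (sets M) (\<lambda>A. emeasure M A + emeasure N A)"

lemma space_add_measure [simp]: "space (add_measure M N) = space M"
  and sets_add_measure [simp, measurable_cong]: "sets (add_measure M N) = sets M"
  by (simp_all add: add_measure_def)

text \<open>For a nonmeasurable \<open>A\<close> all three values are 0 by convention.\<close>

lemma emeasure_add_measure:
  assumes "sets N = sets M"
  shows "emeasure (add_measure M N) A = emeasure M A + emeasure N A"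
proof (cases "A \<in> sets M")
  case True
  show ?thesis
    unfolding add_measure_def
  proof (rule emeasure_measure_of_sigma[OF _ _ _ True])
    show "sigma_algebra (space M) (sets M)" ..
    show "positive (sets M) (\<lambda>A. emeasure M A + emeasure N A)"
      by (simp add: positive_def)
    show "countably_additive (sets M) (\<lambda>A. emeasure M A + emeasure N A)"
    proof (rule countably_additiveI)
      fix A :: "nat \<Rightarrow> _" assume A: "range A \<subseteq> sets M" "disjoint_family A"
      then have "range A \<subseteq> sets N"
        using assms by simp
      with A show "(\<Sum>i. emeasure M (A i) + emeasure N (A i))
          = emeasure M (\<Union>(range A)) + emeasure N (\<Union>(range A))"
        by (simp add: suminf_add[symmetric] suminf_emeasure)
    qed
  qed
next
  case False
  then show ?thesis
    using assms by (simp add: emeasure_notin_sets)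
qed

text \<open>Induction over nonnegative measurable functions. In the supremum step both sequences of
  integrals increase, which is what lets the supremum of their sum split.\<close>

lemma nn_integral_add_measure:
  assumes N: "sets N = sets M" and f: "f \<in> borel_measurable M"
  shows "(\<integral>\<^sup>+x. f x \<partial>add_measure M N) = (\<integral>\<^sup>+x. f x \<partial>M) + (\<integral>\<^sup>+x. f x \<partial>N)"
proof -
  note [measurable_cong] = N
  have [simp]: "space N = space M"
    using N by (rule sets_eq_imp_space_eq)
  show ?thesis
    using f
  proof (induction rule: borel_measurable_induct)
    case (cong f g)
    have "(\<integral>\<^sup>+x. f x \<partial>L) = (\<integral>\<^sup>+x. g x \<partial>L)" if "space L = space M" for L :: "'a measure"
      using cong(3) that by (intro nn_integral_cong) auto
    then show ?case
      using cong(4) by simp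
  next
    case (set A)
    then show ?case
      using N by (simp add: emeasure_add_measure)
  next
    case (mult u c)
    then have [measurable]: "u \<in> borel_measurable M" by simp
    show ?case
      using mult by (simp add: nn_integral_cmult distrib_left)
  next
    case (add u v)
    then have [measurable]: "u \<in> borel_measurable M" "v \<in> borel_measurable M" by simp_all
    show ?case
      using add by (simp add: nn_integral_add ac_simps)
  next
    case (seq U)
    have [measurable]: "U i \<in> borel_measurable M" for i
      using seq by simp
    have mono: "incseq (\<lambda>i. \<integral>\<^sup>+x. U i x \<partial>L)" for L
      using seq(3) by (auto simp: incseq_def le_fun_def intro!: nn_integral_mono)
    have "(\<integral>\<^sup>+x. (SUP i. U i) x \<partial>L) = (SUP i. \<integral>\<^sup>+x. U i x \<partial>L)" if "sets L = sets M" for L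
    proof -
      note [measurable_cong] = that
      show ?thesis
        unfolding SUP_apply by (rule nn_integral_monotone_convergence_SUP) (use seq in auto)
    qed
    then show ?case
      using seq N mono by (simp add: ennreal_SUP_add)
  qed
qed

lemma distr_add_measure:
  assumes "sets N = sets M" "f \<in> measurable M L"
  shows "distr (add_measure M N) L f = add_measure (distr M L f) (distr N L f)"
proof (rule measure_eqI)
  have sp: "space N = space M"
    using assms(1) by (rule sets_eq_imp_space_eq)
  have f: "f \<in> measurable N L"
    using assms by (simp cong: measurable_cong_sets)
  fix A assume "A \<in> sets (distr (add_measure M N) L f)"
  then have "A \<in> sets L" by simp
  moreover have "f \<in> measurable (add_measure M N) L"
    using assms(2) by (simp cong: measurable_cong_sets)
  ultimately show "emeasure (distr (add_measure M N) L f) A = emeasure (add_measure (distr M L f) (distr N L f)) A"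
    using assms f by (simp add: emeasure_distr emeasure_add_measure sp)
qed simp

lemma sigma_finite_measure_mono:
  assumes "sigma_finite_measure M" "sets N = sets M" "\<And>A. A \<in> sets M \<Longrightarrow> emeasure N A \<le> emeasure M A"
  shows "sigma_finite_measure N"
proof -
  interpret sigma_finite_measure M by fact
  obtain A where "countable A" "A \<subseteq> sets M" "\<Union>A = space M" "\<forall>a\<in>A. emeasure M a \<noteq> \<infinity>"
    using sigma_finite_countable by auto
  then show ?thesis
    using assms(2,3) sets_eq_imp_space_eq[OF assms(2)] neq_top_trans
    by (intro sigma_finite_measure.intro exI[of _ A]) (auto simp: subset_eq)
qed

text \<open>By Radon-Nikodym \<nu> has a density h with respect to M, and \<nu> \<le> M forces h
  \<le> 1 almost everywhere, so the removed part \<alpha> is the measure with density 1 - h. Its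
  total mass is bounded by exhaustion: on a set of infinite measure the lower bound for \<nu> says
  only that \<nu> is infinite there too, and nothing about \<alpha>.\<close>

lemma measure_between_split:
  assumes "sigma_finite_measure M" "measure_between M r \<nu>"
  obtains \<alpha> where "sets \<alpha> = sets M" "emeasure \<alpha> (space M) \<le> ennreal r" "add_measure \<nu> \<alpha> = M"
proof -
  interpret sigma_finite_measure M by fact
  have sets: "sets \<nu> = sets M" and
    le: "\<And>B. B \<in> sets M \<Longrightarrow> emeasure \<nu> B \<le> emeasure M B" and
    ge: "\<And>B. B \<in> sets M \<Longrightarrow> emeasure M B - ennreal r \<le> emeasure \<nu> B"
    using assms(2) by (auto simp: measure_between_def)
  have "absolutely_continuous M \<nu>"
    unfolding absolutely_continuous_def null_sets_def
    using le sets by (auto simp flip: zero_less_iff_neq_zero) (metis le le_zero_eq)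
  then obtain h where h[measurable]: "h \<in> borel_measurable M" and \<nu>: "density M h = \<nu>"
    using Radon_Nikodym sets by blast
  have h1: "AE x in M. h x \<le> 1"
  proof -
    have *: "AE x in M. h x \<le> 1"
      if "\<And>A. A \<in> sets M \<Longrightarrow> emeasure (density M h) A \<le> emeasure (density M (\<lambda>_. 1)) A"
    proof -
      obtain A :: "nat \<Rightarrow> _" where A: "range A \<subseteq> sets M" "(\<Union>i. A i) = space M"
        "\<And>i. emeasure M (A i) \<noteq> \<infinity>"
        using sigma_finite by blast
      \<comment> \<open>On a piece of finite measure, M(\<open>E i\<close>) can be cancelled from
        \<nu>(\<open>E i\<close>) \<le> M(\<open>E i\<close>); what remains is that the integral of
        h - 1 over \<open>E i\<close> is 0.\<close>
      define E where "E i = {x\<in>A i. 1 < h x}" for i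
      have E[measurable]: "E i \<in> sets M" for i
      proof -
        have [measurable]: "A i \<in> sets M" using A by auto
        have "E i = A i \<inter> {x\<in>space M. 1 < h x}"
          using A sets.sets_into_space unfolding E_def by fastforce
        then show ?thesis by simp
      qed
      have null: "E i \<in> null_sets M" for i
      proof -
        have fin: "emeasure M (E i) \<noteq> \<infinity>"
        proof -
          have "emeasure M (E i) \<le> emeasure M (A i)"
            using A by (intro emeasure_mono) (auto simp: E_def)
          then show ?thesis using A(3)[of i] by (auto simp: top_unique)
        qed
        have "(\<integral>\<^sup>+x. h x * indicator (E i) x \<partial>M) \<le> emeasure M (E i)"
          using that[OF E[of i]] by (simp add: emeasure_density)
        moreover have "(\<integral>\<^sup>+x. h x * indicator (E i) x \<partial>M)
            = (\<integral>\<^sup>+x. (h x - 1) * indicator (E i) x + indicator (E i) x \<partial>M)"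
          by (intro nn_integral_cong) (auto simp: E_def indicator_def diff_add_cancel_ennreal less_imp_le)
        moreover have "\<dots> = (\<integral>\<^sup>+x. (h x - 1) * indicator (E i) x \<partial>M) + emeasure M (E i)"
          by (subst nn_integral_add) auto
        ultimately have "emeasure M (E i) + (\<integral>\<^sup>+x. (h x - 1) * indicator (E i) x \<partial>M) \<le> emeasure M (E i) + 0"
          by (simp add: add.commute)
        then have "(\<integral>\<^sup>+x. (h x - 1) * indicator (E i) x \<partial>M) = 0"
          using fin unfolding ennreal_add_left_cancel_le by simp
        then have "AE x in M. (h x - 1) * indicator (E i) x = 0"
          by (subst (asm) nn_integral_0_iff_AE) auto
        then have "AE x in M. x \<notin> E i"
          by eventually_elim (auto simp: E_def indicator_def diff_eq_0_iff_ennreal)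
        then show ?thesis
          by (simp add: AE_iff_null_sets)
      qed
      have "AE x in M. \<forall>i. x \<notin> E i"
        unfolding AE_all_countable using null AE_not_in by blast
      then show ?thesis
      proof (rule AE_mp, intro AE_I2 impI)
        fix x assume "x \<in> space M" "\<forall>i. x \<notin> E i"
        then show "h x \<le> 1"
          using A(2) by (auto simp: E_def not_less)
      qed
    qed
    show ?thesis
      using \<nu> le sets by (intro *) (simp add: density_1)
  qed
  define \<alpha> where "\<alpha> = density M (\<lambda>x. 1 - h x)"
  have [simp]: "sets \<alpha> = sets M" by (simp add: \<alpha>_def)
  have add: "emeasure \<nu> B + emeasure \<alpha> B = emeasure M B" if [measurable]: "B \<in> sets M" for B
  proof -
    have "emeasure \<nu> B + emeasure \<alpha> B = (\<integral>\<^sup>+x. h x * indicator B x + (1 - h x) * indicator B x \<partial>M)"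
      unfolding \<alpha>_def \<nu>[symmetric] by (simp add: emeasure_density nn_integral_add)
    also have "\<dots> = (\<integral>\<^sup>+x. indicator B x \<partial>M)"
      using h1 by (intro nn_integral_cong_AE, eventually_elim)
        (auto simp: indicator_def add_diff_inverse_ennreal)
    finally show ?thesis by simp
  qed
  have fin: "emeasure \<alpha> B \<le> ennreal r" if B: "B \<in> sets M" and "emeasure M B \<noteq> \<infinity>" for B
  proof -
    have fin': "emeasure \<nu> B \<noteq> top"
      using le[OF B] that(2) by (auto simp: top_unique)
    have "emeasure \<nu> B + emeasure \<alpha> B \<le> emeasure \<nu> B + ennreal r"
      using ge[OF B] add[OF B] by (simp add: ennreal_minus_le_iff add.commute)
    then show ?thesis
      using fin' by (simp add: ennreal_add_left_cancel_le)
  qed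
  obtain A :: "nat \<Rightarrow> _" where A: "range A \<subseteq> sets M" "(\<Union>i. A i) = space M"
      "\<And>i. emeasure M (A i) \<noteq> \<infinity>" "incseq A"
    using sigma_finite_incseq by blast
  have "emeasure \<alpha> (space M) = (SUP i. emeasure \<alpha> (A i))"
    using A(1,2,4) by (subst SUP_emeasure_incseq) auto
  also have "\<dots> \<le> ennreal r"
    using A by (intro SUP_least fin) auto
  finally have "emeasure \<alpha> (space M) \<le> ennreal r" .
  moreover have "add_measure \<nu> \<alpha> = M"
    using add sets by (intro measure_eqI) (auto simp: emeasure_add_measure)
  ultimately show ?thesis
    using that[of \<alpha>] by simp
qed

section \<open>The extended space\<close>

lemma plus_vimage_Inl_Inr: "(Inl -` C) <+> (Inr -` C) = C"
proof (rule set_eqI)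
  fix x show "x \<in> (Inl -` C) <+> (Inr -` C) \<longleftrightarrow> x \<in> C"
    by (cases x) auto
qed

text \<open>Describing the sets by their preimages under the two injections makes closure under
  complements and countable unions immediate.\<close>

lemma ext_space_algebra:
  "{A <+> B | A B. A \<in> sets M \<and> B \<in> sets (lborel :: real measure)}
     = {C. Inl -` C \<in> sets M \<and> Inr -` C \<in> sets lborel}"
proof (intro set_eqI iffI)
  fix C :: "('a + real) set" assume "C \<in> {A <+> B | A B. A \<in> sets M \<and> B \<in> sets lborel}"
  then obtain A B where C: "C = A <+> B" "A \<in> sets M" "B \<in> sets lborel"
    by blast
  moreover from C(1) have "Inl -` C = A" "Inr -` C = B"
    by auto
  ultimately show "C \<in> {C. Inl -` C \<in> sets M \<and> Inr -` C \<in> sets lborel}"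
    by simp
next
  fix C :: "('a + real) set" assume "C \<in> {C. Inl -` C \<in> sets M \<and> Inr -` C \<in> sets lborel}"
  then show "C \<in> {A <+> B | A B. A \<in> sets M \<and> B \<in> sets lborel}"
    using plus_vimage_Inl_Inr[of C] by blast
qed

lemma sigma_algebra_ext_space:
  "sigma_algebra (space M <+> UNIV) {C. Inl -` C \<in> sets M \<and> Inr -` C \<in> sets (lborel :: real measure)}"
proof (rule sigma_algebra_iff2[THEN iffD2], intro conjI ballI allI impI)
  show "{C. Inl -` C \<in> sets M \<and> Inr -` C \<in> sets (lborel :: real measure)} \<subseteq> Pow (space M <+> UNIV)"
  proof safe
    fix C :: "('a + real) set" and x assume *: "Inl -` C \<in> sets M" "x \<in> C"
    show "x \<in> space M <+> (UNIV :: real set)"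
      using * sets.sets_into_space[OF *(1)] by (cases x) auto
  qed
  show "{} \<in> {C. Inl -` C \<in> sets M \<and> Inr -` C \<in> sets (lborel :: real measure)}"
    by simp
  fix C assume "C \<in> {C. Inl -` C \<in> sets M \<and> Inr -` C \<in> sets (lborel :: real measure)}"
  moreover have "Inl -` ((space M <+> UNIV) - C) = space M - Inl -` C"
    "Inr -` ((space M <+> UNIV) - C) = - (Inr -` C)"
    by auto
  ultimately show "(space M <+> UNIV) - C
      \<in> {C. Inl -` C \<in> sets M \<and> Inr -` C \<in> sets (lborel :: real measure)}"
    by auto
next
  fix A :: "nat \<Rightarrow> _"
  assume "range A \<subseteq> {C. Inl -` C \<in> sets M \<and> Inr -` C \<in> sets (lborel :: real measure)}"
  then show "\<Union>(range A) \<in> {C. Inl -` C \<in> sets M \<and> Inr -` C \<in> sets (lborel :: real measure)}"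
    unfolding vimage_UN mem_Collect_eq by (intro conjI sets.countable_UN) auto
qed

lemma space_ext_space: "space (ext_space M) = space M <+> UNIV"
  and sets_ext_space: "sets (ext_space M) = {C. Inl -` C \<in> sets M \<and> Inr -` C \<in> sets borel}"
proof -
  interpret sigma_algebra "space M <+> UNIV"
    "{C. Inl -` C \<in> sets M \<and> Inr -` C \<in> sets (lborel :: real measure)}"
    by (rule sigma_algebra_ext_space)
  show "space (ext_space M) = space M <+> UNIV"
    "sets (ext_space M) = {C. Inl -` C \<in> sets M \<and> Inr -` C \<in> sets borel}"
    unfolding ext_space_def ext_space_algebra
    by (simp_all add: space_measure_of[OF space_closed] sets_measure_of_eq del: sets_lborel)
      simp_all
qed

lemma emeasure_ext_space:
  assumes "C \<in> sets (ext_space M)"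
  shows "emeasure (ext_space M) C = emeasure M (Inl -` C) + emeasure lborel (Inr -` C)"
  unfolding ext_space_def ext_space_algebra
proof (rule emeasure_measure_of_sigma[OF sigma_algebra_ext_space])
  let ?S = "{C. Inl -` C \<in> sets M \<and> Inr -` C \<in> sets (lborel :: real measure)}"
  show "C \<in> ?S"
    using assms by (simp add: sets_ext_space)
  show "positive ?S (\<lambda>C. emeasure M (Inl -` C) + emeasure lborel (Inr -` C))"
    by (simp add: positive_def)
  show "countably_additive ?S (\<lambda>C. emeasure M (Inl -` C) + emeasure lborel (Inr -` C))"
  proof (rule countably_additiveI)
    fix A :: "nat \<Rightarrow> _" assume A: "range A \<subseteq> ?S" "disjoint_family A"
    have "disjoint_family (\<lambda>i. Inl -` A i)" "disjoint_family (\<lambda>i. Inr -` A i)"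
      using A(2) by (auto simp: disjoint_family_on_def)
    moreover have "range (\<lambda>i. Inl -` A i) \<subseteq> sets M" "range (\<lambda>i. Inr -` A i) \<subseteq> sets lborel"
      using A(1) by auto
    ultimately show "(\<Sum>i. emeasure M (Inl -` A i) + emeasure lborel (Inr -` A i))
        = emeasure M (Inl -` \<Union>(range A)) + emeasure lborel (Inr -` \<Union>(range A))"
      by (simp add: suminf_add[symmetric] suminf_emeasure vimage_UN)
  qed
qed

lemma measurable_Inl_ext [measurable]: "Inl \<in> measurable M (ext_space M)"
  and measurable_Inr_ext [measurable]: "Inr \<in> measurable borel (ext_space M)"
  by (auto simp: measurable_def space_ext_space sets_ext_space Int_absorb2 dest: sets.sets_into_space)

text \<open>The universal property of the disjoint union; it replaces computations with the
  sigma-algebra in later measurability proofs.\<close>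

lemma measurable_ext_iff:
  "f \<in> measurable (ext_space M) N \<longleftrightarrow> (\<lambda>x. f (Inl x)) \<in> measurable M N \<and> (\<lambda>t. f (Inr t)) \<in> measurable borel N"
proof
  assume [measurable]: "f \<in> measurable (ext_space M) N"
  show "(\<lambda>x. f (Inl x)) \<in> measurable M N \<and> (\<lambda>t. f (Inr t)) \<in> measurable borel N"
    by simp
next
  assume *: "(\<lambda>x. f (Inl x)) \<in> measurable M N \<and> (\<lambda>t. f (Inr t)) \<in> measurable borel N"
  show "f \<in> measurable (ext_space M) N"
  proof (rule measurableI)
    show "f x \<in> space N" if "x \<in> space (ext_space M)" for x
      using that * by (auto simp: space_ext_space measurable_def)
    fix A assume A: "A \<in> sets N"
    have "Inl -` (f -` A \<inter> space (ext_space M)) = (\<lambda>x. f (Inl x)) -` A \<inter> space M"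
      "Inr -` (f -` A \<inter> space (ext_space M)) = (\<lambda>x. f (Inr x)) -` A \<inter> space borel"
      by (auto simp: space_ext_space)
    then show "f -` A \<inter> space (ext_space M) \<in> sets (ext_space M)"
      unfolding sets_ext_space mem_Collect_eq using * A by (metis measurable_sets)
  qed
qed

text \<open>Reduces integration over the extension to the sum rule for measures and a change of
  variables on each summand.\<close>

lemma ext_space_eq_add:
  "ext_space M = add_measure (distr M (ext_space M) Inl) (distr lborel (ext_space M) Inr)"
proof (rule measure_eqI)
  fix C assume C: "C \<in> sets (ext_space M)"
  have "Inl -` C \<inter> space M = Inl -` C"
    using C by (auto simp: sets_ext_space dest: sets.sets_into_space)
  with C show "emeasure (ext_space M) C
      = emeasure (add_measure (distr M (ext_space M) Inl) (distr lborel (ext_space M) Inr)) C"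
    by (simp add: emeasure_ext_space emeasure_add_measure emeasure_distr)
qed simp

lemma nn_integral_ext_space:
  assumes [measurable]: "f \<in> borel_measurable (ext_space M)"
  shows "(\<integral>\<^sup>+p. f p \<partial>ext_space M) = (\<integral>\<^sup>+x. f (Inl x) \<partial>M) + (\<integral>\<^sup>+t. f (Inr t) \<partial>lborel)"
proof -
  have "(\<integral>\<^sup>+p. f p \<partial>ext_space M)
      = (\<integral>\<^sup>+p. f p \<partial>add_measure (distr M (ext_space M) Inl) (distr lborel (ext_space M) Inr))"
    using ext_space_eq_add[of M] by simp
  also have "\<dots> = (\<integral>\<^sup>+p. f p \<partial>distr M (ext_space M) Inl) + (\<integral>\<^sup>+p. f p \<partial>distr lborel (ext_space M) Inr)"
    by (rule nn_integral_add_measure) simp_all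
  also have "\<dots> = (\<integral>\<^sup>+x. f (Inl x) \<partial>M) + (\<integral>\<^sup>+t. f (Inr t) \<partial>lborel)"
    by (simp add: nn_integral_distr)
  finally show ?thesis .
qed

lemma sigma_finite_ext_space:
  assumes "sigma_finite_measure M"
  shows "sigma_finite_measure (ext_space M)"
proof -
  interpret M: sigma_finite_measure M by fact
  obtain A where A: "countable A" "A \<subseteq> sets M" "\<Union>A = space M" "\<forall>a\<in>A. emeasure M a \<noteq> \<infinity>"
    using M.sigma_finite_countable by auto
  obtain B where B: "countable B" "B \<subseteq> sets lborel" "\<Union>B = (UNIV :: real set)"
      "\<forall>b\<in>B. emeasure lborel b \<noteq> \<infinity>"
    using lborel.sigma_finite_countable by auto
  define C where "C = (\<lambda>a. a <+> {}) ` A \<union> (\<lambda>b. {} <+> b) ` B"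
  have "(\<Union>C) = (\<Union>A) <+> (\<Union>B)"
    unfolding C_def by auto
  then have "\<Union>C = space (ext_space M)"
    unfolding A(3) B(3) space_ext_space .
  moreover have [simp]: "Inl -` (a <+> b) = a" "Inr -` (a <+> b) = b" for a :: "'a set" and b :: "real set"
    by auto
  have "C \<subseteq> sets (ext_space M)"
    using A(2) B(2) by (auto simp: C_def sets_ext_space)
  moreover have "emeasure (ext_space M) c \<noteq> \<infinity>" if "c \<in> C" for c
  proof -
    have "emeasure (ext_space M) c = emeasure M (Inl -` c) + emeasure lborel (Inr -` c)"
      using that \<open>C \<subseteq> _\<close> by (intro emeasure_ext_space) auto
    then show ?thesis
      using A(4) B(4) that by (auto simp: C_def)
  qed
  moreover have "countable C"
    using A(1) B(1) by (simp add: C_def)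
  ultimately show ?thesis
    by (intro sigma_finite_measure.intro exI[of _ C] conjI ballI)
qed

section \<open>Marginals, pullbacks and couplings\<close>

text \<open>The clauses of \<open>graphex\<close> that are inherited by trivial extensions,
  pullbacks and smaller base measures. Finiteness enters separately, as
  \<open>rho G < \<infinity>\<close>.\<close>

definition measurable_graphex :: "'a graphex \<Rightarrow> bool" where
  "measurable_graphex G \<longleftrightarrow> graphon (base G) (kernel G) \<and>
     star G \<in> borel_measurable (base G) \<and> (\<forall>x\<in>space (base G). 0 \<le> star G x) \<and> 0 \<le> dust G"

text \<open>The degree as an element of [0, \<infinity>]. It differs from \<open>marginal\<close>
  exactly where the section of the kernel has infinite integral, and it is additive in the base
  measure without exception.\<close>

definition nmarg :: "'a graphex \<Rightarrow> 'a \<Rightarrow> ennreal" where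
  "nmarg G x = (\<integral>\<^sup>+y. ennreal (kernel G x y) \<partial>base G) + ennreal (star G x)"

abbreviation (input) degree_mass :: "'a graphex \<Rightarrow> ennreal" where
  "degree_mass G \<equiv> \<integral>\<^sup>+x. nmarg G x \<partial>base G"

abbreviation (input) star_mass :: "'a graphex \<Rightarrow> ennreal" where
  "star_mass G \<equiv> \<integral>\<^sup>+x. ennreal (star G x) \<partial>base G"

text \<open>Subtraction in \<open>ennreal\<close> truncates at 0, so this is \<integral> (D -
  \<delta>)^+. Unlike the integral of D over {D > \<delta>}, it has no jump at the threshold and
  therefore tolerates small changes of D.\<close>

definition excess :: "ennreal \<Rightarrow> 'a graphex \<Rightarrow> ennreal" where
  "excess \<delta> G = (\<integral>\<^sup>+x. (nmarg G x - \<delta>) \<partial>base G)"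

lemma graphex_imp_measurable: "graphex G \<Longrightarrow> measurable_graphex G"
  by (simp add: graphex_def measurable_graphex_def)

lemma measurable_graphexD:
  assumes "measurable_graphex G"
  shows "sigma_finite_measure (base G)"
    and "(\<lambda>(x, y). kernel G x y) \<in> borel_measurable (base G \<Otimes>\<^sub>M base G)"
    and "star G \<in> borel_measurable (base G)"
    and "\<And>x. x \<in> space (base G) \<Longrightarrow> 0 \<le> star G x"
    and "\<And>x y. x \<in> space (base G) \<Longrightarrow> y \<in> space (base G) \<Longrightarrow> 0 \<le> kernel G x y"
    and "\<And>x y. x \<in> space (base G) \<Longrightarrow> y \<in> space (base G) \<Longrightarrow> kernel G x y \<le> 1"
    and "\<And>x y. x \<in> space (base G) \<Longrightarrow> y \<in> space (base G) \<Longrightarrow> kernel G x y = kernel G y x"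
    and "0 \<le> dust G"
  using assms unfolding measurable_graphex_def graphon_def by auto

lemma measurable_nmarg:
  assumes "measurable_graphex G"
  shows "nmarg G \<in> borel_measurable (base G)"
proof -
  interpret sigma_finite_measure "base G" by (rule measurable_graphexD) fact
  note [measurable] = measurable_graphexD(2,3)[OF assms]
  show ?thesis
    unfolding nmarg_def by measurable
qed

text \<open>Of the two copies of \<integral> S in \<rho>, one is absorbed into \<integral> D; the
  other one stays visible.\<close>

lemma rho_eq:
  assumes "measurable_graphex G"
  shows "rho G = degree_mass G + star_mass G + 2 * ennreal (dust G)"
proof -
  interpret sigma_finite_measure "base G" by (rule measurable_graphexD) fact
  note [measurable] = measurable_graphexD(2,3)[OF assms]
  have "(\<integral>\<^sup>+p. ennreal (case_prod (kernel G) p) \<partial>(base G \<Otimes>\<^sub>M base G))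
      = (\<integral>\<^sup>+x. \<integral>\<^sup>+y. ennreal (kernel G x y) \<partial>base G \<partial>base G)"
    by (subst nn_integral_fst[symmetric]) (auto simp: case_prod_beta')
  moreover have "degree_mass G
      = (\<integral>\<^sup>+x. \<integral>\<^sup>+y. ennreal (kernel G x y) \<partial>base G \<partial>base G) + star_mass G"
    unfolding nmarg_def by (rule nn_integral_add) simp_all
  ultimately show ?thesis
    unfolding rho_def by (simp add: mult_2 ac_simps)
qed

section \<open>Trivial extensions of graphexes\<close>

lemma measurable_ext_kernel:
  assumes [measurable]: "case_prod W \<in> borel_measurable (M \<Otimes>\<^sub>M M)"
  shows "case_prod (ext_kernel W) \<in> borel_measurable (ext_space M \<Otimes>\<^sub>M ext_space M)"
proof (cases "space M = {}")
  case True
  have "case_prod (ext_kernel W) p = 0" if "p \<in> space (ext_space M \<Otimes>\<^sub>M ext_space M)" for p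
    using that True by (auto simp: space_pair_measure space_ext_space ext_kernel_def)
  then show ?thesis
    by (simp cong: measurable_cong)
next
  case False
  \<comment> \<open>The kernel is W composed with \<open>e\<close>, multiplied by two 0/1 factors.
    The map \<open>e\<close> has to send the adjoined line to some point of M, hence the base point
    and the separate empty case.\<close>
  then obtain x0 where [simp]: "x0 \<in> space M" by auto
  define e where "e = case_sum (\<lambda>x. x) (\<lambda>_::real. x0)"
  define i where "i = case_sum (\<lambda>_::'a. 1::real) (\<lambda>_::real. 0)"
  have [measurable]: "e \<in> measurable (ext_space M) M" "i \<in> borel_measurable (ext_space M)"
    by (simp_all add: measurable_ext_iff e_def i_def)
  have "case_prod (ext_kernel W) = (\<lambda>(p, q). i p * i q * W (e p) (e q))"
    by (auto simp: fun_eq_iff ext_kernel_def e_def i_def split: sum.splits)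
  then show ?thesis by simp
qed

lemma graphon_ext:
  assumes "graphon M W"
  shows "graphon (ext_space M) (ext_kernel W)"
  using assms unfolding graphon_def
  by (auto simp: sigma_finite_ext_space measurable_ext_kernel space_ext_space) (auto simp: ext_kernel_def)

lemma measurable_graphex_ext:
  assumes "measurable_graphex G"
  shows "measurable_graphex (ext_graphex G)"
proof -
  have "ext_star (star G) \<in> borel_measurable (ext_space (base G))"
    using measurable_graphexD(3)[OF assms] by (simp add: measurable_ext_iff ext_star_def)
  then show ?thesis
    using assms by (auto simp: measurable_graphex_def ext_graphex_def graphon_ext space_ext_space ext_star_def)
qed

lemma ext_graphex_sel [simp]:
  "base (ext_graphex G) = ext_space (base G)" "kernel (ext_graphex G) = ext_kernel (kernel G)"
  "star (ext_graphex G) = ext_star (star G)" "dust (ext_graphex G) = dust G"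
  by (simp_all add: ext_graphex_def)

lemma ext_kernel_simps [simp]:
  "ext_kernel W (Inl x) (Inl y) = W x y" "ext_kernel W (Inr t) q = 0" "ext_kernel W p (Inr t) = 0"
  by (simp_all add: ext_kernel_def split: sum.splits)

lemma ext_star_simps [simp]: "ext_star S (Inl x) = S x" "ext_star S (Inr t) = 0"
  by (simp_all add: ext_star_def)

lemma nn_integral_ext_kernel:
  assumes "measurable_graphex G" "x \<in> space (base G)"
  shows "(\<integral>\<^sup>+y. ennreal (ext_kernel (kernel G) (Inl x) y) \<partial>ext_space (base G)) = (\<integral>\<^sup>+y. ennreal (kernel G x y) \<partial>base G)"
proof -
  note [measurable] = measurable_graphexD(2,3)[OF assms(1)]
  note [simp] = assms(2)
  have [measurable]: "(\<lambda>y. ext_kernel (kernel G) (Inl x) y) \<in> borel_measurable (ext_space (base G))"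
    by (simp add: measurable_ext_iff)
  show ?thesis
    by (subst nn_integral_ext_space) simp_all
qed

lemma nmarg_ext:
  assumes "measurable_graphex G"
  shows "x \<in> space (base G) \<Longrightarrow> nmarg (ext_graphex G) (Inl x) = nmarg G x"
    and "nmarg (ext_graphex G) (Inr t) = 0"
  using assms by (simp_all add: nmarg_def nn_integral_ext_kernel)

text \<open>Where the section is not integrable, its Bochner integral and \<open>enn2real \<infinity>\<close> are both \<open>0\<close>.\<close>

lemma marginal_eq:
  assumes "measurable_graphex G" "x \<in> space (base G)"
  shows "marginal G x = enn2real (\<integral>\<^sup>+y. ennreal (kernel G x y) \<partial>base G) + star G x"
proof -
  note [measurable] = measurable_graphexD(2,3)[OF assms(1)]
  note [simp] = assms(2)
  have "(\<integral>y. kernel G x y \<partial>base G) = enn2real (\<integral>\<^sup>+y. ennreal (kernel G x y) \<partial>base G)"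
    using measurable_graphexD(5)[OF assms] by (intro integral_eq_nn_integral) auto
  then show ?thesis
    by (simp add: marginal_def)
qed

lemma measurable_marginal:
  assumes "measurable_graphex G"
  shows "marginal G \<in> borel_measurable (base G)"
proof -
  interpret sigma_finite_measure "base G" by (rule measurable_graphexD) fact
  note [measurable] = measurable_graphexD(2,3)[OF assms]
  have "(\<lambda>x. enn2real (\<integral>\<^sup>+y. ennreal (kernel G x y) \<partial>base G) + star G x) \<in> borel_measurable (base G)"
    by measurable
  then show ?thesis
    by (subst measurable_cong[OF marginal_eq[OF assms]])
qed

lemma star_le_marginal:
  assumes "measurable_graphex G" "x \<in> space (base G)"
  shows "0 \<le> star G x" "star G x \<le> marginal G x"
  using assms by (simp_all add: marginal_eq measurable_graphexD)

lemma ennreal_marginal: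
  assumes "measurable_graphex G" "x \<in> space (base G)" "nmarg G x < \<infinity>"
  shows "ennreal (marginal G x) = nmarg G x"
  using assms measurable_graphexD(4)[OF assms(1,2)]
  by (simp add: marginal_eq nmarg_def ennreal_plus)

lemma marginal_ext:
  assumes "measurable_graphex G"
  shows "x \<in> space (base G) \<Longrightarrow> marginal (ext_graphex G) (Inl x) = marginal G x"
    and "marginal (ext_graphex G) (Inr t) = 0"
  using assms
  by (simp_all add: marginal_eq measurable_graphex_ext space_ext_space nn_integral_ext_kernel InlI InrI)

text \<open>Off this null set \<open>marginal\<close> and \<open>nmarg\<close> agree, which is how
  statements about Bochner marginals become statements about degrees.\<close>

lemma AE_nmarg_finite:
  assumes "measurable_graphex G" "rho G < \<infinity>"
  shows "AE x in base G. nmarg G x < \<infinity>"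
proof -
  have "degree_mass G \<noteq> \<infinity>"
    using assms by (auto simp: rho_eq)
  then have "AE x in base G. nmarg G x \<noteq> \<infinity>"
    by (intro nn_integral_PInf_AE measurable_nmarg assms) auto
  then show ?thesis
    by eventually_elim (auto simp: top.not_eq_extremum)
qed

text \<open>The adjoined line has infinite measure but degree 0 everywhere; \<open>f 0 = 0\<close>
  keeps it from contributing.\<close>

lemma nn_integral_ext_nmarg:
  assumes "measurable_graphex G" and [measurable]: "f \<in> borel_measurable borel" and "f 0 = 0"
  shows "(\<integral>\<^sup>+p. f (nmarg (ext_graphex G) p) \<partial>ext_space (base G)) = (\<integral>\<^sup>+x. f (nmarg G x) \<partial>base G)"
proof -
  have [measurable]: "nmarg (ext_graphex G) \<in> borel_measurable (ext_space (base G))"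
    using measurable_nmarg[OF measurable_graphex_ext[OF assms(1)]] by simp
  show ?thesis
    using assms by (subst nn_integral_ext_space) (auto simp: nmarg_ext intro!: nn_integral_cong)
qed

lemma excess_ext: "measurable_graphex G \<Longrightarrow> excess \<delta> (ext_graphex G) = excess \<delta> G"
  unfolding excess_def using nn_integral_ext_nmarg[of G "\<lambda>t. t - \<delta>"] by simp

lemma nn_integral_ext_star:
  assumes "measurable_graphex G"
  shows "(\<integral>\<^sup>+p. ennreal (ext_star (star G) p) \<partial>ext_space (base G)) = star_mass G"
  using measurable_graphexD(3)[OF measurable_graphex_ext[OF assms]]
  by (subst nn_integral_ext_space) auto

lemma rho_ext: "measurable_graphex G \<Longrightarrow> rho (ext_graphex G) = rho G"
  using nn_integral_ext_nmarg[of G "\<lambda>t. t"]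
  by (simp add: rho_eq measurable_graphex_ext nn_integral_ext_star)

section \<open>Measure-preserving maps and pullbacks\<close>

definition measure_preserving :: "'b measure \<Rightarrow> 'a measure \<Rightarrow> ('b \<Rightarrow> 'a) \<Rightarrow> bool" where
  "measure_preserving \<theta> M \<pi> \<longleftrightarrow> \<pi> \<in> measurable \<theta> M \<and> distr \<theta> M \<pi> = M"

lemma measure_preserving_nn_integral:
  assumes "measure_preserving \<theta> M \<pi>" "f \<in> borel_measurable M"
  shows "(\<integral>\<^sup>+p. f (\<pi> p) \<partial>\<theta>) = (\<integral>\<^sup>+x. f x \<partial>M)"
  using assms nn_integral_distr[of \<pi> \<theta> M f] by (simp add: measure_preserving_def)

lemma coupling_measure_preserving:
  assumes "\<theta> \<in> couplings M N"
  shows "measure_preserving \<theta> M fst" "measure_preserving \<theta> N snd"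
  using assms by (auto simp: couplings_def measure_preserving_def cong: measurable_cong_sets)

lemma measure_preserving_sigma_finite:
  "measure_preserving \<theta> M \<pi> \<Longrightarrow> sigma_finite_measure M \<Longrightarrow> sigma_finite_measure \<theta>"
  by (metis measure_preserving_def sigma_finite_measure_distr)

lemma pullback_sel [simp]:
  "base (pullback \<theta> \<pi> G) = \<theta>" "kernel (pullback \<theta> \<pi> G) = (\<lambda>p q. kernel G (\<pi> p) (\<pi> q))"
  "star (pullback \<theta> \<pi> G) = (\<lambda>p. star G (\<pi> p))" "dust (pullback \<theta> \<pi> G) = dust G"
  by (simp_all add: pullback_def comp_def)

context
  fixes G :: "'a graphex" and \<theta> :: "'b measure" and \<pi>
  assumes G: "measurable_graphex G" and mp: "measure_preserving \<theta> (base G) \<pi>"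
begin

lemma measurable_graphex_pullback: "measurable_graphex (pullback \<theta> \<pi> G)"
proof -
  have \<pi>[measurable]: "\<pi> \<in> measurable \<theta> (base G)"
    using mp by (simp add: measure_preserving_def)
  note [measurable] = measurable_graphexD(2,3)[OF G]
  have "sigma_finite_measure \<theta>"
    using measure_preserving_sigma_finite[OF mp measurable_graphexD(1)[OF G]] .
  moreover have "(\<lambda>(p, q). kernel G (\<pi> p) (\<pi> q)) \<in> borel_measurable (\<theta> \<Otimes>\<^sub>M \<theta>)"
    by measurable
  moreover have "(\<lambda>p. star G (\<pi> p)) \<in> borel_measurable \<theta>"
    by measurable
  moreover have "\<pi> p \<in> space (base G)" if "p \<in> space \<theta>" for p
    using measurable_space[OF \<pi> that] .
  ultimately show ?thesis
    using measurable_graphexD(4-8)[OF G] by (auto simp: measurable_graphex_def graphon_def)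
qed

lemma nn_integral_pullback_kernel:
  assumes "p \<in> space \<theta>"
  shows "(\<integral>\<^sup>+q. ennreal (kernel G (\<pi> p) (\<pi> q)) \<partial>\<theta>) = (\<integral>\<^sup>+y. ennreal (kernel G (\<pi> p) y) \<partial>base G)"
proof -
  have \<pi>: "\<pi> \<in> measurable \<theta> (base G)"
    using mp by (simp add: measure_preserving_def)
  note [measurable] = measurable_graphexD(2)[OF G]
  have [simp]: "\<pi> p \<in> space (base G)"
    using measurable_space[OF \<pi> assms] .
  show ?thesis
    by (rule measure_preserving_nn_integral[OF mp]) simp
qed

lemma nmarg_pullback: "p \<in> space \<theta> \<Longrightarrow> nmarg (pullback \<theta> \<pi> G) p = nmarg G (\<pi> p)"
  by (simp add: nmarg_def nn_integral_pullback_kernel)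

lemma marginal_pullback: "p \<in> space \<theta> \<Longrightarrow> marginal (pullback \<theta> \<pi> G) p = marginal G (\<pi> p)"
proof -
  assume p: "p \<in> space \<theta>"
  have "\<pi> p \<in> space (base G)"
    using mp p by (auto simp: measure_preserving_def dest: measurable_space)
  then show ?thesis
    using p G by (simp add: marginal_eq measurable_graphex_pullback nn_integral_pullback_kernel)
qed

lemma rho_pullback: "rho (pullback \<theta> \<pi> G) = rho G"
proof -
  note [measurable] = measurable_graphexD(3)[OF G] measurable_nmarg[OF G]
  have "(\<integral>\<^sup>+p. nmarg (pullback \<theta> \<pi> G) p \<partial>\<theta>) = (\<integral>\<^sup>+p. nmarg G (\<pi> p) \<partial>\<theta>)"
    by (intro nn_integral_cong) (simp add: nmarg_pullback)
  also have "\<dots> = degree_mass G"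
    by (rule measure_preserving_nn_integral[OF mp]) simp
  finally show ?thesis
    using measure_preserving_nn_integral[OF mp, of "\<lambda>x. ennreal (star G x)"]
    by (simp add: rho_eq measurable_graphex_pullback G)
qed

end

text \<open>The double integral of W is finite by assumption, and S is dominated by the integrable
  marginal because the kernel part of the marginal is nonnegative.\<close>

lemma rho_finite_of_L1_L2:
  assumes "measurable_graphex G" "graphex_L1_L2 G"
  shows "rho G < \<infinity>"
proof -
  note [measurable] = measurable_graphexD(2,3)[OF assms(1)]
  have "integrable (base G \<Otimes>\<^sub>M base G) (case_prod (kernel G))" and m: "integrable (base G) (marginal G)"
    using assms(2) by (auto simp: graphex_L1_L2_def in_L1_L2_def)
  then have "(\<integral>\<^sup>+p. ennreal (norm (case_prod (kernel G) p)) \<partial>(base G \<Otimes>\<^sub>M base G)) < \<infinity>"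
    by (simp add: integrable_iff_bounded)
  also have "(\<integral>\<^sup>+p. ennreal (norm (case_prod (kernel G) p)) \<partial>(base G \<Otimes>\<^sub>M base G))
      = (\<integral>\<^sup>+p. ennreal (case_prod (kernel G) p) \<partial>(base G \<Otimes>\<^sub>M base G))"
    using measurable_graphexD(5)[OF assms(1)]
    by (intro nn_integral_cong) (auto simp: space_pair_measure)
  finally have 1: "(\<integral>\<^sup>+p. ennreal (case_prod (kernel G) p) \<partial>(base G \<Otimes>\<^sub>M base G)) < \<infinity>" .
  have "star_mass G \<le> (\<integral>\<^sup>+x. ennreal (norm (marginal G x)) \<partial>base G)"
    using star_le_marginal[OF assms(1)] by (intro nn_integral_mono ennreal_leI) force
  also have "\<dots> < \<infinity>"
    using m by (simp add: integrable_iff_bounded)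
  finally show ?thesis
    using 1 by (simp add: rho_def ennreal_mult_less_top)
qed

section \<open>Truncated degrees\<close>

definition capped :: "ennreal \<Rightarrow> 'a graphex \<Rightarrow> ennreal" where
  "capped \<delta> G = (\<integral>\<^sup>+x. min (nmarg G x) \<delta> \<partial>base G)"

definition degree_tail :: "real \<Rightarrow> 'a graphex \<Rightarrow> ennreal" where
  "degree_tail K G = (\<integral>\<^sup>+x. nmarg G x * indicator {x. nmarg G x > ennreal K} x \<partial>base G)"

lemma min_add_diff_ennreal: "min a b + (a - b) = (a :: ennreal)"
  by (cases a; cases b) (auto simp: min_def ennreal_minus ennreal_neg simp flip: ennreal_plus)

text \<open>Pointwise t = min(t, \<delta>) + (t - \<delta>)^+. The second term is the part that
  passes to the limit, the first is the part that may be lost there.\<close>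

lemma capped_add_excess:
  assumes "measurable_graphex G"
  shows "capped \<delta> G + excess \<delta> G = degree_mass G"
proof -
  note [measurable] = measurable_nmarg[OF assms]
  have "capped \<delta> G + excess \<delta> G = (\<integral>\<^sup>+x. min (nmarg G x) \<delta> + (nmarg G x - \<delta>) \<partial>base G)"
    unfolding capped_def excess_def by (rule nn_integral_add[symmetric]) simp_all
  then show ?thesis by (simp add: min_add_diff_ennreal)
qed

text \<open>Dominated convergence with the degree itself as majorant: at a point of finite degree
  the integrand is eventually 0.\<close>

lemma degree_tail_vanishes:
  assumes "measurable_graphex G" "rho G < \<infinity>" "0 < \<epsilon>"
  shows "\<exists>K\<ge>0. degree_tail K G < \<epsilon>"
proof -
  note [measurable] = measurable_nmarg[OF assms(1)]
  have "(\<lambda>k. \<integral>\<^sup>+x. nmarg G x * indicator {x. nmarg G x > ennreal (real k)} x \<partial>base G)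
      \<longlonglongrightarrow> (\<integral>\<^sup>+x. 0 \<partial>base G)"
  proof (rule nn_integral_dominated_convergence[where w = "nmarg G"])
    show "degree_mass G < \<infinity>"
      using assms(1,2) by (auto simp: rho_eq)
    show "AE x in base G. (\<lambda>k. nmarg G x * indicator {x. nmarg G x > ennreal (real k)} x) \<longlonglongrightarrow> 0"
      using AE_nmarg_finite[OF assms(1,2)]
    proof eventually_elim
      case (elim x)
      then obtain r where r: "nmarg G x = ennreal r" "0 \<le> r"
        by (cases "nmarg G x") auto
      have "\<forall>\<^sub>F k in sequentially. nmarg G x * indicator {x. nmarg G x > ennreal (real k)} x = 0"
        using eventually_ge_at_top[of "nat \<lceil>r\<rceil>"]
        by eventually_elim (use r in \<open>auto simp: indicator_def ennreal_less_iff\<close>)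
      then show ?case by (rule tendsto_eventually)
    qed
  qed (auto simp: indicator_def)
  then have "\<forall>\<^sub>F k in sequentially. degree_tail (real k) G < \<epsilon>"
    using assms(3) order_tendstoD(2) unfolding degree_tail_def by fastforce
  then obtain k where "degree_tail (real k) G < \<epsilon>"
    by (auto simp: eventually_sequentially)
  then show ?thesis by (intro exI[of _ "real k"]) simp
qed

text \<open>Dominated convergence along \<delta> = 1/(k+1). For a single graphex of finite mass this
  always holds; the issue later is to find one \<delta> for all large n.\<close>

lemma capped_vanishes:
  assumes "measurable_graphex G" "rho G < \<infinity>" "0 < \<epsilon>"
  shows "\<exists>\<delta>>0. capped (ennreal \<delta>) G < \<epsilon>"
proof -
  note [measurable] = measurable_nmarg[OF assms(1)]
  have "(\<lambda>k. \<integral>\<^sup>+x. min (nmarg G x) (ennreal (1 / real (Suc k))) \<partial>base G)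
      \<longlonglongrightarrow> (\<integral>\<^sup>+x. 0 \<partial>base G)"
  proof (rule nn_integral_dominated_convergence[where w = "nmarg G"])
    show "degree_mass G < \<infinity>"
      using assms(1,2) by (auto simp: rho_eq)
    have 0: "(\<lambda>k. ennreal (1 / real (Suc k))) \<longlonglongrightarrow> 0"
      using tendsto_ennrealI[OF LIMSEQ_inverse_real_of_nat] by (simp add: inverse_eq_divide)
    show "AE x in base G. (\<lambda>k. min (nmarg G x) (ennreal (1 / real (Suc k)))) \<longlonglongrightarrow> 0"
      by (intro AE_I2 tendsto_sandwich[OF _ _ tendsto_const 0] always_eventually) auto
  qed auto
  then have "\<forall>\<^sub>F k in sequentially. capped (ennreal (1 / real (Suc k))) G < \<epsilon>"
    using assms(3) order_tendstoD(2) unfolding capped_def by fastforce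
  then obtain k where "capped (ennreal (1 / real (Suc k))) G < \<epsilon>"
    by (auto simp: eventually_sequentially)
  then show ?thesis by (intro exI[of _ "1 / real (Suc k)"]) simp
qed

lemma capped_mono: "\<delta> \<le> \<delta>' \<Longrightarrow> capped \<delta> G \<le> capped \<delta>' G"
  unfolding capped_def by (intro nn_integral_mono min.mono) auto

lemma excess_antimono: "\<delta> \<le> \<delta>' \<Longrightarrow> excess \<delta>' G \<le> excess \<delta> G"
  unfolding excess_def by (intro nn_integral_mono ennreal_mono_minus)

text \<open>Translates uniform integrability, stated for \<open>marginal\<close>, into degrees; the
  bound on \<rho> makes the two agree almost everywhere.\<close>

lemma uniform_degree_tail:
  assumes "unif_integrable (range G)" "\<And>n. measurable_graphex (G n)"
  shows "\<exists>C::real. \<forall>n. rho (G n) \<le> ennreal C"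
    and "0 < \<epsilon> \<Longrightarrow> \<exists>K\<ge>0. \<forall>n. degree_tail K (G n) \<le> ennreal \<epsilon>"
proof -
  have sup: "(SUP n. rho (G n)) < \<infinity>"
    using assms(1) by (simp add: unif_integrable_def image_image)
  then obtain C where "(SUP n. rho (G n)) = ennreal C"
    by (cases "SUP n. rho (G n)") auto
  then show "\<exists>C::real. \<forall>n. rho (G n) \<le> ennreal C"
    by (metis SUP_upper UNIV_I)
  have fin: "rho (G n) < \<infinity>" for n
    using sup by (meson SUP_upper UNIV_I le_less_trans)
  assume "0 < \<epsilon>"
  then obtain D :: real where D: "(\<integral>\<^sup>+x. ennreal (marginal (G n) x * indicator {x. marginal (G n) x > D} x)
      \<partial>base (G n)) < ennreal \<epsilon>" for n
    using assms(1) unfolding unif_integrable_def by blast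
  \<comment> \<open>Raising the threshold to a nonnegative number only shrinks the tail, and it
    makes \<open>ennreal\<close> faithful on it.\<close>
  have "degree_tail (max D 0) (G n) \<le> ennreal \<epsilon>" for n
  proof -
    have "degree_tail (max D 0) (G n) \<le> (\<integral>\<^sup>+x. ennreal (marginal (G n) x * indicator {x. marginal (G n) x > D} x)
        \<partial>base (G n))"
      unfolding degree_tail_def
    proof (rule nn_integral_mono_AE)
      show "AE x in base (G n). nmarg (G n) x * indicator {x. nmarg (G n) x > ennreal (max D 0)} x
          \<le> ennreal (marginal (G n) x * indicator {x. marginal (G n) x > D} x)"
        using AE_nmarg_finite[OF assms(2) fin[of n]] AE_space
      proof eventually_elim
        case (elim x)
        then have "nmarg (G n) x = ennreal (marginal (G n) x)"
          using ennreal_marginal[OF assms(2)] by simp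
        moreover have "0 \<le> marginal (G n) x"
          using star_le_marginal[OF assms(2) elim(2)] by linarith
        ultimately show ?case
          by (auto simp: indicator_def ennreal_less_iff)
      qed
    qed
    with D[of n] show ?thesis by simp
  qed
  then show "\<exists>K\<ge>0. \<forall>n. degree_tail K (G n) \<le> ennreal \<epsilon>"
    by (intro exI[of _ "max D 0"]) simp
qed

section \<open>Removing a part \<alpha> of the base measure\<close>

context
  fixes G :: "'a graphex" and \<mu> \<alpha> :: "'a measure"
  assumes G: "measurable_graphex G"
    and sets_\<mu>: "sets \<mu> = sets (base G)" and sets_\<alpha>: "sets \<alpha> = sets (base G)"
    and add: "add_measure \<mu> \<alpha> = base G"
begin

lemma split_nn_integral:
  assumes "f \<in> borel_measurable (base G)"
  shows "(\<integral>\<^sup>+x. f x \<partial>base G) = (\<integral>\<^sup>+x. f x \<partial>\<mu>) + (\<integral>\<^sup>+x. f x \<partial>\<alpha>)"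
  using nn_integral_add_measure[of \<alpha> \<mu> f] assms sets_\<mu> sets_\<alpha> add
  by (simp cong: measurable_cong_sets)

lemma split_space: "space \<mu> = space (base G)" "space \<alpha> = space (base G)"
  using sets_\<mu> sets_\<alpha> by (auto dest: sets_eq_imp_space_eq)

lemma split_emeasure_le: "emeasure \<mu> A \<le> emeasure (base G) A" "emeasure \<alpha> A \<le> emeasure (base G) A"
  using emeasure_add_measure[of \<alpha> \<mu> A] sets_\<mu> sets_\<alpha> add by auto

lemma split_sigma_finite: "sigma_finite_measure \<mu>" "sigma_finite_measure \<alpha>"
  using sigma_finite_measure_mono[OF measurable_graphexD(1)[OF G]] sets_\<mu> sets_\<alpha> split_emeasure_le by auto

lemma split_measurable_graphex: "measurable_graphex (G\<lparr>base := \<mu>\<rparr>)"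
proof -
  have "sets (\<mu> \<Otimes>\<^sub>M \<mu>) = sets (base G \<Otimes>\<^sub>M base G)"
    by (intro sets_pair_measure_cong sets_\<mu>)
  then show ?thesis
    using G split_sigma_finite sets_\<mu>
    by (simp add: measurable_graphex_def graphon_def split_space cong: measurable_cong_sets)
qed

lemma split_nmarg:
  assumes "x \<in> space (base G)"
  shows "nmarg G x = nmarg (G\<lparr>base := \<mu>\<rparr>) x + (\<integral>\<^sup>+y. ennreal (kernel G x y) \<partial>\<alpha>)"
proof -
  note [measurable] = measurable_graphexD(2)[OF G]
  show ?thesis
    using assms by (subst nmarg_def) (simp add: split_nn_integral nmarg_def ac_simps)
qed

lemma split_nmarg_le: "x \<in> space (base G) \<Longrightarrow> nmarg (G\<lparr>base := \<mu>\<rparr>) x \<le> nmarg G x"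
  by (simp add: split_nmarg)

text \<open>As W \<le> 1, a point has at most the total mass of \<alpha> as degree into the removed
  part.\<close>

lemma split_nmarg_ge:
  assumes "x \<in> space (base G)"
  shows "nmarg G x \<le> nmarg (G\<lparr>base := \<mu>\<rparr>) x + emeasure \<alpha> (space (base G))"
proof -
  have "(\<integral>\<^sup>+y. ennreal (kernel G x y) \<partial>\<alpha>) \<le> (\<integral>\<^sup>+y. 1 \<partial>\<alpha>)"
    using measurable_graphexD(6)[OF G] assms
    by (intro nn_integral_mono) (auto simp: split_space)
  then show ?thesis
    using assms by (simp add: split_nmarg split_space add_left_mono)
qed

lemma split_rho_le: "rho (G\<lparr>base := \<mu>\<rparr>) \<le> rho G"
proof -
  note [measurable] = measurable_nmarg[OF G] measurable_graphexD(3)[OF G]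
  have "(\<integral>\<^sup>+x. nmarg (G\<lparr>base := \<mu>\<rparr>) x \<partial>\<mu>) \<le> (\<integral>\<^sup>+x. nmarg G x \<partial>\<mu>)"
    using split_nmarg_le by (intro nn_integral_mono) (auto simp: split_space)
  then show ?thesis
    by (simp add: rho_eq[OF G] rho_eq[OF split_measurable_graphex] split_nn_integral add_increasing2 add_mono)
qed

text \<open>Every lost edge has an endpoint in \<alpha>. Edges counted from the removed endpoint,
  together with one copy of S, cost \<integral> D d\<alpha>. Edges counted from the kept endpoint
  equal, by Tonelli and symmetry, the degrees of removed points into \<mu>; with the second copy of
  S they cost at most the same again.\<close>

lemma split_rho_ge: "rho G \<le> rho (G\<lparr>base := \<mu>\<rparr>) + 2 * (\<integral>\<^sup>+x. nmarg G x \<partial>\<alpha>)"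
proof -
  interpret \<mu>: sigma_finite_measure \<mu> by (rule split_sigma_finite)
  interpret \<alpha>: sigma_finite_measure \<alpha> by (rule split_sigma_finite)
  interpret pair_sigma_finite \<mu> \<alpha> ..
  let ?G = "G\<lparr>base := \<mu>\<rparr>"
  have [measurable]: "(\<lambda>(x, y). kernel G x y) \<in> borel_measurable (base G \<Otimes>\<^sub>M base G)"
    "star G \<in> borel_measurable (base G)"
    using measurable_graphexD[OF G] by auto
  have sets: "sets (\<mu> \<Otimes>\<^sub>M \<alpha>) = sets (base G \<Otimes>\<^sub>M base G)"
    by (intro sets_pair_measure_cong sets_\<mu> sets_\<alpha>)
  have [measurable]: "(\<lambda>(x, y). kernel G x y) \<in> borel_measurable (\<mu> \<Otimes>\<^sub>M \<alpha>)"
    by (subst measurable_cong_sets[OF sets refl]) simp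
  have [measurable]: "nmarg G \<in> borel_measurable \<mu>" "nmarg ?G \<in> borel_measurable \<mu>" "nmarg G \<in> borel_measurable (base G)"
    using measurable_nmarg[OF G] measurable_nmarg[OF split_measurable_graphex] sets_\<mu>
    by (simp_all cong: measurable_cong_sets)
  have "(\<integral>\<^sup>+x. nmarg G x \<partial>\<mu>) = (\<integral>\<^sup>+x. nmarg ?G x + (\<integral>\<^sup>+y. ennreal (kernel G x y) \<partial>\<alpha>) \<partial>\<mu>)"
    by (intro nn_integral_cong) (simp add: split_nmarg split_space)
  also have "\<dots> = (\<integral>\<^sup>+x. nmarg ?G x \<partial>\<mu>) + (\<integral>\<^sup>+x. \<integral>\<^sup>+y. ennreal (kernel G x y) \<partial>\<alpha> \<partial>\<mu>)"
    by (rule nn_integral_add) simp_all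
  also have "(\<integral>\<^sup>+x. \<integral>\<^sup>+y. ennreal (kernel G x y) \<partial>\<alpha> \<partial>\<mu>) = (\<integral>\<^sup>+y. \<integral>\<^sup>+x. ennreal (kernel G x y) \<partial>\<mu> \<partial>\<alpha>)"
    by (rule Fubini'[symmetric]) simp
  finally have 1: "(\<integral>\<^sup>+x. nmarg G x \<partial>\<mu>) = (\<integral>\<^sup>+x. nmarg ?G x \<partial>\<mu>) + (\<integral>\<^sup>+y. \<integral>\<^sup>+x. ennreal (kernel G x y) \<partial>\<mu> \<partial>\<alpha>)" .
  have [measurable]: "(\<lambda>y. \<integral>\<^sup>+x. ennreal (kernel G x y) \<partial>\<mu>) \<in> borel_measurable \<alpha>"
    by measurable
  have "(\<integral>\<^sup>+y. \<integral>\<^sup>+x. ennreal (kernel G x y) \<partial>\<mu> \<partial>\<alpha>) + (\<integral>\<^sup>+y. ennreal (star G y) \<partial>\<alpha>)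
      = (\<integral>\<^sup>+y. (\<integral>\<^sup>+x. ennreal (kernel G x y) \<partial>\<mu>) + ennreal (star G y) \<partial>\<alpha>)"
    using sets_\<alpha> by (intro nn_integral_add[symmetric]) (simp_all cong: measurable_cong_sets)
  also have "\<dots> = (\<integral>\<^sup>+y. nmarg ?G y \<partial>\<alpha>)"
  proof (rule nn_integral_cong)
    fix y assume "y \<in> space \<alpha>"
    then have "(\<integral>\<^sup>+x. ennreal (kernel G x y) \<partial>\<mu>) = (\<integral>\<^sup>+x. ennreal (kernel G y x) \<partial>\<mu>)"
      using measurable_graphexD(7)[OF G] by (intro nn_integral_cong) (auto simp: split_space)
    then show "(\<integral>\<^sup>+x. ennreal (kernel G x y) \<partial>\<mu>) + ennreal (star G y) = nmarg ?G y"
      by (simp add: nmarg_def)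
  qed
  also have "\<dots> \<le> (\<integral>\<^sup>+y. nmarg G y \<partial>\<alpha>)"
    using split_nmarg_le by (intro nn_integral_mono) (auto simp: split_space)
  finally have 2: "(\<integral>\<^sup>+y. \<integral>\<^sup>+x. ennreal (kernel G x y) \<partial>\<mu> \<partial>\<alpha>) + (\<integral>\<^sup>+y. ennreal (star G y) \<partial>\<alpha>) \<le> (\<integral>\<^sup>+y. nmarg G y \<partial>\<alpha>)" .
  have "rho G = rho ?G + (\<integral>\<^sup>+y. nmarg G y \<partial>\<alpha>)
      + ((\<integral>\<^sup>+y. \<integral>\<^sup>+x. ennreal (kernel G x y) \<partial>\<mu> \<partial>\<alpha>) + (\<integral>\<^sup>+y. ennreal (star G y) \<partial>\<alpha>))"
    by (simp add: rho_eq[OF G] rho_eq[OF split_measurable_graphex] split_nn_integral 1 ac_simps)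
  also have "\<dots> \<le> rho ?G + (\<integral>\<^sup>+y. nmarg G y \<partial>\<alpha>) + (\<integral>\<^sup>+y. nmarg G y \<partial>\<alpha>)"
    using 2 by (rule add_left_mono)
  finally show ?thesis
    by (simp add: mult_2 ac_simps)
qed

lemma split_excess_le: "excess \<delta> (G\<lparr>base := \<mu>\<rparr>) \<le> excess \<delta> G"
proof -
  note [measurable] = measurable_nmarg[OF G]
  have "excess \<delta> (G\<lparr>base := \<mu>\<rparr>) \<le> (\<integral>\<^sup>+x. nmarg G x - \<delta> \<partial>\<mu>)"
    unfolding excess_def using split_nmarg_le by (auto intro!: nn_integral_mono ennreal_minus_mono simp: split_space)
  then show ?thesis
    by (simp add: excess_def split_nn_integral add_increasing2)
qed

text \<open>On the kept part degrees drop by at most r, which the higher threshold compensates; on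
  the removed part the excess is bounded by the degree.\<close>

lemma split_excess_ge:
  assumes "emeasure \<alpha> (space (base G)) \<le> r" "\<delta> \<noteq> top" "r \<noteq> top"
  shows "excess (\<delta> + r) G \<le> excess \<delta> (G\<lparr>base := \<mu>\<rparr>) + (\<integral>\<^sup>+x. nmarg G x \<partial>\<alpha>)"
proof -
  note [measurable] = measurable_nmarg[OF G]
  have "(\<integral>\<^sup>+x. nmarg G x - (\<delta> + r) \<partial>\<mu>) \<le> excess \<delta> (G\<lparr>base := \<mu>\<rparr>)"
    unfolding excess_def graphex.select_convs graphex.update_convs
  proof (rule order_trans[OF nn_integral_mono])
    fix x assume "x \<in> space \<mu>"
    then have "nmarg G x \<le> nmarg (G\<lparr>base := \<mu>\<rparr>) x + r"
      using split_nmarg_ge[of x] assms split_space by (auto intro: order_trans add_left_mono)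
    also have "\<dots> = min (nmarg (G\<lparr>base := \<mu>\<rparr>) x) \<delta> + (nmarg (G\<lparr>base := \<mu>\<rparr>) x - \<delta>) + r"
      by (simp only: min_add_diff_ennreal)
    also have "\<dots> \<le> \<delta> + (nmarg (G\<lparr>base := \<mu>\<rparr>) x - \<delta>) + r"
      by (intro add_right_mono) simp
    finally show "nmarg G x - (\<delta> + r) \<le> nmarg (G\<lparr>base := \<mu>\<rparr>) x - \<delta>"
      using assms(2,3) by (simp add: ennreal_minus_le_iff ac_simps)
  qed simp
  moreover have "(\<integral>\<^sup>+x. nmarg G x - (\<delta> + r) \<partial>\<alpha>) \<le> (\<integral>\<^sup>+x. nmarg G x \<partial>\<alpha>)"
    by (intro nn_integral_mono) (simp add: diff_le_self_ennreal)
  ultimately show ?thesis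
    by (subst excess_def) (simp add: split_nn_integral add_mono)
qed

text \<open>Pointwise D is at most K plus its part above K. The constant is integrated against the
  small measure \<alpha>, the tail against the whole base; this is where uniform integrability pays
  for the removed mass.\<close>

lemma split_loss:
  assumes "emeasure \<alpha> (space (base G)) \<le> r"
  shows "(\<integral>\<^sup>+x. nmarg G x \<partial>\<alpha>) \<le> ennreal K * r + degree_tail K G"
proof -
  have [measurable]: "nmarg G \<in> borel_measurable (base G)" "nmarg G \<in> borel_measurable \<alpha>"
    using measurable_nmarg[OF G] sets_\<alpha> by (simp_all cong: measurable_cong_sets)
  have "(\<integral>\<^sup>+x. nmarg G x \<partial>\<alpha>) \<le> (\<integral>\<^sup>+x. ennreal K + nmarg G x * indicator {x. nmarg G x > ennreal K} x \<partial>\<alpha>)"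
    by (intro nn_integral_mono) (auto simp: indicator_def)
  also have "\<dots> = ennreal K * emeasure \<alpha> (space \<alpha>) + (\<integral>\<^sup>+x. nmarg G x * indicator {x. nmarg G x > ennreal K} x \<partial>\<alpha>)"
    by (subst nn_integral_add) auto
  also have "\<dots> \<le> ennreal K * r + degree_tail K G"
    using assms by (intro add_mono mult_left_mono) (auto simp: degree_tail_def split_nn_integral split_space)
  finally show ?thesis .
qed

end

section \<open>Consequences of closeness in the weak kernel metric\<close>

lemma measure_between_mono:
  assumes "measure_between M r \<nu>" "r \<le> r'"
  shows "measure_between M r' \<nu>"
  using assms unfolding measure_between_def
  by (meson ennreal_leI ennreal_mono_minus order_trans)

lemma d_2_2_nonneg: "0 \<le> d_2_2 G H"
  unfolding d_2_2_def by (simp add: L2_nrm_def le_max_iff_disj)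

lemma ennreal_le_add_of_enn2real:
  assumes "a < \<infinity>" "b < \<infinity>" "\<bar>enn2real a - enn2real b\<bar> \<le> e"
  shows "a \<le> b + ennreal e"
proof -
  have "a = ennreal (enn2real a)"
    using assms(1) by simp
  also have "\<dots> \<le> ennreal (enn2real b + e)"
    using assms(3) by (intro ennreal_leI) linarith
  also have "\<dots> = b + ennreal e"
    using assms by (subst ennreal_plus) auto
  finally show ?thesis .
qed

text \<open>Ensures that the Bochner integral inside \<open>L2_nrm\<close> is a true integral along
  the coupling and not the default value 0.\<close>

lemma nn_integral_marginal_sq:
  assumes "measurable_graphex G" "graphex_L1_L2 G" "measure_preserving \<theta> (ext_space (base G)) \<pi>"
  shows "(\<integral>\<^sup>+p. ennreal ((marginal (ext_graphex G) (\<pi> p))\<^sup>2) \<partial>\<theta>) < \<infinity>"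
proof -
  have [measurable]: "marginal (ext_graphex G) \<in> borel_measurable (ext_space (base G))"
    "marginal G \<in> borel_measurable (base G)"
    using measurable_marginal[OF measurable_graphex_ext[OF assms(1)]] measurable_marginal[OF assms(1)] by simp_all
  have "(\<integral>\<^sup>+p. ennreal ((marginal (ext_graphex G) (\<pi> p))\<^sup>2) \<partial>\<theta>)
      = (\<integral>\<^sup>+p. ennreal ((marginal (ext_graphex G) p)\<^sup>2) \<partial>ext_space (base G))"
    by (rule measure_preserving_nn_integral[OF assms(3)]) simp
  also have "\<dots> = (\<integral>\<^sup>+x. ennreal ((marginal G x)\<^sup>2) \<partial>base G)"
    using assms(1) by (subst nn_integral_ext_space) (auto simp: marginal_ext intro!: nn_integral_cong)
  also have "\<dots> < \<infinity>"
    using assms(2) by (simp add: graphex_L1_L2_def in_L1_L2_def integrable_iff_bounded)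
  finally show ?thesis .
qed

text \<open>Unpacks the infima: the witness c' lies strictly below c, so there is a coupling whose
  distance is still below c. The exponents undo the roots in the metric: 3 for the cube root on
  \<rho>, and 4 because the square root of an L^2 norm is a fourth root of an integral.\<close>

lemma delta_diamond_couplingE:
  assumes G: "measurable_graphex G" and H: "measurable_graphex H"
    and less: "delta_diamond G H < ereal c"
  obtains \<mu> \<alpha> \<nu> \<beta> \<theta> where
    "sets \<mu> = sets (base G)" "sets \<alpha> = sets (base G)" "add_measure \<mu> \<alpha> = base G"
    "emeasure \<alpha> (space (base G)) \<le> ennreal (c\<^sup>2)"
    "sets \<nu> = sets (base H)" "sets \<beta> = sets (base H)" "add_measure \<nu> \<beta> = base H"
    "emeasure \<beta> (space (base H)) \<le> ennreal (c\<^sup>2)"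
    "\<theta> \<in> couplings (ext_space \<mu>) (ext_space \<nu>)"
    "rho (G\<lparr>base := \<mu>\<rparr>) < \<infinity>" "rho (H\<lparr>base := \<nu>\<rparr>) < \<infinity>"
    "rho (G\<lparr>base := \<mu>\<rparr>) \<le> rho (H\<lparr>base := \<nu>\<rparr>) + ennreal (c ^ 3)"
    "rho (H\<lparr>base := \<nu>\<rparr>) \<le> rho (G\<lparr>base := \<mu>\<rparr>) + ennreal (c ^ 3)"
    "(\<integral>\<^sup>+p. ennreal ((marginal (ext_graphex (G\<lparr>base := \<mu>\<rparr>)) (fst p)
        - marginal (ext_graphex (H\<lparr>base := \<nu>\<rparr>)) (snd p))\<^sup>2) \<partial>\<theta>) \<le> ennreal (c ^ 4)"
    "norm_2_2 \<theta> (\<lambda>p q. ext_kernel (kernel G) (fst p) (fst q) - ext_kernel (kernel H) (snd p) (snd q)) \<le> ereal c"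
proof -
  obtain c' \<mu> \<nu> where c': "c' < c"
    and mb: "measure_between (base G) (c'\<^sup>2) \<mu>" "measure_between (base H) (c'\<^sup>2) \<nu>"
    and L: "graphex_L1_L2 (G\<lparr>base := \<mu>\<rparr>)" "graphex_L1_L2 (H\<lparr>base := \<nu>\<rparr>)"
    and le: "delta_2_2 (G\<lparr>base := \<mu>\<rparr>) (H\<lparr>base := \<nu>\<rparr>) \<le> ereal c'"
    using less unfolding delta_diamond_def Inf_less_iff by auto
  let ?G = "G\<lparr>base := \<mu>\<rparr>" and ?H = "H\<lparr>base := \<nu>\<rparr>"
  \<comment> \<open>The definition of \<open>delta_diamond\<close> admits any real c'. Nonnegativity
    of the distance excludes negative ones, whose squares could exceed c^2.\<close>
  have "0 \<le> delta_2_2 ?G ?H"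
    unfolding delta_2_2_def delta_tilde_2_2_def by (intro INF_greatest d_2_2_nonneg)
  then have "0 \<le> ereal c'" using le by (rule order_trans)
  then have c'0: "0 \<le> c'" by simp
  then have sq: "c'\<^sup>2 \<le> c\<^sup>2"
    using c' by (intro power_mono) auto
  obtain \<alpha> where \<alpha>: "sets \<alpha> = sets (base G)" "emeasure \<alpha> (space (base G)) \<le> ennreal (c\<^sup>2)" "add_measure \<mu> \<alpha> = base G"
    by (rule measure_between_split[OF measurable_graphexD(1)[OF G] measure_between_mono[OF mb(1) sq]])
  obtain \<beta> where \<beta>: "sets \<beta> = sets (base H)" "emeasure \<beta> (space (base H)) \<le> ennreal (c\<^sup>2)" "add_measure \<nu> \<beta> = base H"
    by (rule measure_between_split[OF measurable_graphexD(1)[OF H] measure_between_mono[OF mb(2) sq]])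
  have sets: "sets \<mu> = sets (base G)" "sets \<nu> = sets (base H)"
    using mb by (auto simp: measure_between_def)
  have mG: "measurable_graphex ?G" and mH: "measurable_graphex ?H"
    using split_measurable_graphex[OF G sets(1) \<alpha>(1,3)] split_measurable_graphex[OF H sets(2) \<beta>(1,3)] .
  have "delta_2_2 ?G ?H < ereal c"
    using le c' by (simp add: le_less_trans)
  then obtain \<theta> where \<theta>: "\<theta> \<in> couplings (ext_space \<mu>) (ext_space \<nu>)"
    and d: "d_2_2 (pullback \<theta> fst (ext_graphex ?G)) (pullback \<theta> snd (ext_graphex ?H)) < ereal c"
    unfolding delta_2_2_def delta_tilde_2_2_def INF_less_iff by auto
  note mp = coupling_measure_preserving[OF \<theta>]
  have emG: "measurable_graphex (ext_graphex ?G)" and emH: "measurable_graphex (ext_graphex ?H)"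
    using mG mH by (auto intro: measurable_graphex_ext)
  have mp': "measure_preserving \<theta> (base (ext_graphex ?G)) fst" "measure_preserving \<theta> (base (ext_graphex ?H)) snd"
    using mp by simp_all
  note rho_simps = rho_pullback[OF emG mp'(1)] rho_pullback[OF emH mp'(2)] rho_ext[OF mG] rho_ext[OF mH]
  have fin: "rho ?G < \<infinity>" "rho ?H < \<infinity>"
    using rho_finite_of_L1_L2 mG mH L by auto
  have "ereal (root 3 \<bar>enn2real (rho ?G) - enn2real (rho ?H)\<bar>) \<le> ereal c"
    using d unfolding d_2_2_def rho_simps by simp
  then have "root 3 \<bar>enn2real (rho ?G) - enn2real (rho ?H)\<bar> ^ 3 \<le> c ^ 3"
    by (intro power_mono) (auto simp: real_root_pow_pos2)
  then have "\<bar>enn2real (rho ?G) - enn2real (rho ?H)\<bar> \<le> c ^ 3"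
    by (simp add: odd_real_root_pow)
  then have r: "rho ?G \<le> rho ?H + ennreal (c ^ 3)" "rho ?H \<le> rho ?G + ennreal (c ^ 3)"
    using fin by (auto intro!: ennreal_le_add_of_enn2real simp: abs_minus_commute)
  let ?f = "\<lambda>p. marginal (ext_graphex ?G) (fst p)" and ?g = "\<lambda>p. marginal (ext_graphex ?H) (snd p)"
  have [measurable]: "marginal (ext_graphex ?G) \<in> borel_measurable (ext_space \<mu>)"
    "marginal (ext_graphex ?H) \<in> borel_measurable (ext_space \<nu>)"
    "fst \<in> measurable \<theta> (ext_space \<mu>)" "snd \<in> measurable \<theta> (ext_space \<nu>)"
    using measurable_marginal[OF emG] measurable_marginal[OF emH] mp by (simp_all add: measure_preserving_def)
  have int: "integrable \<theta> (\<lambda>p. (?f p)\<^sup>2)" "integrable \<theta> (\<lambda>p. (?g p)\<^sup>2)"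
    using nn_integral_marginal_sq[OF mG L(1), of \<theta> fst] nn_integral_marginal_sq[OF mH L(2), of \<theta> snd] mp
    by (auto intro!: integrableI_bounded)
  \<comment> \<open>Without integrability the Bochner integral would be 0 by default, and its bound
    would say nothing about the nonnegative integral.\<close>
  have "integrable \<theta> (\<lambda>p. (?f p - ?g p)\<^sup>2)"
  proof (rule Bochner_Integration.integrable_bound)
    show "integrable \<theta> (\<lambda>p. 2 * (?f p)\<^sup>2 + 2 * (?g p)\<^sup>2)"
      using int by simp
    have "(a - b)\<^sup>2 \<le> 2 * a\<^sup>2 + 2 * b\<^sup>2" for a b :: real
      using zero_le_power2[of "a + b"] by (simp add: power2_sum power2_diff)
    then show "AE p in \<theta>. norm ((?f p - ?g p)\<^sup>2) \<le> norm (2 * (?f p)\<^sup>2 + 2 * (?g p)\<^sup>2)"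
      by simp
  qed simp
  then have eq: "(\<integral>\<^sup>+p. ennreal ((?f p - ?g p)\<^sup>2) \<partial>\<theta>) = ennreal (\<integral>p. (?f p - ?g p)\<^sup>2 \<partial>\<theta>)"
    by (rule nn_integral_eq_integral) simp
  have "L2_nrm \<theta> (\<lambda>p. marginal (pullback \<theta> fst (ext_graphex ?G)) p - marginal (pullback \<theta> snd (ext_graphex ?H)) p)
      = L2_nrm \<theta> (\<lambda>p. ?f p - ?g p)"
    unfolding L2_nrm_def
    by (intro arg_cong[where f = sqrt] Bochner_Integration.integral_cong refl)
      (simp add: marginal_pullback[OF emG mp'(1)] marginal_pullback[OF emH mp'(2)])
  then have "ereal (sqrt (L2_nrm \<theta> (\<lambda>p. ?f p - ?g p))) \<le> ereal c"
    using d unfolding d_2_2_def by simp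
  then have "sqrt (sqrt (\<integral>p. (?f p - ?g p)\<^sup>2 \<partial>\<theta>)) ^ 4 \<le> c ^ 4"
    by (intro power_mono) (auto simp: L2_nrm_def)
  moreover have "sqrt (sqrt x) ^ 4 = x" if "0 \<le> x" for x
    using that power_mult[of "sqrt (sqrt x)" 2 2] by simp
  ultimately have "(\<integral>p. (?f p - ?g p)\<^sup>2 \<partial>\<theta>) \<le> c ^ 4"
    by simp
  then have m: "(\<integral>\<^sup>+p. ennreal ((?f p - ?g p)\<^sup>2) \<partial>\<theta>) \<le> ennreal (c ^ 4)"
    unfolding eq by (rule ennreal_leI)
  have "norm_2_2 \<theta> (\<lambda>p q. ext_kernel (kernel G) (fst p) (fst q) - ext_kernel (kernel H) (snd p) (snd q)) \<le> ereal c"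
    using d unfolding d_2_2_def by (simp add: less_imp_le)
  then show ?thesis
    using that[OF sets(1) \<alpha>(1,3,2) sets(2) \<beta>(1,3,2) \<theta> fin r m] by blast
qed

text \<open>The projection preserves measure, finite \<rho> replaces \<open>marginal\<close> by
  \<open>nmarg\<close> almost everywhere, and the adjoined line has degree 0.\<close>

lemma excess_coupling:
  assumes G: "measurable_graphex G" "rho G < \<infinity>" and mp: "measure_preserving \<theta> (ext_space (base G)) \<pi>"
  shows "(\<integral>\<^sup>+p. (ennreal (marginal (ext_graphex G) (\<pi> p)) - \<delta>) \<partial>\<theta>) = excess \<delta> G"
proof -
  let ?E = "ext_graphex G"
  have E: "measurable_graphex ?E" "rho ?E < \<infinity>"
    using G by (auto simp: measurable_graphex_ext rho_ext)
  have [measurable]: "marginal ?E \<in> borel_measurable (ext_space (base G))"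
    using measurable_marginal[OF E(1)] by simp
  have "(\<integral>\<^sup>+p. (ennreal (marginal ?E (\<pi> p)) - \<delta>) \<partial>\<theta>) = (\<integral>\<^sup>+p. (ennreal (marginal ?E p) - \<delta>) \<partial>ext_space (base G))"
    by (rule measure_preserving_nn_integral[OF mp]) simp
  also have "\<dots> = excess \<delta> ?E"
    unfolding excess_def ext_graphex_sel
  proof (rule nn_integral_cong_AE)
    show "AE p in ext_space (base G). ennreal (marginal ?E p) - \<delta> = nmarg ?E p - \<delta>"
      using AE_nmarg_finite[OF E] AE_space unfolding ext_graphex_sel
      by eventually_elim (use ennreal_marginal[OF E(1)] in auto)
  qed
  finally show ?thesis
    by (simp add: excess_ext G(1))
qed

text \<open>The pointwise estimate is \<open>\<bar>u\<bar> \<le> \<delta>/2 + u\<^sup>2/(2 \<delta>)\<close>.\<close>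

lemma truncated_L2_close:
  fixes f g :: "'a \<Rightarrow> real"
  assumes [measurable]: "f \<in> borel_measurable M" "g \<in> borel_measurable M"
    and "0 < \<delta>" and e: "(\<integral>\<^sup>+x. ennreal ((f x - g x)\<^sup>2) \<partial>M) \<le> ennreal e" and "0 \<le> e"
  shows "(\<integral>\<^sup>+x. (ennreal (f x) - ennreal \<delta>) \<partial>M) \<le> (\<integral>\<^sup>+x. (ennreal (g x) - ennreal (\<delta> / 2)) \<partial>M) + ennreal (e / (2 * \<delta>))"
proof -
  have pt: "ennreal (a - \<delta>) \<le> ennreal (b - \<delta> / 2) + ennreal (1 / (2 * \<delta>)) * ennreal ((a - b)\<^sup>2)" for a b :: real
  proof -
    have "0 \<le> (a - b - \<delta>)\<^sup>2 / (2 * \<delta>)"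
      using \<open>0 < \<delta>\<close> by simp
    also have "\<dots> = (a - b)\<^sup>2 / (2 * \<delta>) - (a - b) + \<delta> / 2"
      using \<open>0 < \<delta>\<close> by (simp add: power2_eq_square field_simps)
    finally have "a - \<delta> \<le> max 0 (b - \<delta> / 2) + (a - b)\<^sup>2 / (2 * \<delta>)"
      by linarith
    then have "ennreal (a - \<delta>) \<le> ennreal (max 0 (b - \<delta> / 2) + (a - b)\<^sup>2 / (2 * \<delta>))"
      by (rule ennreal_leI)
    also have "\<dots> = ennreal (max 0 (b - \<delta> / 2)) + ennreal (1 / (2 * \<delta>)) * ennreal ((a - b)\<^sup>2)"
      using \<open>0 < \<delta>\<close> by (subst ennreal_plus) (auto simp flip: ennreal_mult)
    finally show ?thesis
      by (simp add: max_def ennreal_neg split: if_splits)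
  qed
  have sub: "ennreal a - ennreal d = ennreal (a - d)" if "0 < d" for a d
    using that by (cases "0 \<le> a") (auto simp: ennreal_minus ennreal_neg)
  have "(\<integral>\<^sup>+x. (ennreal (f x) - ennreal \<delta>) \<partial>M)
      \<le> (\<integral>\<^sup>+x. (ennreal (g x) - ennreal (\<delta> / 2)) + ennreal (1 / (2 * \<delta>)) * ennreal ((f x - g x)\<^sup>2) \<partial>M)"
    using pt \<open>0 < \<delta>\<close> by (intro nn_integral_mono) (simp add: sub)
  also have "\<dots> = (\<integral>\<^sup>+x. (ennreal (g x) - ennreal (\<delta> / 2)) \<partial>M)
      + ennreal (1 / (2 * \<delta>)) * (\<integral>\<^sup>+x. ennreal ((f x - g x)\<^sup>2) \<partial>M)"
    by (simp add: nn_integral_add nn_integral_cmult)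
  also have "\<dots> \<le> (\<integral>\<^sup>+x. (ennreal (g x) - ennreal (\<delta> / 2)) \<partial>M) + ennreal (1 / (2 * \<delta>)) * ennreal e"
    using e by (intro add_left_mono mult_left_mono) auto
  also have "ennreal (1 / (2 * \<delta>)) * ennreal e = ennreal (e / (2 * \<delta>))"
    using assms by (simp flip: ennreal_mult)
  finally show ?thesis .
qed

text \<open>Each bound descends from one graphex to its submeasure, crosses the coupling, and climbs
  back to the full second graphex. The climb is free by monotonicity, so the only tail that enters
  is that of the graphex on the left.\<close>

lemma delta_diamond_bounds:
  assumes G: "measurable_graphex G" and H: "measurable_graphex H"
    and less: "delta_diamond G H < ereal c" and "0 < \<delta>"
  shows "rho G \<le> rho H + ennreal (c ^ 3) + 2 * (ennreal K * ennreal (c\<^sup>2) + degree_tail K G)"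
    and "rho H \<le> rho G + ennreal (c ^ 3) + 2 * (ennreal K * ennreal (c\<^sup>2) + degree_tail K H)"
    and "excess (ennreal \<delta> + ennreal (c\<^sup>2)) G
      \<le> excess (ennreal (\<delta> / 2)) H + ennreal (c ^ 4 / (2 * \<delta>)) + (ennreal K * ennreal (c\<^sup>2) + degree_tail K G)"
    and "excess (ennreal \<delta> + ennreal (c\<^sup>2)) H
      \<le> excess (ennreal (\<delta> / 2)) G + ennreal (c ^ 4 / (2 * \<delta>)) + (ennreal K * ennreal (c\<^sup>2) + degree_tail K H)"
proof -
  obtain \<mu> \<alpha> \<nu> \<beta> \<theta> where G_split: "sets \<mu> = sets (base G)" "sets \<alpha> = sets (base G)" "add_measure \<mu> \<alpha> = base G"
    and \<alpha>: "emeasure \<alpha> (space (base G)) \<le> ennreal (c\<^sup>2)"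
    and H_split: "sets \<nu> = sets (base H)" "sets \<beta> = sets (base H)" "add_measure \<nu> \<beta> = base H"
    and \<beta>: "emeasure \<beta> (space (base H)) \<le> ennreal (c\<^sup>2)"
    and \<theta>: "\<theta> \<in> couplings (ext_space \<mu>) (ext_space \<nu>)"
    and fin: "rho (G\<lparr>base := \<mu>\<rparr>) < \<infinity>" "rho (H\<lparr>base := \<nu>\<rparr>) < \<infinity>"
    and r1: "rho (G\<lparr>base := \<mu>\<rparr>) \<le> rho (H\<lparr>base := \<nu>\<rparr>) + ennreal (c ^ 3)"
    and r2: "rho (H\<lparr>base := \<nu>\<rparr>) \<le> rho (G\<lparr>base := \<mu>\<rparr>) + ennreal (c ^ 3)"
    and m: "(\<integral>\<^sup>+p. ennreal ((marginal (ext_graphex (G\<lparr>base := \<mu>\<rparr>)) (fst p)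
        - marginal (ext_graphex (H\<lparr>base := \<nu>\<rparr>)) (snd p))\<^sup>2) \<partial>\<theta>) \<le> ennreal (c ^ 4)"
    by (rule delta_diamond_couplingE[OF G H less])
  let ?G = "G\<lparr>base := \<mu>\<rparr>" and ?H = "H\<lparr>base := \<nu>\<rparr>"
  let ?f = "\<lambda>p. marginal (ext_graphex ?G) (fst p)" and ?g = "\<lambda>p. marginal (ext_graphex ?H) (snd p)"
  note Gs = G G_split and Hs = H H_split
  have mG: "measurable_graphex ?G" and mH: "measurable_graphex ?H"
    using split_measurable_graphex[OF Gs] split_measurable_graphex[OF Hs] .
  note mp = coupling_measure_preserving[OF \<theta>]
  note lossG = split_loss[OF Gs \<alpha>, of K] and lossH = split_loss[OF Hs \<beta>, of K]
  have "rho G \<le> rho ?G + 2 * (\<integral>\<^sup>+x. nmarg G x \<partial>\<alpha>)"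
    by (rule split_rho_ge[OF Gs])
  also have "\<dots> \<le> (rho H + ennreal (c ^ 3)) + 2 * (ennreal K * ennreal (c\<^sup>2) + degree_tail K G)"
    using r1 split_rho_le[OF Hs] by (intro add_mono mult_left_mono lossG) (auto intro: order_trans add_right_mono)
  finally show "rho G \<le> rho H + ennreal (c ^ 3) + 2 * (ennreal K * ennreal (c\<^sup>2) + degree_tail K G)" .
  have "rho H \<le> rho ?H + 2 * (\<integral>\<^sup>+x. nmarg H x \<partial>\<beta>)"
    by (rule split_rho_ge[OF Hs])
  also have "\<dots> \<le> (rho G + ennreal (c ^ 3)) + 2 * (ennreal K * ennreal (c\<^sup>2) + degree_tail K H)"
    using r2 split_rho_le[OF Gs] by (intro add_mono mult_left_mono lossH) (auto intro: order_trans add_right_mono)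
  finally show "rho H \<le> rho G + ennreal (c ^ 3) + 2 * (ennreal K * ennreal (c\<^sup>2) + degree_tail K H)" .
  have [measurable]: "marginal (ext_graphex ?G) \<in> borel_measurable (ext_space \<mu>)"
    "marginal (ext_graphex ?H) \<in> borel_measurable (ext_space \<nu>)"
    "fst \<in> measurable \<theta> (ext_space \<mu>)" "snd \<in> measurable \<theta> (ext_space \<nu>)"
    using measurable_marginal[OF measurable_graphex_ext[OF mG]] measurable_marginal[OF measurable_graphex_ext[OF mH]] mp
    by (simp_all add: measure_preserving_def)
  have excessG: "(\<integral>\<^sup>+p. (ennreal (?f p) - d) \<partial>\<theta>) = excess d ?G" for d
    using excess_coupling[OF mG fin(1), of \<theta> fst] mp by simp
  have excessH: "(\<integral>\<^sup>+p. (ennreal (?g p) - d) \<partial>\<theta>) = excess d ?H" for d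
    using excess_coupling[OF mH fin(2), of \<theta> snd] mp by simp
  have fg: "?f \<in> borel_measurable \<theta>" "?g \<in> borel_measurable \<theta>"
    by measurable
  have c4: "0 \<le> c ^ 4" by simp
  have GH: "excess (ennreal \<delta>) ?G \<le> excess (ennreal (\<delta> / 2)) ?H + ennreal (c ^ 4 / (2 * \<delta>))"
    using truncated_L2_close[OF fg \<open>0 < \<delta>\<close> m c4] unfolding excessG excessH .
  have "(\<integral>\<^sup>+p. ennreal ((?g p - ?f p)\<^sup>2) \<partial>\<theta>) \<le> ennreal (c ^ 4)"
    using m by (simp add: power2_commute)
  from truncated_L2_close[OF fg(2,1) \<open>0 < \<delta>\<close> this c4]
  have HG: "excess (ennreal \<delta>) ?H \<le> excess (ennreal (\<delta> / 2)) ?G + ennreal (c ^ 4 / (2 * \<delta>))"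
    unfolding excessG excessH .
  have "excess (ennreal \<delta> + ennreal (c\<^sup>2)) G \<le> excess (ennreal \<delta>) ?G + (\<integral>\<^sup>+x. nmarg G x \<partial>\<alpha>)"
    by (rule split_excess_ge[OF Gs \<alpha>]) simp_all
  also have "\<dots> \<le> (excess (ennreal (\<delta> / 2)) H + ennreal (c ^ 4 / (2 * \<delta>))) + (ennreal K * ennreal (c\<^sup>2) + degree_tail K G)"
    using split_excess_le[OF Hs] by (intro add_mono[OF order_trans[OF GH] lossG] add_right_mono)
  finally show "excess (ennreal \<delta> + ennreal (c\<^sup>2)) G
      \<le> excess (ennreal (\<delta> / 2)) H + ennreal (c ^ 4 / (2 * \<delta>)) + (ennreal K * ennreal (c\<^sup>2) + degree_tail K G)" .
  have "excess (ennreal \<delta> + ennreal (c\<^sup>2)) H \<le> excess (ennreal \<delta>) ?H + (\<integral>\<^sup>+x. nmarg H x \<partial>\<beta>)"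
    by (rule split_excess_ge[OF Hs \<beta>]) simp_all
  also have "\<dots> \<le> (excess (ennreal (\<delta> / 2)) G + ennreal (c ^ 4 / (2 * \<delta>))) + (ennreal K * ennreal (c\<^sup>2) + degree_tail K H)"
    using split_excess_le[OF Gs] by (intro add_mono[OF order_trans[OF HG] lossH] add_right_mono)
  finally show "excess (ennreal \<delta> + ennreal (c\<^sup>2)) H
      \<le> excess (ennreal (\<delta> / 2)) G + ennreal (c ^ 4 / (2 * \<delta>)) + (ennreal K * ennreal (c\<^sup>2) + degree_tail K H)" .
qed

section \<open>Degree tails and the limit graphex\<close>

text \<open>The limit is not assumed to have finite mass, so no degree tail of it is available yet
  to pay for the removed part. Its degrees are therefore truncated; for each fixed truncation c
  tends to 0, and only then does the truncation exhaust the degree.\<close>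

lemma rho_limit_finite:
  assumes G: "\<And>n. measurable_graphex (G n)" and H: "measurable_graphex H"
    and C: "\<And>n. rho (G n) \<le> ennreal C"
    and lim: "(\<lambda>n. delta_diamond (G n) H) \<longlonglongrightarrow> 0"
  shows "rho H < \<infinity>"
proof -
  have split: "\<exists>\<nu> \<beta>. sets \<nu> = sets (base H) \<and> sets \<beta> = sets (base H) \<and> add_measure \<nu> \<beta> = base H
      \<and> emeasure \<beta> (space (base H)) \<le> ennreal (c\<^sup>2) \<and> rho (H\<lparr>base := \<nu>\<rparr>) \<le> ennreal C + ennreal (c ^ 3)"
    if "0 < c" for c
  proof -
    have "\<forall>\<^sub>F n in sequentially. delta_diamond (G n) H < ereal c"
      using lim that by (intro order_tendstoD(2)[OF lim]) simp
    then obtain n where n: "delta_diamond (G n) H < ereal c"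
      by (auto simp: eventually_sequentially)
    obtain \<mu> \<alpha> \<nu> \<beta> where 1: "sets \<mu> = sets (base (G n))" "sets \<alpha> = sets (base (G n))" "add_measure \<mu> \<alpha> = base (G n)"
      and 2: "sets \<nu> = sets (base H)" "sets \<beta> = sets (base H)" "add_measure \<nu> \<beta> = base H"
        "emeasure \<beta> (space (base H)) \<le> ennreal (c\<^sup>2)"
      and r: "rho (H\<lparr>base := \<nu>\<rparr>) \<le> rho (G n\<lparr>base := \<mu>\<rparr>) + ennreal (c ^ 3)"
      by (rule delta_diamond_couplingE[OF G H n])
    have "rho (G n\<lparr>base := \<mu>\<rparr>) \<le> ennreal C"
      using split_rho_le[OF G 1] C[of n] by (rule order_trans)
    then have "rho (H\<lparr>base := \<nu>\<rparr>) \<le> ennreal C + ennreal (c ^ 3)"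
      by (intro order_trans[OF r] add_right_mono)
    with 2 show ?thesis by blast
  qed
  interpret sigma_finite_measure "base H" by (rule measurable_graphexD) fact
  obtain A :: "nat \<Rightarrow> _" where A: "range A \<subseteq> sets (base H)" "(\<Union>i. A i) = space (base H)"
      "\<And>i. emeasure (base H) (A i) \<noteq> \<infinity>" "incseq A"
    using sigma_finite_incseq by blast
  have [measurable]: "nmarg H \<in> borel_measurable (base H)" "\<And>i. A i \<in> sets (base H)"
    using measurable_nmarg[OF H] A by auto
  \<comment> \<open>Bounded by i and supported on a set of finite measure: the removed part then
    costs at most i c^2, and the drop of the degrees at most c^2 times the measure of
    \<open>A i\<close>.\<close>
  define f where "f i x = min (nmarg H x) (ennreal (real i)) * indicator (A i) x" for i x
  have [measurable]: "f i \<in> borel_measurable (base H)" for i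
    unfolding f_def by measurable
  have bound: "(\<integral>\<^sup>+x. f i x \<partial>base H) \<le> ennreal C" for i
  proof (rule ennreal_le_epsilon)
    fix e :: real assume "0 < e"
    obtain a where a: "emeasure (base H) (A i) = ennreal a" "0 \<le> a"
      using A(3)[of i] by (cases "emeasure (base H) (A i)") auto
    \<comment> \<open>As c \<le> 1, both c^2 and c^3 are at most c, so the total error c^3 + c^2 a +
      i c^2 is at most c (1 + a + i) \<le> e.\<close>
    define c where "c = min 1 (e / (1 + a + real i))"
    have c: "0 < c" "c \<le> 1" "c * (1 + a + real i) \<le> e"
    proof -
      have "c \<le> e / (1 + a + real i)" "0 < 1 + a + real i"
        using a(2) by (simp_all add: c_def)
      then show "c * (1 + a + real i) \<le> e"
        by (simp add: pos_le_divide_eq)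
    qed (use \<open>0 < e\<close> a(2) in \<open>simp_all add: c_def\<close>)
    obtain \<nu> \<beta> where \<nu>: "sets \<nu> = sets (base H)" "sets \<beta> = sets (base H)" "add_measure \<nu> \<beta> = base H"
      and \<beta>: "emeasure \<beta> (space (base H)) \<le> ennreal (c\<^sup>2)"
      and r: "rho (H\<lparr>base := \<nu>\<rparr>) \<le> ennreal C + ennreal (c ^ 3)"
      using split[OF c(1)] by blast
    have [measurable]: "nmarg (H\<lparr>base := \<nu>\<rparr>) \<in> borel_measurable \<nu>" "A i \<in> sets \<nu>"
      using measurable_nmarg[OF split_measurable_graphex[OF H \<nu>]] \<nu> by simp_all
    have "(\<integral>\<^sup>+x. f i x \<partial>\<nu>) \<le> (\<integral>\<^sup>+x. nmarg (H\<lparr>base := \<nu>\<rparr>) x + ennreal (c\<^sup>2) * indicator (A i) x \<partial>\<nu>)"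
    proof (rule nn_integral_mono)
      fix x assume "x \<in> space \<nu>"
      then have "nmarg H x \<le> nmarg (H\<lparr>base := \<nu>\<rparr>) x + ennreal (c\<^sup>2)"
        using split_nmarg_ge[OF H \<nu>, of x] \<beta> split_space[OF H \<nu>] by (auto intro: order_trans add_left_mono)
      then show "f i x \<le> nmarg (H\<lparr>base := \<nu>\<rparr>) x + ennreal (c\<^sup>2) * indicator (A i) x"
        by (auto simp: f_def indicator_def min.coboundedI1)
    qed
    also have "\<dots> = (\<integral>\<^sup>+x. nmarg (H\<lparr>base := \<nu>\<rparr>) x \<partial>\<nu>) + ennreal (c\<^sup>2) * emeasure \<nu> (A i)"
      by (subst nn_integral_add) (simp_all add: nn_integral_cmult)
    also have "\<dots> \<le> rho (H\<lparr>base := \<nu>\<rparr>) + ennreal (c\<^sup>2) * ennreal a"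
      using split_emeasure_le(1)[OF H \<nu>, of "A i"] a(1)
      by (intro add_mono mult_left_mono) (simp_all add: rho_eq[OF split_measurable_graphex[OF H \<nu>]] add.assoc)
    finally have 1: "(\<integral>\<^sup>+x. f i x \<partial>\<nu>) \<le> ennreal C + ennreal (c ^ 3) + ennreal (c\<^sup>2) * ennreal a"
      by (rule order_trans) (intro add_right_mono r)
    have "(\<integral>\<^sup>+x. f i x \<partial>\<beta>) \<le> (\<integral>\<^sup>+x. ennreal (real i) \<partial>\<beta>)"
      by (intro nn_integral_mono) (simp add: f_def indicator_def)
    also have "\<dots> \<le> ennreal (real i) * ennreal (c\<^sup>2)"
      using \<beta> split_space[OF H \<nu>] by (simp add: mult_left_mono)
    finally have "(\<integral>\<^sup>+x. f i x \<partial>base H)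
        \<le> (ennreal C + ennreal (c ^ 3) + ennreal (c\<^sup>2) * ennreal a) + ennreal (real i) * ennreal (c\<^sup>2)"
      by (subst split_nn_integral[OF H \<nu>]) (auto intro: add_mono 1)
    also have "\<dots> = ennreal C + ennreal (c ^ 3 + c\<^sup>2 * a + real i * c\<^sup>2)"
      using a(2) c(1) by (simp add: ennreal_mult ennreal_plus add.assoc)
    also have "\<dots> \<le> ennreal C + ennreal e"
    proof (intro add_left_mono ennreal_leI)
      have "c ^ 3 \<le> c" "c\<^sup>2 \<le> c"
        using c power_decreasing[of 1 3 c] power_decreasing[of 1 2 c] by auto
      then have "c ^ 3 + c\<^sup>2 * a + real i * c\<^sup>2 \<le> c + c * a + real i * c"
        using a(2) by (intro add_mono mult_left_mono mult_right_mono) auto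
      also have "\<dots> \<le> e"
        using c(3) by (simp add: algebra_simps)
      finally show "c ^ 3 + c\<^sup>2 * a + real i * c\<^sup>2 \<le> e" .
    qed
    finally show "(\<integral>\<^sup>+x. f i x \<partial>base H) \<le> ennreal C + ennreal e" .
  qed
  have sup: "(SUP i. f i x) = nmarg H x" if x: "x \<in> space (base H)" for x
  proof (rule antisym)
    show "(SUP i. f i x) \<le> nmarg H x"
      by (intro SUP_least) (auto simp: f_def indicator_def)
    obtain i0 where "x \<in> A i0"
      using x A(2) by auto
    then have i0: "x \<in> A i" if "i0 \<le> i" for i
      using A(4) that by (auto simp: incseq_def)
    have "min (nmarg H x) (ennreal (real i)) \<le> (SUP i. f i x)" for i
    proof -
      have "min (nmarg H x) (ennreal (real i)) \<le> min (nmarg H x) (ennreal (real (max i i0)))"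
        by (intro min.mono ennreal_leI) auto
      also have "\<dots> = f (max i i0) x"
        using i0[of "max i i0"] by (simp add: f_def)
      also have "\<dots> \<le> (SUP i. f i x)"
        by (rule SUP_upper) simp
      finally show ?thesis .
    qed
    moreover have "nmarg H x = (SUP i. min (nmarg H x) (ennreal (real i)))"
    proof -
      have "(SUP i. ennreal (real i)) = top"
        by (simp only: ennreal_of_nat_eq_real_of_nat[symmetric] ennreal_SUP_of_nat_eq_top)
      then have "nmarg H x = inf (nmarg H x) (SUP i. ennreal (real i))"
        by (simp only: inf_top_right)
      also have "\<dots> = (SUP i. inf (nmarg H x) (ennreal (real i)))"
        by (rule inf_SUP)
      finally show ?thesis
        by (simp only: inf_min)
    qed
    ultimately show "nmarg H x \<le> (SUP i. f i x)"
      by (metis SUP_least)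
  qed
  have inc: "incseq f"
  proof (intro incseq_SucI le_funI)
    fix i x
    have "min (nmarg H x) (ennreal (real i)) \<le> min (nmarg H x) (ennreal (real (Suc i)))"
      by (intro min.mono ennreal_leI) auto
    moreover have "x \<in> A (Suc i)" if "x \<in> A i"
      using A(4) that by (auto simp: incseq_Suc_iff)
    ultimately show "f i x \<le> f (Suc i) x"
      by (auto simp: f_def indicator_def)
  qed
  have "degree_mass H = (\<integral>\<^sup>+x. (SUP i. f i x) \<partial>base H)"
    using sup by (intro nn_integral_cong) simp
  also have "\<dots> = (SUP i. \<integral>\<^sup>+x. f i x \<partial>base H)"
    using inc by (intro nn_integral_monotone_convergence_SUP) auto
  also have "\<dots> \<le> ennreal C"
    using bound by (intro SUP_least)
  finally have fin: "degree_mass H < \<infinity>"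
    by (simp add: le_less_trans)
  moreover have "star_mass H \<le> degree_mass H"
    by (intro nn_integral_mono) (simp add: nmarg_def)
  ultimately show ?thesis
    by (auto simp: rho_eq[OF H] ennreal_mult_less_top)
qed

text \<open>The condition through which all three statements of the theorem are compared.\<close>

definition degree_tails_vanish :: "(nat \<Rightarrow> 'a graphex) \<Rightarrow> bool" where
  "degree_tails_vanish G \<longleftrightarrow> (\<forall>\<epsilon>>0. \<exists>\<delta>>0. \<forall>\<^sub>F n in sequentially.
     capped (ennreal \<delta>) (G n) + (star_mass (G n) + 2 * ennreal (dust (G n))) \<le> ennreal \<epsilon>)"

text \<open>Splits \<rho> into the part that is followed along the convergence and the remainder
  whose smallness is the criterion.\<close>

lemma rho_capped_excess:
  assumes "measurable_graphex G"
  shows "rho G = excess \<delta> G + (capped \<delta> G + (star_mass G + 2 * ennreal (dust G)))"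
  using capped_add_excess[OF assms, of \<delta>] by (simp add: rho_eq[OF assms] ac_simps)

section \<open>Passing the bounds to the limit\<close>

context
  fixes G :: "nat \<Rightarrow> 'a graphex" and H :: "'b graphex"
  assumes G: "\<And>n. measurable_graphex (G n)" and H: "measurable_graphex H"
    and ui: "unif_integrable (range G)"
    and lim: "(\<lambda>n. delta_diamond (G n) H) \<longlonglongrightarrow> 0"
begin

lemma rho_G_finite: "rho (G n) < \<infinity>"
proof -
  obtain C where "rho (G n) \<le> ennreal C"
    using uniform_degree_tail(1)[OF ui G] by blast
  then show ?thesis
    by (rule le_less_trans) simp
qed

lemma rho_H_finite: "rho H < \<infinity>"
proof -
  obtain C where "\<And>n. rho (G n) \<le> ennreal C"
    using uniform_degree_tail(1)[OF ui G] by blast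
  from rho_limit_finite[OF G H this lim] show ?thesis .
qed

text \<open>K1 comes from uniform integrability, K2 from the finite mass of H; c is chosen after
  both, and n last. \<open>delta_diamond_bounds\<close> is used at \<delta>/2: as c^2 < \<delta>/2,
  the raised threshold \<delta>/2 + c^2 is at most \<delta>, and the halving in the L^2 comparison
  turns \<delta>/2 into \<delta>/4.\<close>

lemma eventually_bounds:
  assumes "0 < \<delta>" "0 < \<epsilon>"
  shows "\<forall>\<^sub>F n in sequentially. rho (G n) \<le> rho H + ennreal \<epsilon> \<and> rho H \<le> rho (G n) + ennreal \<epsilon> \<and>
    excess (ennreal \<delta>) (G n) \<le> excess (ennreal (\<delta> / 4)) H + ennreal \<epsilon> \<and>
    excess (ennreal \<delta>) H \<le> excess (ennreal (\<delta> / 4)) (G n) + ennreal \<epsilon>"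
proof -
  obtain K1 where K1: "0 \<le> K1" "\<And>n. degree_tail K1 (G n) \<le> ennreal (\<epsilon> / 8)"
    using uniform_degree_tail(2)[OF ui G, of "\<epsilon> / 8"] \<open>0 < \<epsilon>\<close> by auto
  obtain K2 where K2: "0 \<le> K2" "degree_tail K2 H < ennreal (\<epsilon> / 8)"
    using degree_tail_vanishes[OF H rho_H_finite, of "ennreal (\<epsilon> / 8)"] \<open>0 < \<epsilon>\<close> by auto
  have "\<forall>\<^sub>F c in at_right 0. c ^ 3 + 2 * (K1 + K2) * c\<^sup>2 + c ^ 4 / \<delta> < \<epsilon> / 2"
    by (rule order_tendstoD(2)[where y = 0]) (use assms in \<open>auto intro!: tendsto_eq_intros\<close>)
  moreover have "\<forall>\<^sub>F c in at_right 0. c\<^sup>2 < \<delta> / 2"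
    by (rule order_tendstoD(2)[where y = 0]) (use assms in \<open>auto intro!: tendsto_eq_intros\<close>)
  ultimately have "\<forall>\<^sub>F c in at_right 0. 0 < c \<and> c\<^sup>2 < \<delta> / 2 \<and> c ^ 3 + 2 * (K1 + K2) * c\<^sup>2 + c ^ 4 / \<delta> < \<epsilon> / 2"
    using eventually_at_right_less[of "0::real"] by eventually_elim auto
  then obtain c where c: "0 < c" "c\<^sup>2 < \<delta> / 2" and e: "c ^ 3 + 2 * (K1 + K2) * c\<^sup>2 + c ^ 4 / \<delta> < \<epsilon> / 2"
    using eventually_happens[of _ "at_right (0::real)"] by (auto simp: trivial_limit_at_right_real)
  have half: "0 < \<delta> / 2" and half_simps: "\<delta> / 2 / 2 = \<delta> / 4" "2 * (\<delta> / 2) = \<delta>"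
    using \<open>0 < \<delta>\<close> by simp_all
  have pos: "0 \<le> c ^ 3" "0 \<le> K1 * c\<^sup>2" "0 \<le> K2 * c\<^sup>2" "0 \<le> c ^ 4 / \<delta>"
    using c K1 K2 \<open>0 < \<delta>\<close> by auto
  have err: "a + ennreal x + 2 * (ennreal K * ennreal (c\<^sup>2) + t) \<le> a + ennreal \<epsilon>"
    "a + ennreal x + (ennreal K * ennreal (c\<^sup>2) + t) \<le> a + ennreal \<epsilon>"
    if "0 \<le> x" "x + 2 * (K * c\<^sup>2) \<le> \<epsilon> / 2" "0 \<le> K" "t \<le> ennreal (\<epsilon> / 8)" for a t K x
  proof -
    have *: "a + ennreal x + 2 * (ennreal K * ennreal (c\<^sup>2) + t)
        \<le> a + ennreal x + 2 * (ennreal K * ennreal (c\<^sup>2) + ennreal (\<epsilon> / 8))"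
      using that by (intro add_left_mono mult_left_mono) auto
    also have "\<dots> = a + ennreal (x + 2 * (K * c\<^sup>2 + \<epsilon> / 8))"
    proof -
      have "ennreal K * ennreal (c\<^sup>2) + ennreal (\<epsilon> / 8) = ennreal (K * c\<^sup>2 + \<epsilon> / 8)"
        using that \<open>0 < \<epsilon>\<close> by (simp add: ennreal_mult ennreal_plus)
      moreover have "2 * ennreal z = ennreal (2 * z)" if "0 \<le> z" for z
        using that by (simp add: ennreal_mult)
      ultimately show ?thesis
        using that \<open>0 < \<epsilon>\<close> by (simp add: ennreal_plus add.assoc)
    qed
    also have "\<dots> \<le> a + ennreal \<epsilon>"
      using that \<open>0 < \<epsilon>\<close> by (intro add_left_mono ennreal_leI) (simp add: algebra_simps)
    finally show 1: "a + ennreal x + 2 * (ennreal K * ennreal (c\<^sup>2) + t) \<le> a + ennreal \<epsilon>" .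
    have "a + ennreal x + (ennreal K * ennreal (c\<^sup>2) + t) \<le> a + ennreal x + 2 * (ennreal K * ennreal (c\<^sup>2) + t)"
      by (intro add_left_mono) (simp add: mult_2)
    from order_trans[OF this 1]
    show "a + ennreal x + (ennreal K * ennreal (c\<^sup>2) + t) \<le> a + ennreal \<epsilon>" .
  qed
  have small: "c ^ 3 + 2 * (K1 * c\<^sup>2) \<le> \<epsilon> / 2" "c ^ 3 + 2 * (K2 * c\<^sup>2) \<le> \<epsilon> / 2"
    "c ^ 4 / \<delta> + 2 * (K1 * c\<^sup>2) \<le> \<epsilon> / 2" "c ^ 4 / \<delta> + 2 * (K2 * c\<^sup>2) \<le> \<epsilon> / 2"
  proof -
    have "c ^ 3 + 2 * (K1 * c\<^sup>2) + 2 * (K2 * c\<^sup>2) + c ^ 4 / \<delta> < \<epsilon> / 2"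
      using e by (simp only: distrib_left distrib_right mult.assoc add.assoc)
    with pos show "c ^ 3 + 2 * (K1 * c\<^sup>2) \<le> \<epsilon> / 2" "c ^ 3 + 2 * (K2 * c\<^sup>2) \<le> \<epsilon> / 2"
      "c ^ 4 / \<delta> + 2 * (K1 * c\<^sup>2) \<le> \<epsilon> / 2" "c ^ 4 / \<delta> + 2 * (K2 * c\<^sup>2) \<le> \<epsilon> / 2"
      by linarith+
  qed
  have le: "ennreal (\<delta> / 2) + ennreal (c\<^sup>2) \<le> ennreal \<delta>"
    using c \<open>0 < \<delta>\<close> by (simp flip: ennreal_plus)
  have "\<forall>\<^sub>F n in sequentially. delta_diamond (G n) H < ereal c"
    using c by (intro order_tendstoD(2)[OF lim]) simp
  then show ?thesis
  proof eventually_elim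
    case (elim n)
    note b = delta_diamond_bounds[OF G H elim half, simplified half_simps]
    show ?case
    proof (intro conjI)
      show "rho (G n) \<le> rho H + ennreal \<epsilon>"
        by (rule order_trans[OF b(1)[of K1] err(1)[OF pos(1) small(1) K1(1) K1(2)[of n]]])
      show "rho H \<le> rho (G n) + ennreal \<epsilon>"
        by (rule order_trans[OF b(2)[of K2] err(1)[OF pos(1) small(2) K2(1) less_imp_le[OF K2(2)]]])
      show "excess (ennreal \<delta>) (G n) \<le> excess (ennreal (\<delta> / 4)) H + ennreal \<epsilon>"
        by (rule order_trans[OF order_trans[OF excess_antimono[OF le] b(3)[of K1]] err(2)[OF pos(4) small(3) K1(1) K1(2)[of n]]])
      show "excess (ennreal \<delta>) H \<le> excess (ennreal (\<delta> / 4)) (G n) + ennreal \<epsilon>"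
        by (rule order_trans[OF order_trans[OF excess_antimono[OF le] b(4)[of K2]] err(2)[OF pos(4) small(4) K2(1) less_imp_le[OF K2(2)]]])
    qed
  qed
qed

text \<open>With S = 0 and I = 0, \<rho>(H) is the excess of H at \<delta> plus a small capped mass.
  Going from \<rho>(\<open>G n\<close>) to \<rho>(H) and from the excess of H back to
  \<open>G n\<close> bounds \<rho>(\<open>G n\<close>) by its own excess at \<delta>/4 plus
  \<epsilon>; cancelling that finite excess leaves the remainder.\<close>

lemma degree_tails_vanish_if:
  assumes "AE x in base H. star H x = 0" "dust H = 0"
  shows "degree_tails_vanish G"
  unfolding degree_tails_vanish_def
proof (intro allI impI)
  fix \<epsilon> :: real assume "0 < \<epsilon>"
  then obtain \<delta> where \<delta>: "0 < \<delta>" "capped (ennreal \<delta>) H < ennreal (\<epsilon> / 3)"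
    using capped_vanishes[OF H rho_H_finite, of "ennreal (\<epsilon> / 3)"] by auto
  have "star_mass H = (\<integral>\<^sup>+x. 0 \<partial>base H)"
    using assms(1) by (intro nn_integral_cong_AE) auto
  then have rho: "rho H = excess (ennreal \<delta>) H + capped (ennreal \<delta>) H"
    using assms(2) by (simp add: rho_capped_excess[OF H, of "ennreal \<delta>"])
  have "\<forall>\<^sub>F n in sequentially. capped (ennreal (\<delta> / 4)) (G n)
      + (star_mass (G n) + 2 * ennreal (dust (G n))) \<le> ennreal \<epsilon>"
    using eventually_bounds[OF \<delta>(1), of "\<epsilon> / 3"]
  proof (rule eventually_mono)
    fix n
    let ?r = "capped (ennreal (\<delta> / 4)) (G n)
      + (star_mass (G n) + 2 * ennreal (dust (G n)))"
    assume b: "rho (G n) \<le> rho H + ennreal (\<epsilon> / 3) \<and> rho H \<le> rho (G n) + ennreal (\<epsilon> / 3) \<and>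
      excess (ennreal \<delta>) (G n) \<le> excess (ennreal (\<delta> / 4)) H + ennreal (\<epsilon> / 3) \<and>
      excess (ennreal \<delta>) H \<le> excess (ennreal (\<delta> / 4)) (G n) + ennreal (\<epsilon> / 3)"
    have "excess (ennreal (\<delta> / 4)) (G n) + ?r = rho (G n)"
      by (rule rho_capped_excess[OF G, symmetric])
    also have "\<dots> \<le> excess (ennreal (\<delta> / 4)) (G n) + ennreal (\<epsilon> / 3) + ennreal (\<epsilon> / 3) + ennreal (\<epsilon> / 3)"
    proof (rule order_trans[OF conjunct1[OF b] add_right_mono])
      show "rho H \<le> excess (ennreal (\<delta> / 4)) (G n) + ennreal (\<epsilon> / 3) + ennreal (\<epsilon> / 3)"
        unfolding rho using \<delta>(2) b by (intro add_mono) auto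
    qed
    also have "\<dots> = excess (ennreal (\<delta> / 4)) (G n) + ennreal \<epsilon>"
      using \<open>0 < \<epsilon>\<close> by (simp add: add.assoc flip: ennreal_plus)
    finally have "excess (ennreal (\<delta> / 4)) (G n) + ?r \<le> excess (ennreal (\<delta> / 4)) (G n) + ennreal \<epsilon>" .
    moreover have "excess (ennreal (\<delta> / 4)) (G n) \<noteq> top"
      using rho_G_finite[of n] rho_capped_excess[OF G, of n "ennreal (\<delta> / 4)"] by auto
    ultimately show "?r \<le> ennreal \<epsilon>"
      by (simp add: ennreal_add_left_cancel_le)
  qed (use \<delta> \<open>0 < \<epsilon>\<close> in auto)
  then show "\<exists>\<delta>>0. \<forall>\<^sub>F n in sequentially. capped (ennreal \<delta>) (G n)
      + (star_mass (G n) + 2 * ennreal (dust (G n))) \<le> ennreal \<epsilon>"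
    using \<delta>(1) by (intro exI[of _ "\<delta> / 4"]) simp
qed

text \<open>\<rho>(H) exceeds \<rho>(\<open>G n\<close>) by at most e/3, the remainder of
  \<rho>(\<open>G n\<close>) beyond its excess is at most e/3, and that excess is at most the degree
  mass of H plus e/3. So \<integral> S + 2 I, which is \<rho>(H) minus the degree mass, is at most
  e.\<close>

lemma degree_tails_vanishD:
  assumes "degree_tails_vanish G"
  shows "(AE x in base H. star H x = 0) \<and> dust H = 0"
proof -
  let ?s = "star_mass H + 2 * ennreal (dust H)"
  have T: "degree_mass H \<noteq> top"
  proof -
    have "degree_mass H \<le> rho H"
      unfolding rho_eq[OF H] add.assoc by simp
    then have "degree_mass H < \<infinity>"
      using rho_H_finite by (rule le_less_trans)
    then show ?thesis by simp
  qed
  have s0: "?s \<le> 0"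
  proof (rule ennreal_le_epsilon)
    fix e :: real assume e: "0 < e"
    obtain \<delta> where \<delta>: "0 < \<delta>" "\<forall>\<^sub>F n in sequentially. capped (ennreal \<delta>) (G n)
      + (star_mass (G n) + 2 * ennreal (dust (G n))) \<le> ennreal (e / 3)"
      using assms[unfolded degree_tails_vanish_def, rule_format, of "e / 3"] e by auto
    have "0 < e / 3"
      using e by simp
    note ev = eventually_conj[OF \<delta>(2) eventually_bounds[OF \<delta>(1) this]]
    obtain n where 1: "capped (ennreal \<delta>) (G n)
          + (star_mass (G n) + 2 * ennreal (dust (G n))) \<le> ennreal (e / 3)"
        and 2: "rho H \<le> rho (G n) + ennreal (e / 3)" "excess (ennreal \<delta>) (G n) \<le> excess (ennreal (\<delta> / 4)) H + ennreal (e / 3)"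
      using eventually_happens[OF ev] by auto
    have "degree_mass H + ?s = rho H"
      by (simp add: rho_eq[OF H] add.assoc)
    also have "\<dots> \<le> rho (G n) + ennreal (e / 3)"
      by (rule 2)
    also have "\<dots> \<le> (excess (ennreal (\<delta> / 4)) H + ennreal (e / 3) + ennreal (e / 3)) + ennreal (e / 3)"
      unfolding rho_capped_excess[OF G, of n "ennreal \<delta>"] by (intro add_right_mono add_mono 1 2)
    also have "\<dots> = excess (ennreal (\<delta> / 4)) H + ennreal e"
      using e by (simp add: add.assoc flip: ennreal_plus)
    also have "\<dots> \<le> degree_mass H + ennreal e"
      unfolding capped_add_excess[OF H, of "ennreal (\<delta> / 4)", symmetric] by (intro add_right_mono) simp
    finally have "degree_mass H + ?s \<le> degree_mass H + ennreal e" .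
    then show "?s \<le> 0 + ennreal e"
      unfolding ennreal_add_left_cancel_le using T by simp
  qed
  have d: "ennreal (dust H) = 0"
    using s0 by (auto simp: add_eq_0_iff_both_eq_0)
  have [measurable]: "star H \<in> borel_measurable (base H)"
    using measurable_graphexD(3)[OF H] .
  have "star_mass H = 0"
    using s0 by (auto simp: add_eq_0_iff_both_eq_0)
  then have "AE x in base H. ennreal (star H x) = 0"
    by (rule nn_integral_0_iff_AE[THEN iffD1, rotated]) simp
  then have "AE x in base H. star H x = 0"
    using AE_space
  proof eventually_elim
    case (elim x)
    have "star H x \<le> 0"
      using elim(1)[unfolded ennreal_eq_0_iff] .
    then show "star H x = 0"
      using measurable_graphexD(4)[OF H elim(2)] by (rule antisym)
  qed
  moreover have "dust H = 0"
    using d[unfolded ennreal_eq_0_iff] measurable_graphexD(8)[OF H] by (rule antisym)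
  ultimately show ?thesis
    by blast
qed

end

section \<open>Uniform tail regularity\<close>

abbreviation (input) outside_mass :: "'a graphex \<Rightarrow> 'a set \<Rightarrow> real" where
  "outside_mass G A \<equiv> (\<integral>p. case_prod (kernel G) p \<partial>(base G \<Otimes>\<^sub>M base G))
     - (LINT p:A \<times> A|base G \<Otimes>\<^sub>M base G. case_prod (kernel G) p)"

text \<open>The kernel mass of a rectangle as an iterated nonnegative integral. In this form it
  splits along sums of base measures; the Bochner set integrals of the cut norm are translated into
  it.\<close>

definition pair_mass :: "'a measure \<Rightarrow> ('a \<Rightarrow> 'a \<Rightarrow> real) \<Rightarrow> 'a set \<Rightarrow> 'a set \<Rightarrow> ennreal" where
  "pair_mass M W A B = (\<integral>\<^sup>+x. (\<integral>\<^sup>+y. ennreal (W x y) * indicator B y \<partial>M) * indicator A x \<partial>M)"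

context
  fixes G :: "'a graphex"
  assumes G: "measurable_graphex G" and fin: "rho G < \<infinity>"
begin

lemma kernel_integrable: "integrable (base G \<Otimes>\<^sub>M base G) (case_prod (kernel G))"
proof (rule integrableI_bounded)
  show "case_prod (kernel G) \<in> borel_measurable (base G \<Otimes>\<^sub>M base G)"
    using measurable_graphexD(2)[OF G] by simp
  have "(\<integral>\<^sup>+p. ennreal (norm (case_prod (kernel G) p)) \<partial>(base G \<Otimes>\<^sub>M base G))
      = (\<integral>\<^sup>+p. ennreal (case_prod (kernel G) p) \<partial>(base G \<Otimes>\<^sub>M base G))"
    using measurable_graphexD(5)[OF G] by (intro nn_integral_cong) (auto simp: space_pair_measure)
  also have "\<dots> \<le> rho G"
    unfolding rho_def add.assoc by simp
  also note fin
  finally show "(\<integral>\<^sup>+p. ennreal (norm (case_prod (kernel G) p)) \<partial>(base G \<Otimes>\<^sub>M base G)) < \<infinity>" .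
qed

lemma integrable_graphon_kernel: "integrable_graphon (base G) (kernel G)"
  using G kernel_integrable by (simp add: integrable_graphon_def measurable_graphex_def)

lemma nn_integral_kernel_indicator:
  assumes [measurable]: "A \<in> sets (base G)" "B \<in> sets (base G)"
  shows "(\<integral>\<^sup>+p. ennreal (indicator (A \<times> B) p * case_prod (kernel G) p) \<partial>(base G \<Otimes>\<^sub>M base G))
    = pair_mass (base G) (kernel G) A B"
proof -
  interpret sigma_finite_measure "base G" by (rule measurable_graphexD) fact
  note [measurable] = measurable_graphexD(2)[OF G]
  have "(\<integral>\<^sup>+p. ennreal (indicator (A \<times> B) p * case_prod (kernel G) p) \<partial>(base G \<Otimes>\<^sub>M base G))
    = (\<integral>\<^sup>+x. \<integral>\<^sup>+y. ennreal (indicator (A \<times> B) (x, y) * kernel G x y) \<partial>base G \<partial>base G)"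
    by (subst nn_integral_fst[symmetric]) (auto simp: case_prod_beta')
  also have "\<dots> = pair_mass (base G) (kernel G) A B"
    unfolding pair_mass_def
    by (intro nn_integral_cong) (auto simp: indicator_def intro!: nn_integral_cong)
  finally show ?thesis .
qed

lemma pair_mass_finite:
  assumes [measurable]: "A \<in> sets (base G)" "B \<in> sets (base G)"
  shows "pair_mass (base G) (kernel G) A B < \<infinity>"
proof -
  have "pair_mass (base G) (kernel G) A B \<le> (\<integral>\<^sup>+p. ennreal (norm (case_prod (kernel G) p)) \<partial>(base G \<Otimes>\<^sub>M base G))"
    unfolding nn_integral_kernel_indicator[OF assms, symmetric]
    by (intro nn_integral_mono ennreal_leI) (auto simp: indicator_def)
  also have "\<dots> < \<infinity>"
    using kernel_integrable by (simp add: integrable_iff_bounded)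
  finally show ?thesis .
qed

lemma set_integrable_kernel:
  assumes "A \<in> sets (base G)" "B \<in> sets (base G)"
  shows "set_integrable (base G \<Otimes>\<^sub>M base G) (A \<times> B) (case_prod (kernel G))"
  using kernel_integrable assms unfolding set_integrable_def
  by (intro integrable_mult_indicator) auto

lemma set_lebesgue_integral_kernel:
  assumes "A \<in> sets (base G)" "B \<in> sets (base G)"
  shows "(LINT p:A \<times> B|base G \<Otimes>\<^sub>M base G. case_prod (kernel G) p) = enn2real (pair_mass (base G) (kernel G) A B)"
proof -
  have "AE p in base G \<Otimes>\<^sub>M base G. 0 \<le> indicator (A \<times> B) p *\<^sub>R case_prod (kernel G) p"
    using measurable_graphexD(5)[OF G] by (intro AE_I2) (auto simp: space_pair_measure indicator_def)
  moreover have "(\<lambda>p. indicator (A \<times> B) p *\<^sub>R case_prod (kernel G) p) \<in> borel_measurable (base G \<Otimes>\<^sub>M base G)"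
    using set_integrable_kernel[OF assms] by (simp add: set_integrable_def)
  ultimately have "(LINT p:A \<times> B|base G \<Otimes>\<^sub>M base G. case_prod (kernel G) p)
      = enn2real (\<integral>\<^sup>+p. ennreal (indicator (A \<times> B) p *\<^sub>R case_prod (kernel G) p) \<partial>(base G \<Otimes>\<^sub>M base G))"
    unfolding set_lebesgue_integral_def by (intro integral_eq_nn_integral) auto
  then show ?thesis
    using nn_integral_kernel_indicator[OF assms] by simp
qed

text \<open>A pair outside \<open>A \<times> A\<close> has its first point outside A, or its first
  point in A and its second outside. By symmetry the second kind has the mass of pairs from the
  complement into A, which is at most that of the first kind. Hence the mass outside lies between
  one and two times the degree mass off A.\<close>

lemma kernel_mass_outside:
  assumes A[measurable]: "A \<in> sets (base G)"
  defines "d \<equiv> outside_mass G A"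
  shows "(\<integral>\<^sup>+x. (\<integral>\<^sup>+y. ennreal (kernel G x y) \<partial>base G) * indicator (space (base G) - A) x \<partial>base G) \<le> ennreal d"
    and "ennreal d \<le> 2 * (\<integral>\<^sup>+x. nmarg G x * indicator (space (base G) - A) x \<partial>base G)"
proof -
  interpret sigma_finite_measure "base G" by (rule measurable_graphexD) fact
  note [measurable] = measurable_graphexD(2)[OF G] measurable_nmarg[OF G]
  let ?S = "space (base G)"
  let ?T = "pair_mass (base G) (kernel G)"
  have deg[measurable]: "(\<lambda>x. \<integral>\<^sup>+y. ennreal (kernel G x y) * indicator B y \<partial>base G) \<in> borel_measurable (base G)"
    if [measurable]: "B \<in> sets (base G)" for B
    by measurable
  have split1: "?T ?S B = ?T A B + ?T (?S - A) B" if [measurable]: "B \<in> sets (base G)" for B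
    unfolding pair_mass_def
    by (subst nn_integral_add[symmetric]) (auto intro!: nn_integral_cong simp: indicator_def)
  have swap: "?T A B = ?T B A" if [measurable]: "A \<in> sets (base G)" "B \<in> sets (base G)" for A B
  proof -
    interpret pair_sigma_finite "base G" "base G" ..
    have "?T A B = (\<integral>\<^sup>+x. \<integral>\<^sup>+y. ennreal (kernel G x y) * indicator B y * indicator A x \<partial>base G \<partial>base G)"
      unfolding pair_mass_def by (intro nn_integral_cong nn_integral_multc[symmetric]) auto
    also have "\<dots> = (\<integral>\<^sup>+y. \<integral>\<^sup>+x. ennreal (kernel G x y) * indicator B y * indicator A x \<partial>base G \<partial>base G)"
      by (intro Fubini'[symmetric]) measurable
    also have "\<dots> = (\<integral>\<^sup>+y. \<integral>\<^sup>+x. ennreal (kernel G y x) * indicator A x * indicator B y \<partial>base G \<partial>base G)"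
      using measurable_graphexD(7)[OF G] by (intro nn_integral_cong) (simp add: mult_ac)
    also have "\<dots> = ?T B A"
      unfolding pair_mass_def by (intro nn_integral_cong nn_integral_multc) auto
    finally show ?thesis .
  qed
  have out: "?T (?S - A) ?S = (\<integral>\<^sup>+x. (\<integral>\<^sup>+y. ennreal (kernel G x y) \<partial>base G) * indicator (?S - A) x \<partial>base G)"
    unfolding pair_mass_def by (intro nn_integral_cong) (auto simp: indicator_def intro!: nn_integral_cong)
  have mono: "?T (?S - A) A \<le> ?T (?S - A) ?S"
    unfolding split1[of A] using swap[of "?S - A" A] swap[of "?S - A" ?S] split1[of "?S - A"] by simp
  have "(\<integral>p. case_prod (kernel G) p \<partial>(base G \<Otimes>\<^sub>M base G))
      = (LINT p:?S \<times> ?S|base G \<Otimes>\<^sub>M base G. case_prod (kernel G) p)"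
    by (simp add: set_lebesgue_integral_def space_pair_measure flip: space_pair_measure cong: Bochner_Integration.integral_cong)
  then have "d = enn2real (?T ?S ?S) - enn2real (?T A A)"
    unfolding d_def by (simp add: set_lebesgue_integral_kernel)
  moreover have "?T ?S ?S = ?T A A + (?T (?S - A) A + ?T (?S - A) ?S)"
    using split1[of ?S] swap[of A ?S] split1[of A] by (simp add: add.assoc)
  moreover have "?T A A < \<infinity>" "?T (?S - A) A < \<infinity>" "?T (?S - A) ?S < \<infinity>"
    by (intro pair_mass_finite; measurable)+
  ultimately have d: "ennreal d = ?T (?S - A) A + ?T (?S - A) ?S"
    by (simp add: enn2real_plus ennreal_plus)
  show "(\<integral>\<^sup>+x. (\<integral>\<^sup>+y. ennreal (kernel G x y) \<partial>base G) * indicator (?S - A) x \<partial>base G) \<le> ennreal d"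
    unfolding d out[symmetric] by simp
  have "?T (?S - A) ?S \<le> (\<integral>\<^sup>+x. nmarg G x * indicator (?S - A) x \<partial>base G)"
    unfolding out by (intro nn_integral_mono mult_right_mono) (auto simp: nmarg_def)
  then show "ennreal d \<le> 2 * (\<integral>\<^sup>+x. nmarg G x * indicator (?S - A) x \<partial>base G)"
    unfolding d mult_2 using mono by (intro add_mono) auto
qed

end

section \<open>Vanishing degree tails and tail regularity\<close>

context
  fixes G :: "nat \<Rightarrow> 'a graphex"
  assumes G: "\<And>n. measurable_graphex (G n)" and fin: "\<And>n. rho (G n) < \<infinity>"
begin

lemma degree_tails_vanish_imp_star_dust:
  assumes "degree_tails_vanish G"
  shows "(\<lambda>n. \<integral>\<^sup>+x. ennreal (star (G n) x) \<partial>base (G n)) \<longlonglongrightarrow> 0" "(\<lambda>n. dust (G n)) \<longlonglongrightarrow> 0"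
proof -
  let ?S = "\<lambda>n. \<integral>\<^sup>+x. ennreal (star (G n) x) \<partial>base (G n)"
  have ev: "\<forall>\<^sub>F n in sequentially. ?S n + 2 * ennreal (dust (G n)) \<le> ennreal e" if e: "0 < e" for e
  proof -
    obtain \<delta> where "\<forall>\<^sub>F n in sequentially. capped (ennreal \<delta>) (G n) + (?S n + 2 * ennreal (dust (G n))) \<le> ennreal e"
      using assms[unfolded degree_tails_vanish_def, rule_format, OF e] by blast
    then show ?thesis
      by eventually_elim (rule order_trans[rotated], assumption, simp)
  qed
  show "?S \<longlonglongrightarrow> 0"
  proof (rule order_tendstoI)
    fix a :: ennreal assume "0 < a"
    then obtain e where e: "0 < e" "ennreal e < a"
      by (metis dense ennreal_cases ennreal_less_zero_iff less_top_ennreal order_less_trans top.not_eq_extremum)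
    show "\<forall>\<^sub>F n in sequentially. ?S n < a"
      using ev[OF e(1)]
    proof eventually_elim
      case (elim n)
      have "?S n \<le> ?S n + 2 * ennreal (dust (G n))"
        by simp
      also note elim
      also note e(2)
      finally show ?case .
    qed
  qed simp
  show "(\<lambda>n. dust (G n)) \<longlonglongrightarrow> 0"
  proof (rule order_tendstoI)
    fix a :: real assume "a < 0"
    then show "\<forall>\<^sub>F n in sequentially. a < dust (G n)"
      using measurable_graphexD(8)[OF G] by (intro always_eventually allI) (rule less_le_trans)
  next
    fix a :: real assume "0 < a"
    then have "0 < a / 2" by simp
    from ev[OF this] show "\<forall>\<^sub>F n in sequentially. dust (G n) < a"
    proof eventually_elim
      case (elim n)
      have "ennreal (dust (G n)) \<le> ?S n + 2 * ennreal (dust (G n))"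
        by (simp add: mult_2 add.assoc add_increasing)
      also note elim
      finally have "dust (G n) \<le> a / 2"
        using \<open>0 < a\<close> by (subst (asm) ennreal_le_iff) auto
      then show ?case
        using \<open>0 < a\<close> by linarith
    qed
  qed
qed

text \<open>By Markov's inequality {D \<ge> \<delta>} has measure at most C/\<delta>. Off this set D
  = min(D, \<delta>), so the mass outside its square is at most twice the capped mass.\<close>

lemma degree_tails_vanish_imp_tail_regular:
  assumes "degree_tails_vanish G" and C: "\<And>n. rho (G n) \<le> ennreal C"
  shows "unif_tail_regular (range (\<lambda>n. (base (G n), kernel (G n))))"
proof -
  have "\<exists>m::real. \<forall>n. \<exists>A\<in>sets (base (G n)). emeasure (base (G n)) A \<le> ennreal m \<and>
      outside_mass (G n) A \<le> \<epsilon>" if "0 < \<epsilon>" for \<epsilon>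
  proof -
    have e2: "0 < \<epsilon> / 2" using that by simp
    obtain \<delta>0 N where \<delta>0: "0 < \<delta>0" "\<And>n. N \<le> n \<Longrightarrow> capped (ennreal \<delta>0) (G n) \<le> ennreal (\<epsilon> / 2)"
    proof -
      obtain \<delta>0 where "0 < \<delta>0" "\<forall>\<^sub>F n in sequentially. capped (ennreal \<delta>0) (G n)
         + (star_mass (G n) + 2 * ennreal (dust (G n))) \<le> ennreal (\<epsilon> / 2)"
        using assms(1) e2 unfolding degree_tails_vanish_def by blast
      moreover from this(2) have "\<forall>\<^sub>F n in sequentially. capped (ennreal \<delta>0) (G n) \<le> ennreal (\<epsilon> / 2)"
        by eventually_elim (rule order_trans[rotated], assumption, simp)
      ultimately show ?thesis
        using that unfolding eventually_sequentially by blast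
    qed
    have "\<exists>\<delta>>0. capped (ennreal \<delta>) (G n) < ennreal (\<epsilon> / 2)" for n
      using capped_vanishes[OF G fin] e2 by simp
    then obtain d where d: "\<And>n. 0 < d n" "\<And>n. capped (ennreal (d n)) (G n) < ennreal (\<epsilon> / 2)"
      by metis
    \<comment> \<open>The criterion speaks only of large n, tail regularity of all n. The finitely
      many early indices each have a threshold of their own, and the minimum serves all of
      them.\<close>
    define \<delta> where "\<delta> = Min (insert \<delta>0 (d ` {..<N}))"
    have \<delta>: "0 < \<delta>" "\<delta> \<le> \<delta>0" "\<And>n. n < N \<Longrightarrow> \<delta> \<le> d n"
      using d(1) \<delta>0(1) by (auto simp: \<delta>_def)
    have capped: "capped (ennreal \<delta>) (G n) \<le> ennreal (\<epsilon> / 2)" for n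
    proof (cases "n < N")
      case True
      have "capped (ennreal \<delta>) (G n) \<le> capped (ennreal (d n)) (G n)"
        using \<delta>(3)[OF True] by (intro capped_mono ennreal_leI)
      also have "\<dots> \<le> ennreal (\<epsilon> / 2)"
        using d(2) by (rule less_imp_le)
      finally show ?thesis .
    next
      case False
      have "capped (ennreal \<delta>) (G n) \<le> capped (ennreal \<delta>0) (G n)"
        using \<delta>(2) by (intro capped_mono ennreal_leI)
      also have "\<dots> \<le> ennreal (\<epsilon> / 2)"
        using \<delta>0(2) False by simp
      finally show ?thesis .
    qed
    show ?thesis
    proof (intro exI[of _ "C / \<delta>"] allI)
      fix n
      note [measurable] = measurable_nmarg[OF G[of n]]
      let ?S = "space (base (G n))"
      define A where "A = {x\<in>?S. ennreal \<delta> \<le> nmarg (G n) x}"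
      have A[measurable]: "A \<in> sets (base (G n))"
        unfolding A_def by measurable
      have "ennreal \<delta> * emeasure (base (G n)) A = (\<integral>\<^sup>+x. ennreal \<delta> * indicator A x \<partial>base (G n))"
        by (simp add: nn_integral_cmult)
      also have "\<dots> \<le> degree_mass (G n)"
        by (intro nn_integral_mono) (auto simp: A_def indicator_def)
      also have "\<dots> \<le> rho (G n)"
        unfolding rho_eq[OF G] add.assoc by simp
      also note C[of n]
      finally have "ennreal (1 / \<delta>) * (ennreal \<delta> * emeasure (base (G n)) A) \<le> ennreal (1 / \<delta>) * ennreal C"
        by (intro mult_left_mono) auto
      moreover have "ennreal (1 / \<delta>) * ennreal \<delta> = 1"
        using \<delta>(1) by (simp flip: ennreal_mult)
      ultimately have mass: "emeasure (base (G n)) A \<le> ennreal (C / \<delta>)"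
        using \<delta>(1) by (simp add: mult.assoc[symmetric] ennreal_mult'[symmetric])
      have "(\<integral>\<^sup>+x. nmarg (G n) x * indicator (?S - A) x \<partial>base (G n)) \<le> capped (ennreal \<delta>) (G n)"
        unfolding capped_def by (intro nn_integral_mono) (auto simp: A_def indicator_def)
      also note capped
      finally have "2 * (\<integral>\<^sup>+x. nmarg (G n) x * indicator (?S - A) x \<partial>base (G n)) \<le> 2 * ennreal (\<epsilon> / 2)"
        by (intro mult_left_mono) auto
      also have "\<dots> = ennreal \<epsilon>"
        using ennreal_mult'[of 2 "\<epsilon> / 2"] by simp
      finally have "ennreal (outside_mass (G n) A) \<le> ennreal \<epsilon>"
        by (rule order_trans[OF kernel_mass_outside(2)[OF G fin A]])
      then have "outside_mass (G n) A \<le> \<epsilon>"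
        using \<open>0 < \<epsilon>\<close> by (subst (asm) ennreal_le_iff) auto
      with mass A show "\<exists>A\<in>sets (base (G n)). emeasure (base (G n)) A \<le> ennreal (C / \<delta>) \<and>
        outside_mass (G n) A \<le> \<epsilon>"
        by blast
    qed
  qed
  then show ?thesis
    using integrable_graphon_kernel[OF G fin] unfolding unif_tail_regular_def by auto
qed

lemma eventually_star_dust_le:
  assumes "(\<lambda>n. \<integral>\<^sup>+x. ennreal (star (G n) x) \<partial>base (G n)) \<longlonglongrightarrow> 0" "(\<lambda>n. dust (G n)) \<longlonglongrightarrow> 0" "0 < \<epsilon>"
  shows "\<forall>\<^sub>F n in sequentially. star_mass (G n) + 2 * ennreal (dust (G n)) \<le> ennreal \<epsilon>"
proof -
  have "\<forall>\<^sub>F n in sequentially. star_mass (G n) < ennreal (\<epsilon> / 2)"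
    using assms by (intro order_tendstoD(2)) auto
  moreover have "\<forall>\<^sub>F n in sequentially. dust (G n) < \<epsilon> / 4"
    using assms by (intro order_tendstoD(2)) auto
  ultimately show ?thesis
  proof eventually_elim
    case (elim n)
    have "2 * ennreal (dust (G n)) \<le> 2 * ennreal (\<epsilon> / 4)"
      using elim by (intro mult_left_mono ennreal_leI) auto
    also have "\<dots> = ennreal (\<epsilon> / 2)"
      using ennreal_mult'[of 2 "\<epsilon> / 4"] by simp
    finally have "star_mass (G n) + 2 * ennreal (dust (G n)) \<le> ennreal (\<epsilon> / 2) + ennreal (\<epsilon> / 2)"
      using elim by (intro add_mono) auto
    also have "\<dots> = ennreal \<epsilon>"
      using \<open>0 < \<epsilon>\<close> by (simp flip: ennreal_plus)
    finally show ?case .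
  qed
qed

text \<open>The star mass may be added on the right because it tends to 0; this lets the capped mass
  be estimated from the kernel alone.\<close>

lemma degree_tails_vanishI:
  assumes sd: "(\<lambda>n. \<integral>\<^sup>+x. ennreal (star (G n) x) \<partial>base (G n)) \<longlonglongrightarrow> 0" "(\<lambda>n. dust (G n)) \<longlonglongrightarrow> 0"
    and capped: "\<And>\<epsilon>. 0 < \<epsilon> \<Longrightarrow> \<exists>\<delta>>0. \<forall>\<^sub>F n in sequentially.
      capped (ennreal \<delta>) (G n) \<le> ennreal \<epsilon> + star_mass (G n)"
  shows "degree_tails_vanish G"
  unfolding degree_tails_vanish_def
proof (intro allI impI)
  fix \<epsilon> :: real assume "0 < \<epsilon>"
  then have e3: "0 < \<epsilon> / 3" by simp
  let ?s = "\<lambda>n. star_mass (G n) + 2 * ennreal (dust (G n))"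
  obtain \<delta> where \<delta>: "0 < \<delta>" and ev: "\<forall>\<^sub>F n in sequentially.
      capped (ennreal \<delta>) (G n) \<le> ennreal (\<epsilon> / 3) + star_mass (G n)"
    using capped[OF e3] by blast
  have "\<forall>\<^sub>F n in sequentially. capped (ennreal \<delta>) (G n) + ?s n \<le> ennreal \<epsilon>"
    using ev eventually_star_dust_le[OF sd e3]
  proof eventually_elim
    case (elim n)
    have "capped (ennreal \<delta>) (G n) \<le> ennreal (\<epsilon> / 3) + ?s n"
      by (rule order_trans[OF elim(1)]) (simp add: add.assoc[symmetric])
    then have "capped (ennreal \<delta>) (G n) + ?s n \<le> (ennreal (\<epsilon> / 3) + ennreal (\<epsilon> / 3)) + ennreal (\<epsilon> / 3)"
      using elim(2) by (intro add_mono) (auto intro: order_trans add_left_mono)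
    also have "\<dots> = ennreal \<epsilon>"
      using \<open>0 < \<epsilon>\<close> by (simp flip: ennreal_plus)
    finally show ?case .
  qed
  with \<delta> show "\<exists>\<delta>>0. \<forall>\<^sub>F n in sequentially. capped (ennreal \<delta>) (G n) + ?s n \<le> ennreal \<epsilon>"
    by blast
qed

text \<open>On the set A of bounded measure min(D, \<delta>) is at most \<delta>; off A it is at
  most the kernel degree plus S, and the kernel degrees off A integrate to at most the mass outside
  \<open>A \<times> A\<close>.\<close>

lemma tail_regular_imp_degree_tails_vanish:
  assumes sd: "(\<lambda>n. \<integral>\<^sup>+x. ennreal (star (G n) x) \<partial>base (G n)) \<longlonglongrightarrow> 0" "(\<lambda>n. dust (G n)) \<longlonglongrightarrow> 0"
    and tr: "unif_tail_regular (range (\<lambda>n. (base (G n), kernel (G n))))"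
  shows "degree_tails_vanish G"
proof (rule degree_tails_vanishI[OF sd])
  fix \<epsilon> :: real assume "0 < \<epsilon>"
  then have "0 < \<epsilon> / 2" by simp
  then obtain m where m: "\<And>n. \<exists>A\<in>sets (base (G n)). emeasure (base (G n)) A \<le> ennreal m \<and>
      outside_mass (G n) A \<le> \<epsilon> / 2"
    using tr unfolding unif_tail_regular_def by fast
  \<comment> \<open>Chosen so that \<delta> times the measure of A is at most \<epsilon>/2. The
    absolute value and the summand 1 take care of a negative or vanishing \<open>m\<close>.\<close>
  define \<delta> where "\<delta> = \<epsilon> / (2 * (1 + \<bar>m\<bar>))"
  have \<delta>: "0 < \<delta>" "\<delta> * \<bar>m\<bar> \<le> \<epsilon> / 2"
    using \<open>0 < \<epsilon>\<close> by (auto simp: \<delta>_def field_simps)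
  have "capped (ennreal \<delta>) (G n) \<le> ennreal \<epsilon> + star_mass (G n)" for n
  proof -
    interpret sigma_finite_measure "base (G n)" by (rule measurable_graphexD) (rule G)
    note [measurable] = measurable_graphexD(2,3)[OF G[of n]]
    let ?S = "space (base (G n))"
    obtain A where A[measurable]: "A \<in> sets (base (G n))" and mA: "emeasure (base (G n)) A \<le> ennreal m"
      and d: "outside_mass (G n) A \<le> \<epsilon> / 2"
      using m[of n] by blast
    have "capped (ennreal \<delta>) (G n) \<le> (\<integral>\<^sup>+x. (ennreal \<delta> * indicator A x
        + (\<integral>\<^sup>+y. ennreal (kernel (G n) x y) \<partial>base (G n)) * indicator (?S - A) x) + ennreal (star (G n) x) \<partial>base (G n))"
      unfolding capped_def by (intro nn_integral_mono) (auto simp: nmarg_def indicator_def min_le_iff_disj add_increasing2)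
    also have "\<dots> = ennreal \<delta> * emeasure (base (G n)) A
        + (\<integral>\<^sup>+x. (\<integral>\<^sup>+y. ennreal (kernel (G n) x y) \<partial>base (G n)) * indicator (?S - A) x \<partial>base (G n))
        + star_mass (G n)"
      by (simp add: nn_integral_add nn_integral_cmult)
    also have "\<dots> \<le> (ennreal (\<epsilon> / 2) + ennreal (\<epsilon> / 2)) + star_mass (G n)"
    proof (intro add_right_mono add_mono)
      have "ennreal \<delta> * emeasure (base (G n)) A \<le> ennreal \<delta> * ennreal \<bar>m\<bar>"
        by (intro mult_left_mono order_trans[OF mA] ennreal_leI) auto
      also have "\<dots> \<le> ennreal (\<epsilon> / 2)"
        using \<delta> by (simp add: ennreal_leI flip: ennreal_mult)
      finally show "ennreal \<delta> * emeasure (base (G n)) A \<le> ennreal (\<epsilon> / 2)" .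
      show "(\<integral>\<^sup>+x. (\<integral>\<^sup>+y. ennreal (kernel (G n) x y) \<partial>base (G n)) * indicator (?S - A) x \<partial>base (G n)) \<le> ennreal (\<epsilon> / 2)"
        using kernel_mass_outside(1)[OF G fin A] ennreal_leI[OF d] by (rule order_trans)
    qed
    also have "ennreal (\<epsilon> / 2) + ennreal (\<epsilon> / 2) = ennreal \<epsilon>"
      using \<open>0 < \<epsilon>\<close> by (simp flip: ennreal_plus)
    finally show ?thesis .
  qed
  then show "\<exists>\<delta>>0. \<forall>\<^sub>F n in sequentially.
      capped (ennreal \<delta>) (G n) \<le> ennreal \<epsilon> + star_mass (G n)"
    using \<delta>(1) by (intro exI[of _ \<delta>]) simp
qed

end

section \<open>Cut convergence controls degrees\<close>

text \<open>The cut metric sees only the kernel, so cut closeness is exploited for the graphon part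
  of \<open>G n\<close> alone.\<close>

definition no_star :: "'a graphex \<Rightarrow> 'a graphex" where
  "no_star G = G\<lparr>star := \<lambda>_. 0, dust := 0\<rparr>"

lemma no_star_sel [simp]:
  "base (no_star G) = base G" "kernel (no_star G) = kernel G" "star (no_star G) = (\<lambda>_. 0)" "dust (no_star G) = 0"
  by (simp_all add: no_star_def)

lemma measurable_graphex_no_star: "measurable_graphex G \<Longrightarrow> measurable_graphex (no_star G)"
  by (simp add: measurable_graphex_def)

lemma nmarg_no_star: "nmarg G x = nmarg (no_star G) x + ennreal (star G x)"
  by (simp add: nmarg_def)

lemma rho_no_star_le: "rho (no_star G) \<le> rho G"
  unfolding rho_def add.assoc by (intro add_mono) auto

text \<open>Pointwise min(a + b, d) \<le> min(a, d) + b.\<close>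

lemma capped_le_no_star:
  assumes "measurable_graphex G"
  shows "capped \<delta> G \<le> capped \<delta> (no_star G) + star_mass G"
proof -
  note [measurable] = measurable_graphexD(3)[OF assms] measurable_nmarg[OF measurable_graphex_no_star[OF assms], simplified]
  have "capped \<delta> G \<le> (\<integral>\<^sup>+x. min (nmarg (no_star G) x) \<delta> + ennreal (star G x) \<partial>base G)"
  proof -
    have "min (a + b) d \<le> min a d + b" for a b d :: ennreal
      by (cases "a \<le> d") (auto simp: min.absorb1 min.absorb2 less_imp_le not_le intro: min.coboundedI1 min.coboundedI2 add_increasing2)
    then show ?thesis
      unfolding capped_def by (intro nn_integral_mono) (simp add: nmarg_no_star[of G])
  qed
  also have "\<dots> = capped \<delta> (no_star G) + star_mass G"
    unfolding capped_def no_star_sel by (rule nn_integral_add) simp_all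
  finally show ?thesis .
qed

text \<open>Makes everything proved about degrees of graphexes available for the graphon that is the
  cut limit.\<close>

definition graphon_graphex :: "'a measure \<Rightarrow> ('a \<Rightarrow> 'a \<Rightarrow> real) \<Rightarrow> 'a graphex" where
  "graphon_graphex M W = \<lparr>base = M, kernel = W, star = \<lambda>_. 0, dust = 0\<rparr>"

lemma graphon_graphex_sel [simp]:
  "base (graphon_graphex M W) = M" "kernel (graphon_graphex M W) = W"
  "star (graphon_graphex M W) = (\<lambda>_. 0)" "dust (graphon_graphex M W) = 0"
  by (simp_all add: graphon_graphex_def)

lemma measurable_graphon_graphex: "graphon M W \<Longrightarrow> measurable_graphex (graphon_graphex M W)"
  by (simp add: measurable_graphex_def)

lemma rho_graphon_graphex:
  assumes "integrable_graphon M W"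
  shows "rho (graphon_graphex M W) < \<infinity>"
proof -
  have "(\<integral>\<^sup>+p. ennreal (norm (case_prod W p)) \<partial>(M \<Otimes>\<^sub>M M)) < \<infinity>"
    using assms by (simp add: integrable_graphon_def integrable_iff_bounded)
  also have "(\<integral>\<^sup>+p. ennreal (norm (case_prod W p)) \<partial>(M \<Otimes>\<^sub>M M)) = (\<integral>\<^sup>+p. ennreal (case_prod W p) \<partial>(M \<Otimes>\<^sub>M M))"
    using assms by (intro nn_integral_cong) (auto simp: integrable_graphon_def graphon_def space_pair_measure)
  finally show ?thesis
    by (simp add: rho_def)
qed

lemma excess_pullback:
  assumes G: "measurable_graphex G" and mp: "measure_preserving \<theta> (base G) \<pi>"
  shows "excess \<delta> (pullback \<theta> \<pi> G) = excess \<delta> G"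
proof -
  note [measurable] = measurable_nmarg[OF G]
  have "excess \<delta> (pullback \<theta> \<pi> G) = (\<integral>\<^sup>+p. nmarg G (\<pi> p) - \<delta> \<partial>\<theta>)"
    unfolding excess_def pullback_sel by (intro nn_integral_cong) (simp add: nmarg_pullback[OF G mp])
  also have "\<dots> = excess \<delta> G"
    unfolding excess_def by (rule measure_preserving_nn_integral[OF mp]) simp
  finally show ?thesis .
qed

text \<open>Bridge from the signed integral in the cut norm to nonnegative integrals. Both masses
  are finite, so a bound on the absolute difference is a pair of additive inequalities, which can be
  chained in \<open>ennreal\<close>.\<close>

lemma set_lebesgue_integral_diff_le_iff:
  assumes P: "measurable_graphex P" "rho P < \<infinity>" and Q: "measurable_graphex Q" "rho Q < \<infinity>"
    and "base Q = base P" and AB: "A \<in> sets (base P)" "B \<in> sets (base P)" and "0 \<le> e"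
  shows "\<bar>LINT p:A \<times> B|base P \<Otimes>\<^sub>M base P. case_prod (\<lambda>x y. kernel P x y - kernel Q x y) p\<bar> \<le> e \<longleftrightarrow>
    pair_mass (base P) (kernel P) A B \<le> pair_mass (base P) (kernel Q) A B + ennreal e \<and>
    pair_mass (base P) (kernel Q) A B \<le> pair_mass (base P) (kernel P) A B + ennreal e"
proof -
  have AB': "A \<in> sets (base Q)" "B \<in> sets (base Q)"
    using assms by simp_all
  have "(LINT p:A \<times> B|base P \<Otimes>\<^sub>M base P. case_prod (\<lambda>x y. kernel P x y - kernel Q x y) p)
      = (LINT p:A \<times> B|base P \<Otimes>\<^sub>M base P. case_prod (kernel P) p - case_prod (kernel Q) p)"
    by (simp add: case_prod_beta')
  also have "\<dots> = (LINT p:A \<times> B|base P \<Otimes>\<^sub>M base P. case_prod (kernel P) p)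
      - (LINT p:A \<times> B|base P \<Otimes>\<^sub>M base P. case_prod (kernel Q) p)"
    using set_integrable_kernel[OF P AB] set_integrable_kernel[OF Q AB'] \<open>base Q = base P\<close>
    by (intro set_integral_diff(2)) simp_all
  also have "\<dots> = enn2real (pair_mass (base P) (kernel P) A B) - enn2real (pair_mass (base P) (kernel Q) A B)"
    using set_lebesgue_integral_kernel[OF P AB] set_lebesgue_integral_kernel[OF Q AB'] \<open>base Q = base P\<close> by simp
  finally have eq: "(LINT p:A \<times> B|base P \<Otimes>\<^sub>M base P. case_prod (\<lambda>x y. kernel P x y - kernel Q x y) p)
      = enn2real (pair_mass (base P) (kernel P) A B) - enn2real (pair_mass (base P) (kernel Q) A B)" .
  obtain a where a: "pair_mass (base P) (kernel P) A B = ennreal a" "0 \<le> a"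
    using pair_mass_finite[OF P AB] by (cases "pair_mass (base P) (kernel P) A B") auto
  obtain b where b: "pair_mass (base P) (kernel Q) A B = ennreal b" "0 \<le> b"
    using pair_mass_finite[OF Q AB'] \<open>base Q = base P\<close> by (cases "pair_mass (base P) (kernel Q) A B") auto
  show ?thesis
    unfolding eq a(1) b(1) using a(2) b(2) \<open>0 \<le> e\<close>
    by (auto simp: abs_le_iff ennreal_le_iff simp flip: ennreal_plus)
qed

lemma pair_mass_space:
  assumes "star G = (\<lambda>_. 0)"
  shows "pair_mass (base G) (kernel G) A (space (base G)) = (\<integral>\<^sup>+x. nmarg G x * indicator A x \<partial>base G)"
  unfolding pair_mass_def nmarg_def assms
  by (intro nn_integral_cong) (auto intro!: nn_integral_cong simp: indicator_def)

text \<open>For every A, \<integral> (D - \<delta>)^+ is at least the integral of D over A minus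
  \<delta> times the measure of A, with equality for A = {D > \<delta>}. Taking the optimal set for
  Q and using it as a competitor for P gives the claim; its measure is finite by Markov's
  inequality, so it cancels.\<close>

lemma excess_le_of_nmarg_le:
  assumes P: "measurable_graphex P" and Q: "measurable_graphex Q" "rho Q < \<infinity>" and "base Q = base P"
    and le: "\<And>A. A \<in> sets (base P) \<Longrightarrow> (\<integral>\<^sup>+x. nmarg Q x * indicator A x \<partial>base P)
      \<le> (\<integral>\<^sup>+x. nmarg P x * indicator A x \<partial>base P) + \<eta>" and "0 < \<delta>"
  shows "excess (ennreal \<delta>) Q \<le> excess (ennreal \<delta>) P + \<eta>"
proof -
  have [measurable]: "nmarg P \<in> borel_measurable (base P)" "nmarg Q \<in> borel_measurable (base P)"
    using measurable_nmarg[OF P] measurable_nmarg[OF Q(1)] assms(4) by simp_all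
  define A where "A = {x\<in>space (base P). ennreal \<delta> < nmarg Q x}"
  have A[measurable]: "A \<in> sets (base P)"
    unfolding A_def by measurable
  let ?m = "ennreal \<delta> * emeasure (base P) A"
  have "?m = (\<integral>\<^sup>+x. ennreal \<delta> * indicator A x \<partial>base P)"
    by (simp add: nn_integral_cmult)
  also have "\<dots> \<le> (\<integral>\<^sup>+x. nmarg Q x \<partial>base P)"
    by (intro nn_integral_mono) (auto simp: A_def indicator_def)
  also have "\<dots> \<le> rho Q"
    unfolding rho_eq[OF Q(1)] add.assoc \<open>base Q = base P\<close> by simp
  also note Q(2)
  finally have fin: "?m \<noteq> top" by simp
  have "?m + excess (ennreal \<delta>) Q = (\<integral>\<^sup>+x. ennreal \<delta> * indicator A x + (nmarg Q x - ennreal \<delta>) \<partial>base P)"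
    unfolding excess_def \<open>base Q = base P\<close> by (subst nn_integral_add) (simp_all add: nn_integral_cmult)
  also have "\<dots> = (\<integral>\<^sup>+x. nmarg Q x * indicator A x \<partial>base P)"
    by (intro nn_integral_cong)
      (auto simp: A_def indicator_def not_less add_diff_inverse_ennreal less_imp_le diff_eq_0_iff_ennreal
        intro: le_less_trans[OF _ ennreal_less_top])
  also have "\<dots> \<le> (\<integral>\<^sup>+x. nmarg P x * indicator A x \<partial>base P) + \<eta>"
    by (rule le[OF A])
  also have "\<dots> \<le> (\<integral>\<^sup>+x. ennreal \<delta> * indicator A x + (nmarg P x - ennreal \<delta>) \<partial>base P) + \<eta>"
  proof (intro add_right_mono nn_integral_mono)
    fix x
    have "nmarg P x \<le> ennreal \<delta> + (nmarg P x - ennreal \<delta>)"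
      using min_add_diff_ennreal[of "nmarg P x" "ennreal \<delta>"] by (metis add_right_mono min.cobounded2)
    then show "nmarg P x * indicator A x \<le> ennreal \<delta> * indicator A x + (nmarg P x - ennreal \<delta>)"
      by (simp add: indicator_def)
  qed
  also have "(\<integral>\<^sup>+x. ennreal \<delta> * indicator A x + (nmarg P x - ennreal \<delta>) \<partial>base P) = ?m + excess (ennreal \<delta>) P"
    unfolding excess_def by (subst nn_integral_add) (simp_all add: nn_integral_cmult)
  finally show ?thesis
    using fin by (simp add: add.assoc ennreal_add_left_cancel_le)
qed

text \<open>Rectangles whose second side is the whole space turn the cut norm into a comparison of
  the integrals of the degrees over every set A.\<close>

lemma delta_cut_bounds:
  assumes G: "measurable_graphex G" "rho G < \<infinity>" "star G = (\<lambda>_. 0)" and H: "measurable_graphex H" "rho H < \<infinity>" "star H = (\<lambda>_. 0)"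
    and less: "delta_cut (base G) (kernel G) (base H) (kernel H) < ereal \<eta>"
  shows "degree_mass G \<le> degree_mass H + ennreal \<eta>"
    and "0 < \<delta> \<Longrightarrow> excess (ennreal \<delta>) H \<le> excess (ennreal \<delta>) G + ennreal \<eta>"
proof -
  obtain \<kappa> where \<kappa>: "\<kappa> \<in> couplings (ext_space (base G)) (ext_space (base H))"
    and cut: "cut_norm \<kappa> (\<lambda>p q. ext_kernel (kernel G) (fst p) (fst q) - ext_kernel (kernel H) (snd p) (snd q)) < ereal \<eta>"
    using less unfolding delta_cut_def INF_less_iff by blast
  define P where "P = pullback \<kappa> fst (ext_graphex G)"
  define Q where "Q = pullback \<kappa> snd (ext_graphex H)"
  have mp: "measure_preserving \<kappa> (base (ext_graphex G)) fst" "measure_preserving \<kappa> (base (ext_graphex H)) snd"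
    using coupling_measure_preserving[OF \<kappa>] by simp_all
  note eG = measurable_graphex_ext[OF G(1)] and eH = measurable_graphex_ext[OF H(1)]
  have P: "measurable_graphex P" "rho P < \<infinity>" and Q: "measurable_graphex Q" "rho Q < \<infinity>"
    using G H rho_pullback[OF eG mp(1)] rho_pullback[OF eH mp(2)]
    by (simp_all add: P_def Q_def measurable_graphex_pullback[OF eG mp(1)] measurable_graphex_pullback[OF eH mp(2)] rho_ext)
  have b: "base P = \<kappa>" "base Q = base P"
    by (simp_all add: P_def Q_def)
  have star0: "star P = (\<lambda>_. 0)" "star Q = (\<lambda>_. 0)"
    using G(3) H(3) by (auto simp: P_def Q_def ext_star_def fun_eq_iff split: sum.splits)
  have bound: "\<bar>LINT p:A \<times> B|\<kappa> \<Otimes>\<^sub>M \<kappa>. case_prod (\<lambda>x y. kernel P x y - kernel Q x y) p\<bar> \<le> \<eta>"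
    if "A \<in> sets \<kappa>" "B \<in> sets \<kappa>" for A B
  proof -
    have "ereal \<bar>LINT p:A \<times> B|\<kappa> \<Otimes>\<^sub>M \<kappa>. case_prod (\<lambda>x y. kernel P x y - kernel Q x y) p\<bar>
        \<le> cut_norm \<kappa> (\<lambda>p q. ext_kernel (kernel G) (fst p) (fst q) - ext_kernel (kernel H) (snd p) (snd q))"
      unfolding cut_norm_def by (rule SUP_upper2[of "(A, B)"]) (use that in \<open>simp_all add: P_def Q_def\<close>)
    also note cut
    finally show ?thesis by simp
  qed
  have \<eta>: "0 \<le> \<eta>"
    using bound[of "{}" "{}"] by simp
  have J: "pair_mass \<kappa> (kernel P) A (space \<kappa>) \<le> pair_mass \<kappa> (kernel Q) A (space \<kappa>) + ennreal \<eta>"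
      "pair_mass \<kappa> (kernel Q) A (space \<kappa>) \<le> pair_mass \<kappa> (kernel P) A (space \<kappa>) + ennreal \<eta>"
    if "A \<in> sets \<kappa>" for A
    using set_lebesgue_integral_diff_le_iff[OF P Q b(2) _ _ \<eta>, of A "space \<kappa>"] bound[of A "space \<kappa>"] that b
    by auto
  have nmass: "pair_mass \<kappa> (kernel P) A (space \<kappa>) = (\<integral>\<^sup>+x. nmarg P x * indicator A x \<partial>\<kappa>)"
    "pair_mass \<kappa> (kernel Q) A (space \<kappa>) = (\<integral>\<^sup>+x. nmarg Q x * indicator A x \<partial>\<kappa>)" for A
    using pair_mass_space[OF star0(1)] pair_mass_space[OF star0(2)] b by simp_all
  \<comment> \<open>Excess at threshold 0 is the degree mass, so the transfer rules for the excess
    apply.\<close>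
  have total: "(\<integral>\<^sup>+x. nmarg P x \<partial>\<kappa>) = degree_mass G" "(\<integral>\<^sup>+x. nmarg Q x \<partial>\<kappa>) = degree_mass H"
    using excess_pullback[OF eG mp(1), of 0] excess_pullback[OF eH mp(2), of 0] excess_ext[OF G(1), of 0] excess_ext[OF H(1), of 0]
    by (simp_all add: excess_def P_def Q_def)
  have "(\<integral>\<^sup>+x. nmarg P x * indicator (space \<kappa>) x \<partial>\<kappa>) = (\<integral>\<^sup>+x. nmarg P x \<partial>\<kappa>)"
    "(\<integral>\<^sup>+x. nmarg Q x * indicator (space \<kappa>) x \<partial>\<kappa>) = (\<integral>\<^sup>+x. nmarg Q x \<partial>\<kappa>)"
    by (auto intro!: nn_integral_cong)
  with J(1)[of "space \<kappa>"] show "degree_mass G \<le> degree_mass H + ennreal \<eta>"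
    by (simp add: nmass total)
  show "excess (ennreal \<delta>) H \<le> excess (ennreal \<delta>) G + ennreal \<eta>" if "0 < \<delta>"
  proof -
    have "excess (ennreal \<delta>) Q \<le> excess (ennreal \<delta>) P + ennreal \<eta>"
      using J(2) unfolding nmass by (intro excess_le_of_nmarg_le[OF P(1) Q b(2) _ that]) (simp add: b)
    then show ?thesis
      by (simp add: P_def Q_def excess_pullback[OF eG mp(1)] excess_pullback[OF eH mp(2)] excess_ext G H)
  qed
qed

text \<open>Capped mass is degree mass minus excess. Cut closeness bounds the degree mass from above
  and the excess from below by those of the limit graphon U, so the capped mass exceeds that of U by
  at most 2 \<epsilon>/3. The threshold depends on U alone, and any integrable U will do.\<close>

lemma delta_cut_imp_degree_tails_vanish:
  assumes G: "\<And>n. measurable_graphex (G n)" and fin: "\<And>n. rho (G n) < \<infinity>"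
    and sd: "(\<lambda>n. \<integral>\<^sup>+x. ennreal (star (G n) x) \<partial>base (G n)) \<longlonglongrightarrow> 0" "(\<lambda>n. dust (G n)) \<longlonglongrightarrow> 0"
    and U: "integrable_graphon M U" and cut: "(\<lambda>n. delta_cut (base (G n)) (kernel (G n)) M U) \<longlonglongrightarrow> 0"
  shows "degree_tails_vanish G"
proof (rule degree_tails_vanishI[OF G fin sd])
  fix \<epsilon> :: real assume "0 < \<epsilon>"
  let ?U = "graphon_graphex M U"
  have U': "measurable_graphex ?U" "rho ?U < \<infinity>"
    using U rho_graphon_graphex[OF U] by (simp_all add: measurable_graphon_graphex integrable_graphon_def)
  have "0 < ennreal (\<epsilon> / 3)"
    using \<open>0 < \<epsilon>\<close> by simp
  then obtain \<delta> where \<delta>: "0 < \<delta>" "capped (ennreal \<delta>) ?U < ennreal (\<epsilon> / 3)"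
    using capped_vanishes[OF U'] by blast
  have "\<forall>\<^sub>F n in sequentially. delta_cut (base (G n)) (kernel (G n)) M U < ereal (\<epsilon> / 3)"
    using \<open>0 < \<epsilon>\<close> by (intro order_tendstoD(2)[OF cut]) simp
  then have "\<forall>\<^sub>F n in sequentially. capped (ennreal \<delta>) (G n) \<le> ennreal \<epsilon> + star_mass (G n)"
  proof eventually_elim
    case (elim n)
    let ?G = "no_star (G n)"
    have G': "measurable_graphex ?G" "rho ?G < \<infinity>"
      using G fin[of n] rho_no_star_le[of "G n"] by (auto simp: measurable_graphex_no_star intro: le_less_trans)
    have "delta_cut (base ?G) (kernel ?G) (base ?U) (kernel ?U) < ereal (\<epsilon> / 3)"
      using elim by simp
    note b = delta_cut_bounds[OF G' _ U' _ this, simplified no_star_sel graphon_graphex_sel, OF refl refl]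
    have "capped (ennreal \<delta>) ?G + excess (ennreal \<delta>) ?G = (\<integral>\<^sup>+x. nmarg ?G x \<partial>base (G n))"
      using capped_add_excess[OF G'(1)] by simp
    also have "\<dots> \<le> (\<integral>\<^sup>+x. nmarg ?U x \<partial>M) + ennreal (\<epsilon> / 3)"
      by (rule b(1))
    also have "(\<integral>\<^sup>+x. nmarg ?U x \<partial>M) = capped (ennreal \<delta>) ?U + excess (ennreal \<delta>) ?U"
      using capped_add_excess[OF U'(1)] by simp
    also have "\<dots> + ennreal (\<epsilon> / 3) \<le> ennreal (\<epsilon> / 3) + (excess (ennreal \<delta>) ?G + ennreal (\<epsilon> / 3)) + ennreal (\<epsilon> / 3)"
      using \<delta> by (intro add_right_mono add_mono b(2)) auto
    also have "\<dots> = (ennreal (\<epsilon> / 3) + ennreal (\<epsilon> / 3) + ennreal (\<epsilon> / 3)) + excess (ennreal \<delta>) ?G"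
      by (simp only: ac_simps)
    also have "ennreal (\<epsilon> / 3) + ennreal (\<epsilon> / 3) + ennreal (\<epsilon> / 3) = ennreal \<epsilon>"
      using \<open>0 < \<epsilon>\<close> by (simp flip: ennreal_plus)
    finally have "excess (ennreal \<delta>) ?G + capped (ennreal \<delta>) ?G \<le> excess (ennreal \<delta>) ?G + ennreal \<epsilon>"
      by (simp only: add.commute)
    moreover have "excess (ennreal \<delta>) ?G \<noteq> top"
    proof -
      have "excess (ennreal \<delta>) ?G \<le> rho ?G"
        unfolding rho_capped_excess[OF G'(1), of "ennreal \<delta>"] by simp
      then have "excess (ennreal \<delta>) ?G < \<infinity>"
        using G'(2) by (rule le_less_trans)
      then show ?thesis by simp
    qed
    ultimately have "capped (ennreal \<delta>) ?G \<le> ennreal \<epsilon>"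
      unfolding ennreal_add_left_cancel_le by simp
    then show ?case
      by (intro order_trans[OF capped_le_no_star[OF G]] add_right_mono)
  qed
  with \<delta>(1) show "\<exists>\<delta>>0. \<forall>\<^sub>F n in sequentially.
      capped (ennreal \<delta>) (G n) \<le> ennreal \<epsilon> + star_mass (G n)"
    by blast
qed

section \<open>Extending a coupling of submeasures\<close>

lemma couplings_distr:
  assumes \<theta>: "\<theta> \<in> couplings P Q" and f[measurable]: "f \<in> measurable P P'" and g[measurable]: "g \<in> measurable Q Q'"
  shows "distr \<theta> (P' \<Otimes>\<^sub>M Q') (map_prod f g) \<in> couplings (distr P P' f) (distr Q Q' g)"
proof -
  have \<theta>': "fst \<in> measurable \<theta> P" "snd \<in> measurable \<theta> Q" "distr \<theta> P fst = P" "distr \<theta> Q snd = Q"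
    using coupling_measure_preserving[OF \<theta>] by (auto simp: measure_preserving_def)
  note [measurable] = \<theta>'(1,2)
  have map[measurable]: "map_prod f g \<in> measurable \<theta> (P' \<Otimes>\<^sub>M Q')"
    unfolding map_prod_def case_prod_beta' by measurable
  let ?D = "distr \<theta> (P' \<Otimes>\<^sub>M Q') (map_prod f g)"
  have "distr ?D (distr P P' f) fst = distr ?D P' fst"
    by (intro distr_cong) simp_all
  also have "\<dots> = distr \<theta> P' (\<lambda>p. f (fst p))"
    by (simp add: distr_distr comp_def)
  also have "\<dots> = distr (distr \<theta> P fst) P' f"
    by (simp add: distr_distr comp_def)
  finally have 1: "distr ?D (distr P P' f) fst = distr P P' f"
    by (simp add: \<theta>')
  have "distr ?D (distr Q Q' g) snd = distr ?D Q' snd"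
    by (intro distr_cong) simp_all
  also have "\<dots> = distr \<theta> Q' (\<lambda>p. g (snd p))"
    by (simp add: distr_distr comp_def)
  also have "\<dots> = distr (distr \<theta> Q snd) Q' g"
    by (simp add: distr_distr comp_def)
  finally have 2: "distr ?D (distr Q Q' g) snd = distr Q Q' g"
    by (simp add: \<theta>')
  have "sets ?D = sets (distr P P' f \<Otimes>\<^sub>M distr Q Q' g)"
    by (simp cong: sets_pair_measure_cong)
  with 1 2 show ?thesis
    by (simp add: couplings_def)
qed

lemma couplings_add_measure:
  assumes "\<kappa>\<^sub>1 \<in> couplings P\<^sub>1 Q\<^sub>1" "\<kappa>\<^sub>2 \<in> couplings P\<^sub>2 Q\<^sub>2" "sets P\<^sub>2 = sets P\<^sub>1" "sets Q\<^sub>2 = sets Q\<^sub>1"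
  shows "add_measure \<kappa>\<^sub>1 \<kappa>\<^sub>2 \<in> couplings (add_measure P\<^sub>1 P\<^sub>2) (add_measure Q\<^sub>1 Q\<^sub>2)"
proof -
  have s: "sets \<kappa>\<^sub>1 = sets (P\<^sub>1 \<Otimes>\<^sub>M Q\<^sub>1)" "sets \<kappa>\<^sub>2 = sets \<kappa>\<^sub>1"
    using assms by (auto simp: couplings_def cong: sets_pair_measure_cong)
  have d: "distr \<kappa>\<^sub>1 P\<^sub>1 fst = P\<^sub>1" "distr \<kappa>\<^sub>1 Q\<^sub>1 snd = Q\<^sub>1" "distr \<kappa>\<^sub>2 P\<^sub>2 fst = P\<^sub>2" "distr \<kappa>\<^sub>2 Q\<^sub>2 snd = Q\<^sub>2"
    using assms by (auto simp: couplings_def)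
  have m: "fst \<in> measurable \<kappa>\<^sub>1 (add_measure P\<^sub>1 P\<^sub>2)" "snd \<in> measurable \<kappa>\<^sub>1 (add_measure Q\<^sub>1 Q\<^sub>2)"
    using s(1) by (simp_all cong: measurable_cong_sets)
  have c: "distr \<kappa>\<^sub>1 (add_measure P\<^sub>1 P\<^sub>2) fst = distr \<kappa>\<^sub>1 P\<^sub>1 fst" "distr \<kappa>\<^sub>2 (add_measure P\<^sub>1 P\<^sub>2) fst = distr \<kappa>\<^sub>2 P\<^sub>2 fst"
    "distr \<kappa>\<^sub>1 (add_measure Q\<^sub>1 Q\<^sub>2) snd = distr \<kappa>\<^sub>1 Q\<^sub>1 snd" "distr \<kappa>\<^sub>2 (add_measure Q\<^sub>1 Q\<^sub>2) snd = distr \<kappa>\<^sub>2 Q\<^sub>2 snd"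
    using assms(3,4) by (auto intro!: distr_cong)
  have "sets (add_measure \<kappa>\<^sub>1 \<kappa>\<^sub>2) = sets (add_measure P\<^sub>1 P\<^sub>2 \<Otimes>\<^sub>M add_measure Q\<^sub>1 Q\<^sub>2)"
    using s(1) by (simp cong: sets_pair_measure_cong)
  then show ?thesis
    using distr_add_measure[OF s(2) m(1)] distr_add_measure[OF s(2) m(2)] by (simp add: couplings_def c d)
qed

text \<open>The product measure divided by the common total mass. If that mass is 0 the factor is
  set to 1, and the zero product has the right marginals.\<close>

lemma couplings_finite_nonempty:
  assumes eq: "emeasure P (space P) = emeasure Q (space Q)" and fin: "emeasure Q (space Q) \<noteq> \<infinity>"
  shows "\<exists>\<omega>. \<omega> \<in> couplings P Q"
proof -
  interpret P: finite_measure P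
    by standard (use eq fin in simp)
  interpret Q: finite_measure Q
    by standard (use fin in simp)
  define m where "m = emeasure Q (space Q)"
  define r where "r = (if m = 0 then 1 else inverse m)"
  define \<omega> where "\<omega> = scale_measure r (P \<Otimes>\<^sub>M Q)"
  have m: "m = 0 \<or> r * m = 1"
  proof (cases "m = 0")
    case False
    then have "m / m = 1"
      by (intro ennreal_divide_self) (simp_all add: m_def less_top[symmetric])
    with False show ?thesis
      by (simp add: r_def divide_ennreal_def mult.commute)
  qed simp
  have "distr \<omega> P fst = P"
  proof (rule measure_eqI)
    fix A assume "A \<in> sets (distr \<omega> P fst)"
    then have A: "A \<in> sets P" by simp
    have "fst -` A \<inter> space \<omega> = A \<times> space Q"
      using sets.sets_into_space[OF A] by (auto simp: \<omega>_def space_scale_measure space_pair_measure)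
    moreover have "fst \<in> measurable \<omega> P"
      by (simp add: \<omega>_def cong: measurable_cong_sets)
    ultimately have "emeasure (distr \<omega> P fst) A = r * (emeasure P A * m)"
      using A by (simp add: emeasure_distr) (simp add: \<omega>_def m_def Q.emeasure_pair_measure_Times)
    also have "\<dots> = emeasure P A"
    proof (cases "m = 0")
      case True
      then have "emeasure P A = 0"
        using emeasure_mono[OF sets.sets_into_space[OF A] sets.top, of] eq by (simp add: m_def)
      then show ?thesis by simp
    next
      case False
      then show ?thesis
        using m by (metis mult.commute mult.left_commute mult_1)
    qed
    finally show "emeasure (distr \<omega> P fst) A = emeasure P A" .
  qed simp
  moreover have "distr \<omega> Q snd = Q"
  proof (rule measure_eqI)
    fix A assume "A \<in> sets (distr \<omega> Q snd)"
    then have A: "A \<in> sets Q" by simp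
    have "snd -` A \<inter> space \<omega> = space P \<times> A"
      using sets.sets_into_space[OF A] by (auto simp: \<omega>_def space_scale_measure space_pair_measure)
    moreover have "snd \<in> measurable \<omega> Q"
      by (simp add: \<omega>_def cong: measurable_cong_sets)
    ultimately have "emeasure (distr \<omega> Q snd) A = r * (m * emeasure Q A)"
      using A by (simp add: emeasure_distr) (simp add: \<omega>_def m_def eq Q.emeasure_pair_measure_Times)
    also have "\<dots> = emeasure Q A"
    proof (cases "m = 0")
      case True
      then have "emeasure Q A = 0"
        using emeasure_mono[OF sets.sets_into_space[OF A] sets.top, of] by (simp add: m_def)
      then show ?thesis by simp
    next
      case False
      then show ?thesis
        using m by (simp add: mult.assoc[symmetric])
    qed
    finally show "emeasure (distr \<omega> Q snd) A = emeasure Q A" .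
  qed simp
  ultimately show ?thesis
    by (intro exI[of _ \<omega>]) (simp add: couplings_def \<omega>_def)
qed

text \<open>Shifting the nonnegative half-line by \<open>a\<close> frees the interval \<open>[0, a)\<close>, to which a removed
  measure of total mass \<open>a\<close> can then be coupled.\<close>

definition gap :: "real \<Rightarrow> real \<Rightarrow> real" where
  "gap a t = (if t < 0 then t else t + a)"

definition ext_gap :: "real \<Rightarrow> 'a + real \<Rightarrow> 'a + real" where
  "ext_gap a = map_sum (\<lambda>x. x) (gap a)"

lemma ext_gap_simps [simp]: "ext_gap a (Inl x) = Inl x" "ext_gap a (Inr t) = Inr (gap a t)"
  by (simp_all add: ext_gap_def)

lemma measurable_gap [measurable]: "gap a \<in> borel_measurable borel"
  unfolding gap_def by measurable

text \<open>Decompose the line into the negative half, [0, a) and [a, \<infinity>). The shift fixes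
  the first piece and, by translation invariance, carries [0, \<infinity>) to the last.\<close>

lemma emeasure_gap:
  assumes "0 \<le> a" and [measurable]: "A \<in> sets borel"
  shows "emeasure lborel (gap a -` A) + emeasure lborel (A \<inter> {0..<a}) = emeasure lborel A"
proof -
  have [measurable]: "gap a -` A \<in> sets borel"
    using measurable_sets[OF measurable_gap assms(2), of a] by simp
  have "(\<integral>\<^sup>+t. indicator A t * indicator {a..} t \<partial>lborel) = (\<integral>\<^sup>+t. indicator A (a + t) * indicator {a..} (a + t) \<partial>lborel)"
    using nn_integral_real_affine[of "\<lambda>t. indicator A t * indicator {a..} t" 1 a] by simp
  also have "\<dots> = (\<integral>\<^sup>+t. indicator A (a + t) * indicator {0..} t \<partial>lborel)"
    by (intro nn_integral_cong) (auto simp: indicator_def)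
  finally have shift: "(\<integral>\<^sup>+t. indicator A (a + t) * indicator {0..} t \<partial>lborel) = (\<integral>\<^sup>+t. indicator A t * indicator {a..} t \<partial>lborel)" ..
  have [measurable]: "(\<lambda>t. indicator A (a + t) :: ennreal) \<in> borel_measurable borel"
    by measurable
  have "emeasure lborel (gap a -` A) = (\<integral>\<^sup>+t. indicator (gap a -` A) t \<partial>lborel)"
    by simp
  also have "\<dots> = (\<integral>\<^sup>+t. indicator A t * indicator {..<0} t + indicator A (a + t) * indicator {0..} t \<partial>lborel)"
    by (intro nn_integral_cong) (auto simp: indicator_def gap_def add.commute)
  also have "\<dots> = (\<integral>\<^sup>+t. indicator A t * indicator {..<0} t \<partial>lborel) + (\<integral>\<^sup>+t. indicator A t * indicator {a..} t \<partial>lborel)"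
    by (simp add: nn_integral_add shift)
  finally have "emeasure lborel (gap a -` A) + emeasure lborel (A \<inter> {0..<a})
      = (\<integral>\<^sup>+t. indicator A t * indicator {..<0} t \<partial>lborel) + (\<integral>\<^sup>+t. indicator A t * indicator {a..} t \<partial>lborel)
        + (\<integral>\<^sup>+t. indicator (A \<inter> {0..<a}) t \<partial>lborel)"
    by simp
  also have "\<dots> = (\<integral>\<^sup>+t. indicator A t * indicator {..<0} t + indicator A t * indicator {a..} t + indicator (A \<inter> {0..<a}) t \<partial>lborel)"
    by (simp add: nn_integral_add)
  also have "\<dots> = (\<integral>\<^sup>+t. indicator A t \<partial>lborel)"
    using \<open>0 \<le> a\<close> by (intro nn_integral_cong) (auto simp: indicator_def)
  finally show ?thesis by simp
qed

lemma measurable_ext_gap [measurable]: "ext_gap a \<in> measurable (ext_space M) (ext_space M)"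
  by (simp add: measurable_ext_iff)

lemma sets_ext_space_cong: "sets M = sets N \<Longrightarrow> sets (ext_space M) = sets (ext_space N)"
  by (simp add: sets_ext_space)

text \<open>Reassembles the full extended space from the extended submeasure with its line shifted,
  the removed part \<alpha> in its original place, and Lebesgue measure on the gap. In its use,
  \<open>a\<close> is the mass removed on the other side, so the gap has room for the partner of
  that mass.\<close>

lemma ext_space_gap_decomposition:
  assumes "sets \<mu> = sets M" "sets \<alpha> = sets M" and add: "add_measure \<mu> \<alpha> = M" and "0 \<le> a"
  shows "add_measure (distr (ext_space \<mu>) (ext_space M) (ext_gap a))
    (add_measure (distr \<alpha> (ext_space M) Inl) (distr (density lborel (indicator {0..<a})) (ext_space M) Inr)) = ext_space M"
    (is "add_measure ?A (add_measure ?B ?C) = _")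
proof (rule measure_eqI)
  fix S assume "S \<in> sets (add_measure ?A (add_measure ?B ?C))"
  then have S: "S \<in> sets (ext_space M)" by simp
  then have S': "Inl -` S \<in> sets M" "Inr -` S \<in> sets borel"
    by (simp_all add: sets_ext_space)
  have sp: "space \<mu> = space M" "space \<alpha> = space M"
    using assms by (auto dest: sets_eq_imp_space_eq)
  have meas: "ext_gap a \<in> measurable (ext_space \<mu>) (ext_space M)" "Inl \<in> measurable \<alpha> (ext_space M)"
    "Inr \<in> measurable (density lborel (indicator {0..<a})) (ext_space M)"
    using measurable_ext_gap[of a M] measurable_Inl_ext[of M] measurable_Inr_ext[of M] assms(1,2) sets_ext_space_cong[OF assms(1)]
    by (simp_all cong: measurable_cong_sets)
  have "Inl -` (ext_gap a -` S \<inter> space (ext_space \<mu>)) = Inl -` S"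
    "Inr -` (ext_gap a -` S \<inter> space (ext_space \<mu>)) = gap a -` (Inr -` S)"
    using sets.sets_into_space[OF S'(1)] by (auto simp: space_ext_space sp)
  moreover have "ext_gap a -` S \<inter> space (ext_space \<mu>) \<in> sets (ext_space \<mu>)"
    by (rule measurable_sets[OF meas(1) S])
  ultimately have 1: "emeasure ?A S = emeasure \<mu> (Inl -` S) + emeasure lborel (gap a -` (Inr -` S))"
    using meas(1) S by (simp add: emeasure_distr emeasure_ext_space)
  have "Inl -` S \<inter> space \<alpha> = Inl -` S"
    using sets.sets_into_space[OF S'(1)] by (auto simp: sp)
  then have 2: "emeasure ?B S = emeasure \<alpha> (Inl -` S)"
    using meas(2) S by (simp add: emeasure_distr)
  have 3: "emeasure ?C S = emeasure lborel (Inr -` S \<inter> {0..<a})"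
    using meas(3) S S' by (simp add: emeasure_distr emeasure_density nn_integral_set_ennreal)
      (simp add: Int_commute flip: indicator_inter_arith)
  have "emeasure (add_measure ?A (add_measure ?B ?C)) S
      = (emeasure \<mu> (Inl -` S) + emeasure \<alpha> (Inl -` S))
        + (emeasure lborel (gap a -` (Inr -` S)) + emeasure lborel (Inr -` S \<inter> {0..<a}))"
    by (simp add: emeasure_add_measure 1 2 3 ac_simps)
  also have "\<dots> = emeasure M (Inl -` S) + emeasure lborel (Inr -` S)"
    using emeasure_gap[OF \<open>0 \<le> a\<close> S'(2)] emeasure_add_measure[of \<alpha> \<mu> "Inl -` S"] assms(1,2) add by simp
  also have "\<dots> = emeasure (ext_space M) S"
    using S by (simp add: emeasure_ext_space)
  finally show "emeasure (add_measure ?A (add_measure ?B ?C)) S = emeasure (ext_space M) S" .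
qed simp

text \<open>Mass removed from M has no partner in \<theta>; it is matched with the gap [0, a) in the
  line adjoined to N, and the mass removed from N with [0, b) in the line adjoined to M. Hence the
  crossed shifts: b on the first coordinate, a on the second. The lines carry no kernel, so shifting
  them changes no kernel value.\<close>

lemma couplings_extend:
  assumes M: "sets \<mu> = sets M" "sets \<alpha> = sets M" "add_measure \<mu> \<alpha> = M" "emeasure \<alpha> (space M) = ennreal a" "0 \<le> a"
    and N: "sets \<nu> = sets N" "sets \<beta> = sets N" "add_measure \<nu> \<beta> = N" "emeasure \<beta> (space N) = ennreal b" "0 \<le> b"
    and \<theta>: "\<theta> \<in> couplings (ext_space \<mu>) (ext_space \<nu>)"
  obtains \<omega>\<^sub>1 \<omega>\<^sub>2 where
    "\<omega>\<^sub>1 \<in> couplings (distr \<alpha> (ext_space M) Inl) (distr (density lborel (indicator {0..<a})) (ext_space N) Inr)"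
    "\<omega>\<^sub>2 \<in> couplings (distr (density lborel (indicator {0..<b})) (ext_space M) Inr) (distr \<beta> (ext_space N) Inl)"
    "add_measure (distr \<theta> (ext_space M \<Otimes>\<^sub>M ext_space N) (map_prod (ext_gap b) (ext_gap a))) (add_measure \<omega>\<^sub>1 \<omega>\<^sub>2)
      \<in> couplings (ext_space M) (ext_space N)"
proof -
  have meas: "ext_gap b \<in> measurable (ext_space \<mu>) (ext_space M)" "ext_gap a \<in> measurable (ext_space \<nu>) (ext_space N)"
    using measurable_ext_gap[of b M] measurable_ext_gap[of a N] sets_ext_space_cong[OF M(1)] sets_ext_space_cong[OF N(1)]
    by (simp_all cong: measurable_cong_sets)
  have leb: "emeasure (distr (density lborel (indicator {0..<d})) (ext_space L) Inr) (space (ext_space L)) = ennreal d"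
    if "0 \<le> d" for d and L :: "'c measure"
  proof -
    have "Inr -` space (ext_space L) \<inter> space (density lborel (indicator {0..<d})) = UNIV"
      by (auto simp: space_ext_space)
    then show ?thesis
      using that by (subst emeasure_distr) (simp_all add: emeasure_density cong: measurable_cong_sets)
  qed
  have inl: "emeasure (distr \<gamma> (ext_space L) Inl) (space (ext_space L)) = emeasure \<gamma> (space L)" if "sets \<gamma> = sets L"
    for \<gamma> L :: "'c measure"
  proof -
    have "Inl -` space (ext_space L) \<inter> space \<gamma> = space L"
      using sets_eq_imp_space_eq[OF that] by (auto simp: space_ext_space)
    moreover have "Inl \<in> measurable \<gamma> (ext_space L)"
      using that measurable_Inl_ext[of L] by (simp cong: measurable_cong_sets)
    ultimately show ?thesis
      by (simp add: emeasure_distr)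
  qed
  let ?A = "distr \<alpha> (ext_space M) Inl" and ?A' = "distr (density lborel (indicator {0..<a})) (ext_space N) Inr"
  let ?B = "distr \<beta> (ext_space N) Inl" and ?B' = "distr (density lborel (indicator {0..<b})) (ext_space M) Inr"
  obtain \<omega>\<^sub>1 where \<omega>1: "\<omega>\<^sub>1 \<in> couplings ?A ?A'"
    using couplings_finite_nonempty[of ?A ?A'] leb[OF M(5), of N] inl[OF M(2)] M(4) by auto
  obtain \<omega>\<^sub>2 where \<omega>2: "\<omega>\<^sub>2 \<in> couplings ?B' ?B"
    using couplings_finite_nonempty[of ?B' ?B] leb[OF N(5), of M] inl[OF N(2)] N(4) by auto
  let ?P = "distr (ext_space \<mu>) (ext_space M) (ext_gap b)" and ?Q = "distr (ext_space \<nu>) (ext_space N) (ext_gap a)"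
  have "add_measure (distr \<theta> (ext_space M \<Otimes>\<^sub>M ext_space N) (map_prod (ext_gap b) (ext_gap a))) (add_measure \<omega>\<^sub>1 \<omega>\<^sub>2)
      \<in> couplings (add_measure ?P (add_measure ?A ?B')) (add_measure ?Q (add_measure ?A' ?B))"
    by (intro couplings_add_measure couplings_distr \<theta> meas \<omega>1 \<omega>2) simp_all
  moreover have "add_measure ?P (add_measure ?A ?B') = ext_space M"
    by (rule ext_space_gap_decomposition[OF M(1-3) N(5)])
  moreover have "add_measure ?A' ?B = add_measure ?B ?A'"
    by (rule measure_eqI) (simp_all add: emeasure_add_measure add.commute)
  moreover have "add_measure ?Q (add_measure ?B ?A') = ext_space N"
    by (rule ext_space_gap_decomposition[OF N(1-3) M(5)])
  ultimately show ?thesis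
    using that[OF \<omega>1 \<omega>2] by simp
qed

section \<open>Cut norm of the extended coupling\<close>

text \<open>Test the norm with the indicators of A and B divided by sqrt a and sqrt b. The factor s
  = 1 or -1 yields the absolute value, since the norm is a supremum of signed integrals. A null set
  cannot be normalised, but then the rectangle is null as well.\<close>

lemma norm_2_2_rectangle:
  assumes "sigma_finite_measure M" and norm: "norm_2_2 M U \<le> ereal c" and "0 \<le> c"
    and A[measurable]: "A \<in> sets M" and B[measurable]: "B \<in> sets M"
    and "emeasure M A \<le> ennreal k" "emeasure M B \<le> ennreal k" "0 \<le> k"
  shows "\<bar>LINT p:A \<times> B|M \<Otimes>\<^sub>M M. case_prod U p\<bar> \<le> c * k"
proof -
  interpret sigma_finite_measure M by fact
  define a where "a = measure M A"
  define b where "b = measure M B"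
  have fin: "emeasure M A \<noteq> \<infinity>" "emeasure M B \<noteq> \<infinity>"
    using assms(6,7) by (auto simp: top_unique)
  have em: "emeasure M A = ennreal a" "emeasure M B = ennreal b"
    using fin by (simp_all add: a_def b_def emeasure_eq_ennreal_measure)
  have ab: "0 \<le> a" "0 \<le> b" "a \<le> k" "b \<le> k"
    using assms(6-8) unfolding em by (simp_all add: a_def b_def)
  let ?I = "LINT p:A \<times> B|M \<Otimes>\<^sub>M M. case_prod U p"
  show ?thesis
  proof (cases "a = 0 \<or> b = 0")
    case True
    then have "emeasure (M \<Otimes>\<^sub>M M) (A \<times> B) = 0"
      by (subst emeasure_pair_measure_Times) (auto simp: em)
    then have "A \<times> B \<in> null_sets (M \<Otimes>\<^sub>M M)"
      by auto
    then have "AE p in M \<Otimes>\<^sub>M M. p \<notin> A \<times> B"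
      by (rule AE_not_in)
    then have "AE p in M \<Otimes>\<^sub>M M. indicator (A \<times> B) p *\<^sub>R case_prod U p = 0"
      by eventually_elim (auto simp: indicator_def)
    then have "?I = 0"
      unfolding set_lebesgue_integral_def by (rule integral_eq_zero_AE)
    then show ?thesis
      using \<open>0 \<le> c\<close> \<open>0 \<le> k\<close> by simp
  next
    case False
    then have pos: "0 < a" "0 < b"
      using ab by auto
    define f where "f x = indicator A x / sqrt a" for x
    define g where "g s x = s * indicator B x / sqrt b" for s :: real and x
    have [measurable]: "f \<in> borel_measurable M" "g s \<in> borel_measurable M" for s
      unfolding f_def g_def by measurable
    have "(\<integral>x. (f x)\<^sup>2 \<partial>M) = (\<integral>x. indicator A x * (1 / a) \<partial>M)"
      using pos by (intro Bochner_Integration.integral_cong) (auto simp: f_def indicator_def power_divide)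
    also have "\<dots> = 1"
      using pos fin by (simp add: a_def)
    finally have f1: "L2_nrm M f = 1"
      by (simp add: L2_nrm_def)
    have g1: "L2_nrm M (g s) = 1" if "s\<^sup>2 = 1" for s
    proof -
      have "(\<integral>x. (g s x)\<^sup>2 \<partial>M) = (\<integral>x. indicator B x * (1 / b) \<partial>M)"
        using pos that by (intro Bochner_Integration.integral_cong) (auto simp: g_def indicator_def power_divide)
      also have "\<dots> = 1"
        using pos fin by (simp add: b_def)
      finally show ?thesis
        by (simp add: L2_nrm_def)
    qed
    have le: "s * ?I \<le> c * k" if s: "s\<^sup>2 = 1" for s
    proof -
      have "ereal (\<integral>(x, y). f x * U x y * g s y \<partial>(M \<Otimes>\<^sub>M M)) \<le> norm_2_2 M U"
        unfolding norm_2_2_def by (rule SUP_upper2[of "(f, g s)"]) (use f1 g1[OF s] in auto)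
      from order_trans[OF this norm] have 1: "(\<integral>(x, y). f x * U x y * g s y \<partial>(M \<Otimes>\<^sub>M M)) \<le> c"
        by simp
      have "(\<integral>(x, y). f x * U x y * g s y \<partial>(M \<Otimes>\<^sub>M M))
          = (\<integral>p. (s / (sqrt a * sqrt b)) * (indicator (A \<times> B) p *\<^sub>R case_prod U p) \<partial>(M \<Otimes>\<^sub>M M))"
        by (intro Bochner_Integration.integral_cong) (auto simp: f_def g_def indicator_def)
      also have "\<dots> = s * ?I / (sqrt a * sqrt b)"
        unfolding set_lebesgue_integral_def by simp
      finally have "s * ?I \<le> c * (sqrt a * sqrt b)"
        using 1 pos by (simp add: pos_divide_le_eq)
      also have "\<dots> \<le> c * (sqrt k * sqrt k)"
        using ab \<open>0 \<le> c\<close> by (intro mult_left_mono mult_mono) auto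
      finally show ?thesis
        using \<open>0 \<le> k\<close> by simp
    qed
    show ?thesis
      using le[of 1] le[of "-1"] by (simp add: abs_le_iff)
  qed
qed

text \<open>Pairs lost on discarding \<beta> have their first or their second point in \<beta>.
  Either kind has at most the mass \<integral> D d\<beta>, the second one by Tonelli and
  symmetry.\<close>

lemma split_pair_mass:
  assumes P: "measurable_graphex P" and \<gamma>: "sets \<gamma> = sets (base P)" "sets \<beta> = sets (base P)" "add_measure \<gamma> \<beta> = base P"
    and A: "A \<in> sets (base P)" and B: "B \<in> sets (base P)"
  shows "pair_mass \<gamma> (kernel P) A B \<le> pair_mass (base P) (kernel P) A B"
    and "pair_mass (base P) (kernel P) A B \<le> pair_mass \<gamma> (kernel P) A B + 2 * (\<integral>\<^sup>+x. nmarg P x \<partial>\<beta>)"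
proof -
  note split = split_nn_integral[OF P \<gamma>]
  interpret \<gamma>: sigma_finite_measure \<gamma> by (rule split_sigma_finite[OF P \<gamma>])
  interpret \<beta>: sigma_finite_measure \<beta> by (rule split_sigma_finite[OF P \<gamma>])
  interpret sigma_finite_measure "base P" by (rule measurable_graphexD[OF P])
  interpret pair_sigma_finite \<gamma> \<beta> ..
  have sp: "space \<gamma> = space (base P)" "space \<beta> = space (base P)"
    using split_space[OF P \<gamma>] .
  have [measurable]: "A \<in> sets (base P)" "B \<in> sets (base P)" "A \<in> sets \<gamma>" "B \<in> sets \<gamma>" "A \<in> sets \<beta>" "B \<in> sets \<beta>"
    using A B \<gamma> by simp_all
  have [measurable]: "(\<lambda>(x, y). kernel P x y) \<in> borel_measurable (base P \<Otimes>\<^sub>M base P)"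
    by (rule measurable_graphexD[OF P])
  have "(\<lambda>(x, y). kernel P x y) \<in> borel_measurable (L \<Otimes>\<^sub>M L')"
    if "sets L = sets (base P)" "sets L' = sets (base P)" for L L'
    by (subst measurable_cong_sets[OF sets_pair_measure_cong[OF that] refl]) simp
  from this[OF refl \<gamma>(1)] this[OF refl \<gamma>(2)] this[OF \<gamma>(1,2)] this[OF \<gamma>(1,1)]
  have [measurable]: "(\<lambda>(x, y). kernel P x y) \<in> borel_measurable (base P \<Otimes>\<^sub>M \<gamma>)"
    "(\<lambda>(x, y). kernel P x y) \<in> borel_measurable (base P \<Otimes>\<^sub>M \<beta>)"
    "(\<lambda>(x, y). kernel P x y) \<in> borel_measurable (\<gamma> \<Otimes>\<^sub>M \<beta>)"
    "(\<lambda>(x, y). kernel P x y) \<in> borel_measurable (\<gamma> \<Otimes>\<^sub>M \<gamma>)" .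
  let ?d = "\<lambda>L x. \<integral>\<^sup>+y. ennreal (kernel P x y) * indicator B y \<partial>L"
  have d[measurable]: "?d (base P) \<in> borel_measurable (base P)" "?d \<gamma> \<in> borel_measurable (base P)" "?d \<beta> \<in> borel_measurable (base P)"
    by measurable
  have dd[measurable]: "?d \<gamma> \<in> borel_measurable \<gamma>" "?d \<beta> \<in> borel_measurable \<gamma>"
    using d(2,3) \<gamma>(1) by (simp_all cong: measurable_cong_sets)
  have d_split: "?d (base P) x = ?d \<gamma> x + ?d \<beta> x" if "x \<in> space (base P)" for x
    using that by (intro split) measurable
  have "pair_mass (base P) (kernel P) A B = (\<integral>\<^sup>+x. ?d (base P) x * indicator A x \<partial>\<gamma>) + (\<integral>\<^sup>+x. ?d (base P) x * indicator A x \<partial>\<beta>)"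
    unfolding pair_mass_def by (intro split) measurable
  also have "(\<integral>\<^sup>+x. ?d (base P) x * indicator A x \<partial>\<gamma>) = (\<integral>\<^sup>+x. ?d \<gamma> x * indicator A x + ?d \<beta> x * indicator A x \<partial>\<gamma>)"
    by (intro nn_integral_cong) (simp add: d_split sp distrib_right)
  also have "\<dots> = pair_mass \<gamma> (kernel P) A B + (\<integral>\<^sup>+x. ?d \<beta> x * indicator A x \<partial>\<gamma>)"
    unfolding pair_mass_def by (rule nn_integral_add) measurable
  finally have eq: "pair_mass (base P) (kernel P) A B = pair_mass \<gamma> (kernel P) A B + (\<integral>\<^sup>+x. ?d \<beta> x * indicator A x \<partial>\<gamma>)
      + (\<integral>\<^sup>+x. ?d (base P) x * indicator A x \<partial>\<beta>)" .
  then show "pair_mass \<gamma> (kernel P) A B \<le> pair_mass (base P) (kernel P) A B"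
    by (simp add: add.assoc)
  have nm: "(\<integral>\<^sup>+y. ennreal (kernel P x y) \<partial>base P) \<le> nmarg P x" for x
    by (simp add: nmarg_def)
  have r1: "(\<integral>\<^sup>+x. ?d (base P) x * indicator A x \<partial>\<beta>) \<le> (\<integral>\<^sup>+x. nmarg P x \<partial>\<beta>)"
  proof (rule nn_integral_mono)
    fix x
    have "?d (base P) x * indicator A x \<le> (\<integral>\<^sup>+y. ennreal (kernel P x y) \<partial>base P)"
      by (auto simp: indicator_def intro!: nn_integral_mono)
    then show "?d (base P) x * indicator A x \<le> nmarg P x"
      using nm by (rule order_trans)
  qed
  have "(\<integral>\<^sup>+x. ?d \<beta> x * indicator A x \<partial>\<gamma>) \<le> (\<integral>\<^sup>+x. \<integral>\<^sup>+y. ennreal (kernel P x y) \<partial>\<beta> \<partial>\<gamma>)"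
    by (intro nn_integral_mono) (auto simp: indicator_def intro!: nn_integral_mono)
  also have "\<dots> = (\<integral>\<^sup>+y. \<integral>\<^sup>+x. ennreal (kernel P x y) \<partial>\<gamma> \<partial>\<beta>)"
    by (rule Fubini'[symmetric]) measurable
  also have "\<dots> \<le> (\<integral>\<^sup>+y. nmarg P y \<partial>\<beta>)"
  proof (rule nn_integral_mono)
    fix y assume "y \<in> space \<beta>"
    then have y: "y \<in> space (base P)"
      by (simp add: sp)
    have "(\<integral>\<^sup>+x. ennreal (kernel P x y) \<partial>\<gamma>) = (\<integral>\<^sup>+x. ennreal (kernel P y x) \<partial>\<gamma>)"
      using measurable_graphexD(7)[OF P] y by (intro nn_integral_cong) (auto simp: sp)
    also have "\<dots> \<le> (\<integral>\<^sup>+x. ennreal (kernel P y x) \<partial>base P)"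
    proof -
      have "(\<lambda>x. ennreal (kernel P y x)) \<in> borel_measurable (base P)"
        using y by measurable
      from split[OF this] show ?thesis by simp
    qed
    also note nm
    finally show "(\<integral>\<^sup>+x. ennreal (kernel P x y) \<partial>\<gamma>) \<le> nmarg P y" .
  qed
  finally have r2: "(\<integral>\<^sup>+x. ?d \<beta> x * indicator A x \<partial>\<gamma>) \<le> (\<integral>\<^sup>+y. nmarg P y \<partial>\<beta>)" .
  show "pair_mass (base P) (kernel P) A B \<le> pair_mass \<gamma> (kernel P) A B + 2 * (\<integral>\<^sup>+x. nmarg P x \<partial>\<beta>)"
    unfolding eq mult_2 add.assoc by (intro add_left_mono add_mono r1 r2)
qed

lemma ext_kernel_gap [simp]: "ext_kernel W (ext_gap a p) (ext_gap a q) = ext_kernel W p q"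
  by (cases p; cases q) simp_all

lemma nmarg_ext_gap:
  assumes "measurable_graphex G"
  shows "nmarg (ext_graphex G) (ext_gap a p) = nmarg (ext_graphex G) p"
  using assms by (cases p) (simp_all add: nmarg_ext)

text \<open>A rectangle seen by the image of \<theta> restricted to Z becomes a rectangle of
  \<theta> with both sides inside Z, where the norm estimate applies.\<close>

lemma pair_mass_distr_density:
  assumes "sigma_finite_measure \<theta>" and [measurable]: "\<tau> \<in> measurable \<theta> N" "Z \<in> sets \<theta>" "A \<in> sets N" "B \<in> sets N"
    and F: "case_prod F \<in> borel_measurable (N \<Otimes>\<^sub>M N)"
  shows "pair_mass (distr (density \<theta> (indicator Z)) N \<tau>) F A B
    = pair_mass \<theta> (\<lambda>p q. F (\<tau> p) (\<tau> q)) (Z \<inter> (\<tau> -` A \<inter> space \<theta>)) (Z \<inter> (\<tau> -` B \<inter> space \<theta>))"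
proof -
  interpret sigma_finite_measure \<theta> by fact
  let ?D = "distr (density \<theta> (indicator Z)) N \<tau>"
  note [measurable] = F
  have [measurable]: "\<tau> \<in> measurable (density \<theta> (indicator Z)) N"
    by measurable
  have int: "(\<integral>\<^sup>+x. f x \<partial>?D) = (\<integral>\<^sup>+p. indicator Z p * f (\<tau> p) \<partial>\<theta>)" if [measurable]: "f \<in> borel_measurable N" for f
    by (simp add: nn_integral_distr nn_integral_density)
  have inner: "(\<integral>\<^sup>+y. ennreal (F x y) * indicator B y \<partial>?D) = (\<integral>\<^sup>+q. indicator Z q * (ennreal (F x (\<tau> q)) * indicator B (\<tau> q)) \<partial>\<theta>)"
    if [simp]: "x \<in> space N" for x
    by (rule int) measurable
  have "(\<lambda>x. \<integral>\<^sup>+q. indicator Z q * (ennreal (F x (\<tau> q)) * indicator B (\<tau> q)) \<partial>\<theta>) \<in> borel_measurable N"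
    by measurable
  then have [measurable]: "(\<lambda>x. \<integral>\<^sup>+y. ennreal (F x y) * indicator B y \<partial>?D) \<in> borel_measurable N"
    by (subst measurable_cong[OF inner])
  have "pair_mass ?D F A B = (\<integral>\<^sup>+p. indicator Z p * ((\<integral>\<^sup>+y. ennreal (F (\<tau> p) y) * indicator B y \<partial>?D) * indicator A (\<tau> p)) \<partial>\<theta>)"
    unfolding pair_mass_def by (rule int) measurable
  also have "\<dots> = pair_mass \<theta> (\<lambda>p q. F (\<tau> p) (\<tau> q)) (Z \<inter> (\<tau> -` A \<inter> space \<theta>)) (Z \<inter> (\<tau> -` B \<inter> space \<theta>))"
    unfolding pair_mass_def
  proof (intro nn_integral_cong)
    fix p assume p: "p \<in> space \<theta>"
    then have "\<tau> p \<in> space N"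
      by (rule measurable_space[rotated]) measurable
    note inner[OF this]
    also have "(\<integral>\<^sup>+q. indicator Z q * (ennreal (F (\<tau> p) (\<tau> q)) * indicator B (\<tau> q)) \<partial>\<theta>)
        = (\<integral>\<^sup>+q. ennreal (F (\<tau> p) (\<tau> q)) * indicator (Z \<inter> (\<tau> -` B \<inter> space \<theta>)) q \<partial>\<theta>)"
      by (intro nn_integral_cong) (simp add: indicator_def)
    finally show "indicator Z p * ((\<integral>\<^sup>+y. ennreal (F (\<tau> p) y) * indicator B y \<partial>?D) * indicator A (\<tau> p))
        = (\<integral>\<^sup>+q. ennreal (F (\<tau> p) (\<tau> q)) * indicator (Z \<inter> (\<tau> -` B \<inter> space \<theta>)) q \<partial>\<theta>) * indicator (Z \<inter> (\<tau> -` A \<inter> space \<theta>)) p"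
      using p by (simp add: indicator_def)
  qed
  finally show ?thesis .
qed

lemma nn_integral_ext_nmarg_Inl:
  assumes G: "measurable_graphex G" and "sets \<alpha> = sets (base G)"
  shows "(\<integral>\<^sup>+p. nmarg (ext_graphex G) p \<partial>distr \<alpha> (ext_space (base G)) Inl) = (\<integral>\<^sup>+x. nmarg G x \<partial>\<alpha>)"
proof -
  have [measurable]: "nmarg (ext_graphex G) \<in> borel_measurable (ext_space (base G))"
    using measurable_nmarg[OF measurable_graphex_ext[OF G]] by simp
  have [measurable]: "Inl \<in> measurable \<alpha> (ext_space (base G))"
    using assms(2) measurable_Inl_ext[of "base G"] by (simp cong: measurable_cong_sets)
  show ?thesis
    using nmarg_ext(1)[OF G] sets_eq_imp_space_eq[OF assms(2)]
    by (subst nn_integral_distr) (auto intro!: nn_integral_cong)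
qed

lemma nn_integral_ext_nmarg_Inr:
  assumes G: "measurable_graphex G" and "sets L = sets borel"
  shows "(\<integral>\<^sup>+p. nmarg (ext_graphex G) p \<partial>distr L (ext_space (base G)) Inr) = 0"
proof -
  have [measurable]: "nmarg (ext_graphex G) \<in> borel_measurable (ext_space (base G))"
    using measurable_nmarg[OF measurable_graphex_ext[OF G]] by simp
  have [measurable]: "Inr \<in> measurable L (ext_space (base G))"
    using assms(2) measurable_Inr_ext[of "base G"] by (simp cong: measurable_cong_sets)
  show ?thesis
    by (subst nn_integral_distr) (simp_all add: nmarg_ext(2)[OF G])
qed

text \<open>The degrees here are those in the full graphex while the integration runs over the
  submeasure; both the line, where g is evaluated at 0, and the removed part can only lower the
  right-hand integral on passing to the left.\<close>

lemma split_ext_nmarg: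
  assumes G: "measurable_graphex G" "sets \<mu> = sets (base G)" "sets \<alpha> = sets (base G)" "add_measure \<mu> \<alpha> = base G"
    and mp: "measure_preserving \<theta> (ext_space \<mu>) \<pi>" and [measurable]: "g \<in> borel_measurable borel" and "g 0 = 0"
  shows "(\<integral>\<^sup>+p. g (nmarg (ext_graphex G) (\<pi> p)) \<partial>\<theta>) \<le> (\<integral>\<^sup>+x. g (nmarg G x) \<partial>base G)"
proof -
  have [measurable]: "nmarg (ext_graphex G) \<in> borel_measurable (ext_space \<mu>)"
    using measurable_nmarg[OF measurable_graphex_ext[OF G(1)]] sets_ext_space_cong[OF G(2)]
    by (simp cong: measurable_cong_sets)
  have [measurable]: "nmarg G \<in> borel_measurable (base G)"
    by (rule measurable_nmarg) fact
  have "(\<integral>\<^sup>+p. g (nmarg (ext_graphex G) (\<pi> p)) \<partial>\<theta>) = (\<integral>\<^sup>+q. g (nmarg (ext_graphex G) q) \<partial>ext_space \<mu>)"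
    by (rule measure_preserving_nn_integral[OF mp]) simp
  also have "\<dots> = (\<integral>\<^sup>+x. g (nmarg (ext_graphex G) (Inl x)) \<partial>\<mu>)"
    by (subst nn_integral_ext_space) (simp_all add: nmarg_ext(2)[OF G(1)] \<open>g 0 = 0\<close>)
  also have "\<dots> = (\<integral>\<^sup>+x. g (nmarg G x) \<partial>\<mu>)"
    using split_space(1)[OF G] by (intro nn_integral_cong) (simp add: nmarg_ext(1)[OF G(1)])
  also have "\<dots> \<le> (\<integral>\<^sup>+x. g (nmarg G x) \<partial>base G)"
  proof -
    have "(\<lambda>x. g (nmarg G x)) \<in> borel_measurable (base G)"
      by measurable
    from split_nn_integral[OF G this] show ?thesis by simp
  qed
  finally show ?thesis .
qed

lemma distr_density_split:
  assumes \<tau>[measurable]: "\<tau> \<in> measurable M N" and Z[measurable]: "Z \<in> sets M"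
  shows "add_measure (distr (density M (indicator Z)) N \<tau>) (distr (density M (indicator (space M - Z))) N \<tau>) = distr M N \<tau>"
proof (rule measure_eqI)
  fix S assume "S \<in> sets (add_measure (distr (density M (indicator Z)) N \<tau>) (distr (density M (indicator (space M - Z))) N \<tau>))"
  then have [measurable]: "S \<in> sets N" by simp
  have T[measurable]: "\<tau> -` S \<inter> space M \<in> sets M"
    by measurable
  have *: "emeasure (distr (density M (indicator Y)) N \<tau>) S = (\<integral>\<^sup>+x. indicator Y x * indicator (\<tau> -` S \<inter> space M) x \<partial>M)"
    if [measurable]: "Y \<in> sets M" for Y
    by (simp add: emeasure_distr emeasure_density)
  have "emeasure (add_measure (distr (density M (indicator Z)) N \<tau>) (distr (density M (indicator (space M - Z))) N \<tau>)) S
      = (\<integral>\<^sup>+x. indicator Z x * indicator (\<tau> -` S \<inter> space M) x + indicator (space M - Z) x * indicator (\<tau> -` S \<inter> space M) x \<partial>M)"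
    by (simp add: emeasure_add_measure * nn_integral_add)
  also have "\<dots> = (\<integral>\<^sup>+x. indicator (\<tau> -` S \<inter> space M) x \<partial>M)"
    by (intro nn_integral_cong) (auto simp: indicator_def)
  also have "\<dots> = emeasure (distr M N \<tau>) S"
    by (simp add: emeasure_distr)
  finally show "emeasure (add_measure (distr (density M (indicator Z)) N \<tau>) (distr (density M (indicator (space M - Z))) N \<tau>)) S
      = emeasure (distr M N \<tau>) S" .
qed simp

lemma add_measure_assoc:
  "sets L = sets M \<Longrightarrow> sets N = sets M \<Longrightarrow> add_measure (add_measure M L) N = add_measure M (add_measure L N)"
  by (rule measure_eqI) (simp_all add: emeasure_add_measure add.assoc)

text \<open>The bad part of the coupling consists of the added mass and of the pairs in which both points
  have small degree; it contributes little because few edges meet it.\<close>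

lemma bad_part_bound:
  assumes G: "measurable_graphex G" "sets \<mu> = sets (base G)" "sets \<alpha> = sets (base G)" "add_measure \<mu> \<alpha> = base G"
    and mp: "measure_preserving \<theta> (ext_space \<mu>) \<pi>"
    and \<tau>: "\<tau> \<in> measurable \<theta> N" and \<pi>': "\<pi>' \<in> measurable N (ext_space (base G))" "\<And>p. p \<in> space \<theta> \<Longrightarrow> \<pi>' (\<tau> p) = ext_gap b (\<pi> p)"
    and Y[measurable]: "Y \<in> sets \<theta>" and small: "\<And>p. p \<in> Y \<Longrightarrow> nmarg (ext_graphex G) (\<pi> p) \<le> d"
    and \<omega>: "sets \<omega> = sets N" "sets \<omega>' = sets N" and "sets L = sets borel"
    and mp\<omega>: "measure_preserving \<omega> (distr \<alpha> (ext_space (base G)) Inl) \<pi>'"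
      "measure_preserving \<omega>' (distr L (ext_space (base G)) Inr) \<pi>'"
  shows "(\<integral>\<^sup>+p. nmarg (ext_graphex G) (\<pi>' p) \<partial>add_measure (distr (density \<theta> (indicator Y)) N \<tau>) (add_measure \<omega> \<omega>'))
    \<le> capped d G + (\<integral>\<^sup>+x. nmarg G x \<partial>\<alpha>)"
proof -
  note [measurable] = \<tau> \<pi>'(1)
  let ?f = "nmarg (ext_graphex G)"
  have f[measurable]: "?f \<in> borel_measurable (ext_space (base G))"
    using measurable_nmarg[OF measurable_graphex_ext[OF G(1)]] by simp
  have [measurable]: "\<pi> \<in> measurable \<theta> (ext_space (base G))"
    using mp sets_ext_space_cong[OF G(2)] by (simp add: measure_preserving_def cong: measurable_cong_sets)
  have fN: "(\<lambda>p. ?f (\<pi>' p)) \<in> borel_measurable N"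
    by measurable
  have f': "?f \<in> borel_measurable (distr \<alpha> (ext_space (base G)) Inl)" "?f \<in> borel_measurable (distr L (ext_space (base G)) Inr)"
    by simp_all
  have "(\<integral>\<^sup>+p. ?f (\<pi>' p) \<partial>add_measure (distr (density \<theta> (indicator Y)) N \<tau>) (add_measure \<omega> \<omega>'))
      = (\<integral>\<^sup>+p. ?f (\<pi>' p) \<partial>distr (density \<theta> (indicator Y)) N \<tau>) + ((\<integral>\<^sup>+p. ?f (\<pi>' p) \<partial>\<omega>) + (\<integral>\<^sup>+p. ?f (\<pi>' p) \<partial>\<omega>'))"
    using fN \<omega> by (simp add: nn_integral_add_measure cong: measurable_cong_sets)
  also have "(\<integral>\<^sup>+p. ?f (\<pi>' p) \<partial>\<omega>) = (\<integral>\<^sup>+x. nmarg G x \<partial>\<alpha>)"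
    using measure_preserving_nn_integral[OF mp\<omega>(1) f'(1)] nn_integral_ext_nmarg_Inl[OF G(1,3)] by simp
  also have "(\<integral>\<^sup>+p. ?f (\<pi>' p) \<partial>\<omega>') = 0"
    using measure_preserving_nn_integral[OF mp\<omega>(2) f'(2)] nn_integral_ext_nmarg_Inr[OF G(1) \<open>sets L = sets borel\<close>] by simp
  also have "(\<integral>\<^sup>+p. ?f (\<pi>' p) \<partial>distr (density \<theta> (indicator Y)) N \<tau>) = (\<integral>\<^sup>+p. indicator Y p * ?f (\<pi>' (\<tau> p)) \<partial>\<theta>)"
    by (simp add: nn_integral_distr nn_integral_density)
  also have "\<dots> \<le> (\<integral>\<^sup>+p. min (?f (\<pi> p)) d \<partial>\<theta>)"
    using small by (intro nn_integral_mono) (auto simp: indicator_def \<pi>'(2) nmarg_ext_gap[OF G(1)])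
  also have "\<dots> \<le> capped d G"
    unfolding capped_def by (rule split_ext_nmarg[OF G mp, of "\<lambda>t. min t d"]) simp_all
  finally show ?thesis by simp
qed

text \<open>The term c k is the norm estimate on rectangles whose sides have measure at most k. The
  terms 2 r and 2 s bound, for G and H respectively, the mass of pairs with at least one point in
  the bad part: the factor 2 stands for the two positions of that point.\<close>

lemma coupling_cut_norm_le:
  assumes G: "measurable_graphex G" "rho G < \<infinity>" and H: "measurable_graphex H" "rho H < \<infinity>"
    and less: "delta_diamond G H < ereal c" and pos: "0 < c" "0 < \<delta>" "0 \<le> k" "0 \<le> r" "0 \<le> s"
    and k: "degree_mass G + degree_mass H \<le> ennreal (\<delta> * k)"
    and r: "capped (ennreal \<delta>) G + (ennreal K * ennreal (c\<^sup>2) + degree_tail K G) \<le> ennreal r"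
    and s: "capped (ennreal \<delta>) H + (ennreal K' * ennreal (c\<^sup>2) + degree_tail K' H) \<le> ennreal s"
  shows "\<exists>\<kappa>\<in>couplings (ext_space (base G)) (ext_space (base H)).
    cut_norm \<kappa> (\<lambda>p q. ext_kernel (kernel G) (fst p) (fst q) - ext_kernel (kernel H) (snd p) (snd q)) \<le> ereal (c * k + 2 * r + 2 * s)"
proof -
  obtain \<mu> \<alpha> \<nu> \<beta> \<theta> where G_split: "sets \<mu> = sets (base G)" "sets \<alpha> = sets (base G)" "add_measure \<mu> \<alpha> = base G"
    and \<alpha>: "emeasure \<alpha> (space (base G)) \<le> ennreal (c\<^sup>2)"
    and H_split: "sets \<nu> = sets (base H)" "sets \<beta> = sets (base H)" "add_measure \<nu> \<beta> = base H"
    and \<beta>: "emeasure \<beta> (space (base H)) \<le> ennreal (c\<^sup>2)"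
    and \<theta>: "\<theta> \<in> couplings (ext_space \<mu>) (ext_space \<nu>)"
    and fin: "rho (G\<lparr>base := \<mu>\<rparr>) < \<infinity>" "rho (H\<lparr>base := \<nu>\<rparr>) < \<infinity>"
    and norm: "norm_2_2 \<theta> (\<lambda>p q. ext_kernel (kernel G) (fst p) (fst q) - ext_kernel (kernel H) (snd p) (snd q)) \<le> ereal c"
    by (rule delta_diamond_couplingE[OF G(1) H(1) less])
  note Gs = G(1) G_split and Hs = H(1) H_split
  obtain a where a: "emeasure \<alpha> (space (base G)) = ennreal a" "0 \<le> a"
    using \<alpha> by (cases "emeasure \<alpha> (space (base G))") (auto simp: top_unique)
  obtain b where b: "emeasure \<beta> (space (base H)) = ennreal b" "0 \<le> b"
    using \<beta> by (cases "emeasure \<beta> (space (base H))") (auto simp: top_unique)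
  define E1 where "E1 = ext_space (base G)"
  define E2 where "E2 = ext_space (base H)"
  define N where "N = E1 \<Otimes>\<^sub>M E2"
  define \<tau> :: "('a + real) \<times> ('b + real) \<Rightarrow> ('a + real) \<times> ('b + real)" where "\<tau> = map_prod (ext_gap b) (ext_gap a)"
  obtain \<omega>\<^sub>1 \<omega>\<^sub>2 where
    \<omega>1: "\<omega>\<^sub>1 \<in> couplings (distr \<alpha> E1 Inl) (distr (density lborel (indicator {0..<a})) E2 Inr)" and
    \<omega>2: "\<omega>\<^sub>2 \<in> couplings (distr (density lborel (indicator {0..<b})) E1 Inr) (distr \<beta> E2 Inl)" and
    \<kappa>0: "add_measure (distr \<theta> N \<tau>) (add_measure \<omega>\<^sub>1 \<omega>\<^sub>2) \<in> couplings E1 E2"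
    unfolding E1_def E2_def N_def \<tau>_def
    by (rule couplings_extend[OF G_split a H_split b \<theta>])
  define \<kappa> where "\<kappa> = add_measure (distr \<theta> N \<tau>) (add_measure \<omega>\<^sub>1 \<omega>\<^sub>2)"
  have \<kappa>: "\<kappa> \<in> couplings E1 E2"
    using \<kappa>0 by (simp add: \<kappa>_def)
  have sets_N: "sets \<omega>\<^sub>1 = sets N" "sets \<omega>\<^sub>2 = sets N" "sets \<kappa> = sets N"
    using \<omega>1 \<omega>2 \<kappa> by (auto simp: couplings_def N_def cong: sets_pair_measure_cong)
  note mp\<theta> = coupling_measure_preserving[OF \<theta>]
  note mp\<kappa> = coupling_measure_preserving[OF \<kappa>, unfolded E1_def E2_def]
  have sets_E: "sets (ext_space \<mu>) = sets E1" "sets (ext_space \<nu>) = sets E2"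
    using sets_ext_space_cong G_split(1) H_split(1) by (auto simp: E1_def E2_def)
  have fs[measurable]: "fst \<in> measurable \<theta> E1" "snd \<in> measurable \<theta> E2"
    using mp\<theta> sets_E by (simp_all add: measure_preserving_def cong: measurable_cong_sets)
  have [measurable]: "ext_gap b \<in> measurable E1 E1" "ext_gap a \<in> measurable E2 E2"
    by (simp_all add: E1_def E2_def)
  have \<tau>[measurable]: "\<tau> \<in> measurable \<theta> N"
    unfolding \<tau>_def N_def map_prod_def case_prod_beta' by measurable
  have proj: "fst \<in> measurable N (ext_space (base G))" "snd \<in> measurable N (ext_space (base H))"
    by (simp_all add: N_def E1_def E2_def)
  let ?f = "nmarg (ext_graphex G)" and ?g = "nmarg (ext_graphex H)"
  have [measurable]: "?f \<in> borel_measurable E1" "?g \<in> borel_measurable E2"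
    using measurable_nmarg[OF measurable_graphex_ext[OF G(1)]] measurable_nmarg[OF measurable_graphex_ext[OF H(1)]]
    by (simp_all add: E1_def E2_def)
  \<comment> \<open>Markov's inequality for the sum of the two degrees bounds the mass of Z by k
    although either degree alone may be large; off Z both degrees are at most \<delta>, as the
    estimates for both kernels require.\<close>
  define Z where "Z = {p\<in>space \<theta>. ennreal \<delta> < ?f (fst p) \<or> ennreal \<delta> < ?g (snd p)}"
  have Z[measurable]: "Z \<in> sets \<theta>"
    unfolding Z_def by measurable
  define \<gamma> where "\<gamma> = distr (density \<theta> (indicator Z)) N \<tau>"
  \<comment> \<open>Writing \<kappa> as a sum of measures lets \<open>split_pair_mass\<close>
    discard \<beta>', while \<gamma> remains accessible through \<theta> on Z.\<close>
  define \<beta>' where "\<beta>' = add_measure (distr (density \<theta> (indicator (space \<theta> - Z))) N \<tau>) (add_measure \<omega>\<^sub>1 \<omega>\<^sub>2)"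
  have add: "add_measure \<gamma> \<beta>' = \<kappa>"
    unfolding \<gamma>_def \<beta>'_def \<kappa>_def distr_density_split[OF \<tau> Z, symmetric]
    using sets_N by (intro add_measure_assoc[symmetric]) simp_all
  have sets_\<gamma>: "sets \<gamma> = sets N" "sets \<beta>' = sets N"
    by (simp_all add: \<gamma>_def \<beta>'_def)
  define P where "P = pullback \<kappa> fst (ext_graphex G)"
  define Q where "Q = pullback \<kappa> snd (ext_graphex H)"
  note eG = measurable_graphex_ext[OF G(1)] and eH = measurable_graphex_ext[OF H(1)]
  have mpP: "measure_preserving \<kappa> (base (ext_graphex G)) fst" "measure_preserving \<kappa> (base (ext_graphex H)) snd"
    using mp\<kappa> by simp_all
  have P: "measurable_graphex P" "rho P < \<infinity>" and Q: "measurable_graphex Q" "rho Q < \<infinity>"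
    using G H rho_pullback[OF eG mpP(1)] rho_pullback[OF eH mpP(2)]
    by (simp_all add: P_def Q_def measurable_graphex_pullback[OF eG mpP(1)] measurable_graphex_pullback[OF eH mpP(2)] rho_ext)
  have base: "base P = \<kappa>" "base Q = \<kappa>"
    by (simp_all add: P_def Q_def)
  have kernel_PQ: "kernel P = (\<lambda>p q. ext_kernel (kernel G) (fst p) (fst q))" "kernel Q = (\<lambda>p q. ext_kernel (kernel H) (snd p) (snd q))"
    by (simp_all add: P_def Q_def)
  have sp\<beta>: "space \<beta>' = space \<kappa>"
    using sets_\<gamma>(2) sets_N(3) by (intro sets_eq_imp_space_eq) simp
  have RP: "(\<integral>\<^sup>+p. nmarg P p \<partial>\<beta>') \<le> ennreal r"
  proof -
    have "(\<integral>\<^sup>+p. nmarg P p \<partial>\<beta>') = (\<integral>\<^sup>+p. ?f (fst p) \<partial>\<beta>')"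
      unfolding P_def by (intro nn_integral_cong nmarg_pullback[OF eG mpP(1)]) (simp add: sp\<beta>)
    also have "\<dots> \<le> capped (ennreal \<delta>) G + (\<integral>\<^sup>+x. nmarg G x \<partial>\<alpha>)"
      unfolding \<beta>'_def
      by (rule bad_part_bound[OF Gs mp\<theta>(1) \<tau> proj(1) _ _ _ sets_N(1,2) _
            coupling_measure_preserving(1)[OF \<omega>1, unfolded E1_def] coupling_measure_preserving(1)[OF \<omega>2, unfolded E1_def]])
        (auto simp: \<tau>_def Z_def not_less)
    also have "\<dots> \<le> capped (ennreal \<delta>) G + (ennreal K * ennreal (c\<^sup>2) + degree_tail K G)"
      by (intro add_left_mono split_loss[OF Gs \<alpha>])
    also note r
    finally show ?thesis .
  qed
  have RQ: "(\<integral>\<^sup>+p. nmarg Q p \<partial>\<beta>') \<le> ennreal s"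
  proof -
    \<comment> \<open>For H the roles of the added couplings are exchanged: \<omega>2 carries
      \<beta>, and \<omega>1 projects to the adjoined line.\<close>
    have swap: "add_measure \<omega>\<^sub>1 \<omega>\<^sub>2 = add_measure \<omega>\<^sub>2 \<omega>\<^sub>1"
      using sets_N by (intro measure_eqI) (simp_all add: emeasure_add_measure add.commute)
    have "(\<integral>\<^sup>+p. nmarg Q p \<partial>\<beta>') = (\<integral>\<^sup>+p. ?g (snd p) \<partial>\<beta>')"
      unfolding Q_def by (intro nn_integral_cong nmarg_pullback[OF eH mpP(2)]) (simp add: sp\<beta>)
    also have "\<dots> \<le> capped (ennreal \<delta>) H + (\<integral>\<^sup>+x. nmarg H x \<partial>\<beta>)"
      unfolding \<beta>'_def swap
      by (rule bad_part_bound[OF Hs mp\<theta>(2) \<tau> proj(2) _ _ _ sets_N(2,1) _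
            coupling_measure_preserving(2)[OF \<omega>2, unfolded E2_def] coupling_measure_preserving(2)[OF \<omega>1, unfolded E2_def]])
        (auto simp: \<tau>_def Z_def not_less)
    also have "\<dots> \<le> capped (ennreal \<delta>) H + (ennreal K' * ennreal (c\<^sup>2) + degree_tail K' H)"
      by (intro add_left_mono split_loss[OF Hs \<beta>])
    also note s
    finally show ?thesis .
  qed
  have mass_Z: "emeasure \<theta> Z \<le> ennreal k"
  proof -
    have "ennreal \<delta> * emeasure \<theta> Z = (\<integral>\<^sup>+p. ennreal \<delta> * indicator Z p \<partial>\<theta>)"
      by (simp add: nn_integral_cmult)
    also have "\<dots> \<le> (\<integral>\<^sup>+p. ?f (fst p) + ?g (snd p) \<partial>\<theta>)"
      by (intro nn_integral_mono) (auto simp: Z_def indicator_def intro: add_increasing add_increasing2)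
    also have "\<dots> = (\<integral>\<^sup>+p. ?f (fst p) \<partial>\<theta>) + (\<integral>\<^sup>+p. ?g (snd p) \<partial>\<theta>)"
      by (rule nn_integral_add) measurable
    also have "\<dots> \<le> degree_mass G + degree_mass H"
      using split_ext_nmarg[OF Gs mp\<theta>(1), of "\<lambda>t. t"] split_ext_nmarg[OF Hs mp\<theta>(2), of "\<lambda>t. t"]
      by (intro add_mono) simp_all
    also note k
    finally have "ennreal (1 / \<delta>) * (ennreal \<delta> * emeasure \<theta> Z) \<le> ennreal (1 / \<delta>) * ennreal (\<delta> * k)"
      by (intro mult_left_mono) auto
    moreover have "ennreal (1 / \<delta>) * ennreal \<delta> = 1" "ennreal (1 / \<delta>) * ennreal (\<delta> * k) = ennreal k"
      using pos by (simp_all flip: ennreal_mult)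
    ultimately show ?thesis
      by (simp add: mult.assoc[symmetric])
  qed
  \<comment> \<open>These share their kernel functions with P and Q up to the shift \<tau>; the
    finite \<rho> of the submeasures makes the kernels integrable over \<theta>.\<close>
  define P' where "P' = pullback \<theta> fst (ext_graphex (G\<lparr>base := \<mu>\<rparr>))"
  define Q' where "Q' = pullback \<theta> snd (ext_graphex (H\<lparr>base := \<nu>\<rparr>))"
  note mG = split_measurable_graphex[OF Gs] and mH = split_measurable_graphex[OF Hs]
  note emG = measurable_graphex_ext[OF mG] and emH = measurable_graphex_ext[OF mH]
  have mp': "measure_preserving \<theta> (base (ext_graphex (G\<lparr>base := \<mu>\<rparr>))) fst" "measure_preserving \<theta> (base (ext_graphex (H\<lparr>base := \<nu>\<rparr>))) snd"
    using mp\<theta> by simp_all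
  have P': "measurable_graphex P'" "rho P' < \<infinity>" and Q': "measurable_graphex Q'" "rho Q' < \<infinity>"
    using fin rho_pullback[OF emG mp'(1)] rho_pullback[OF emH mp'(2)]
    by (simp_all add: P'_def Q'_def measurable_graphex_pullback[OF emG mp'(1)] measurable_graphex_pullback[OF emH mp'(2)]
        rho_ext mG mH)
  have base': "base P' = \<theta>" "base Q' = \<theta>"
    by (simp_all add: P'_def Q'_def)
  have kernel': "kernel P' = (\<lambda>p q. ext_kernel (kernel G) (fst p) (fst q))" "kernel Q' = (\<lambda>p q. ext_kernel (kernel H) (snd p) (snd q))"
    by (simp_all add: P'_def Q'_def)
  have sf: "sigma_finite_measure \<theta>"
    using measurable_graphexD(1)[OF P'(1)] by (simp add: base')
  have good: "pair_mass \<gamma> (kernel P) A B \<le> pair_mass \<gamma> (kernel Q) A B + ennreal (c * k)"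
    "pair_mass \<gamma> (kernel Q) A B \<le> pair_mass \<gamma> (kernel P) A B + ennreal (c * k)"
    if AB[measurable]: "A \<in> sets N" "B \<in> sets N" for A B
  proof -
    let ?A = "Z \<inter> (\<tau> -` A \<inter> space \<theta>)" and ?B = "Z \<inter> (\<tau> -` B \<inter> space \<theta>)"
    have AB': "?A \<in> sets \<theta>" "?B \<in> sets \<theta>"
      by measurable
    have "sets (\<kappa> \<Otimes>\<^sub>M \<kappa>) = sets (N \<Otimes>\<^sub>M N)"
      using sets_N(3) by (intro sets_pair_measure_cong)
    then have "case_prod (kernel P) \<in> borel_measurable (N \<Otimes>\<^sub>M N)" "case_prod (kernel Q) \<in> borel_measurable (N \<Otimes>\<^sub>M N)"
      using measurable_graphexD(2)[OF P(1)] measurable_graphexD(2)[OF Q(1)] base by (simp_all cong: measurable_cong_sets)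
    note pm = this[THEN pair_mass_distr_density[OF sf \<tau> Z AB]]
    have *: "pair_mass \<gamma> (kernel P) A B = pair_mass \<theta> (kernel P') ?A ?B" "pair_mass \<gamma> (kernel Q) A B = pair_mass \<theta> (kernel Q') ?A ?B"
      unfolding \<gamma>_def pm by (simp_all add: kernel_PQ kernel' \<tau>_def)
    have "emeasure \<theta> ?A \<le> emeasure \<theta> Z" "emeasure \<theta> ?B \<le> emeasure \<theta> Z"
      by (intro emeasure_mono Int_lower1 Z)+
    from this[THEN order_trans, OF mass_Z] have "emeasure \<theta> ?A \<le> ennreal k" "emeasure \<theta> ?B \<le> ennreal k" .
    with norm_2_2_rectangle[OF sf norm _ AB'] pos
    have "\<bar>LINT p:?A \<times> ?B|\<theta> \<Otimes>\<^sub>M \<theta>. case_prod (\<lambda>p q. kernel P' p q - kernel Q' p q) p\<bar> \<le> c * k"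
      unfolding kernel' by auto
    with set_lebesgue_integral_diff_le_iff[OF P' Q', of ?A ?B "c * k"] AB' pos
    have "pair_mass \<theta> (kernel P') ?A ?B \<le> pair_mass \<theta> (kernel Q') ?A ?B + ennreal (c * k)"
      "pair_mass \<theta> (kernel Q') ?A ?B \<le> pair_mass \<theta> (kernel P') ?A ?B + ennreal (c * k)"
      by (simp_all add: base')
    then show "pair_mass \<gamma> (kernel P) A B \<le> pair_mass \<gamma> (kernel Q) A B + ennreal (c * k)"
      "pair_mass \<gamma> (kernel Q) A B \<le> pair_mass \<gamma> (kernel P) A B + ennreal (c * k)"
      unfolding * .
  qed
  have "\<bar>LINT p:A \<times> B|\<kappa> \<Otimes>\<^sub>M \<kappa>. case_prod (\<lambda>p q. kernel P p q - kernel Q p q) p\<bar> \<le> c * k + 2 * r + 2 * s"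
    if "A \<in> sets \<kappa>" "B \<in> sets \<kappa>" for A B
  proof -
    have AB: "A \<in> sets N" "B \<in> sets N"
      using that sets_N by simp_all
    have spP: "sets \<gamma> = sets (base P)" "sets \<beta>' = sets (base P)" "add_measure \<gamma> \<beta>' = base P"
      and spQ: "sets \<gamma> = sets (base Q)" "sets \<beta>' = sets (base Q)" "add_measure \<gamma> \<beta>' = base Q"
      using sets_\<gamma> sets_N add by (simp_all add: base)
    have mP: "pair_mass \<gamma> (kernel P) A B \<le> pair_mass \<kappa> (kernel P) A B"
      "pair_mass \<kappa> (kernel P) A B \<le> pair_mass \<gamma> (kernel P) A B + 2 * (\<integral>\<^sup>+p. nmarg P p \<partial>\<beta>')"
      using split_pair_mass[OF P(1) spP, of A B] that by (simp_all add: base)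
    have mQ: "pair_mass \<gamma> (kernel Q) A B \<le> pair_mass \<kappa> (kernel Q) A B"
      "pair_mass \<kappa> (kernel Q) A B \<le> pair_mass \<gamma> (kernel Q) A B + 2 * (\<integral>\<^sup>+p. nmarg Q p \<partial>\<beta>')"
      using split_pair_mass[OF Q(1) spQ, of A B] that by (simp_all add: base)
    have two: "2 * ennreal x = ennreal (2 * x)" if "0 \<le> x" for x
      using that by (simp add: ennreal_mult)
    \<comment> \<open>Each direction of the comparison incurs the loss of one side only; the common
      constant covers both.\<close>
    have err: "ennreal (c * k) + 2 * R \<le> ennreal (c * k + 2 * r + 2 * s)" if "R \<le> ennreal r \<or> R \<le> ennreal s" for R
    proof -
      have "0 \<le> c * k" using pos by simp
      have "2 * R \<le> ennreal (2 * r + 2 * s)"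
        using that
      proof
        assume "R \<le> ennreal r"
        then have "2 * R \<le> 2 * ennreal r" by (rule mult_left_mono) simp
        also have "\<dots> \<le> ennreal (2 * r + 2 * s)"
          using pos by (simp add: two ennreal_leI)
        finally show ?thesis .
      next
        assume "R \<le> ennreal s"
        then have "2 * R \<le> 2 * ennreal s" by (rule mult_left_mono) simp
        also have "\<dots> \<le> ennreal (2 * r + 2 * s)"
          using pos by (simp add: two ennreal_leI)
        finally show ?thesis .
      qed
      then have "ennreal (c * k) + 2 * R \<le> ennreal (c * k) + ennreal (2 * r + 2 * s)"
        by (rule add_left_mono)
      also have "\<dots> = ennreal (c * k + 2 * r + 2 * s)"
        using pos \<open>0 \<le> c * k\<close> by (simp add: add.assoc flip: ennreal_plus)
      finally show ?thesis .
    qed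
    have "pair_mass \<kappa> (kernel P) A B \<le> pair_mass \<gamma> (kernel Q) A B + ennreal (c * k) + 2 * (\<integral>\<^sup>+p. nmarg P p \<partial>\<beta>')"
      by (rule order_trans[OF mP(2) add_right_mono[OF good(1)[OF AB]]])
    also have "\<dots> \<le> pair_mass \<kappa> (kernel Q) A B + ennreal (c * k + 2 * r + 2 * s)"
      unfolding add.assoc using RP err by (intro add_mono mQ(1)) (auto simp: add.assoc)
    finally have 1: "pair_mass \<kappa> (kernel P) A B \<le> pair_mass \<kappa> (kernel Q) A B + ennreal (c * k + 2 * r + 2 * s)" .
    have "pair_mass \<kappa> (kernel Q) A B \<le> pair_mass \<gamma> (kernel P) A B + ennreal (c * k) + 2 * (\<integral>\<^sup>+p. nmarg Q p \<partial>\<beta>')"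
      by (rule order_trans[OF mQ(2) add_right_mono[OF good(2)[OF AB]]])
    also have "\<dots> \<le> pair_mass \<kappa> (kernel P) A B + ennreal (c * k + 2 * r + 2 * s)"
      unfolding add.assoc using RQ err by (intro add_mono mP(1)) (auto simp: add.assoc)
    finally have 2: "pair_mass \<kappa> (kernel Q) A B \<le> pair_mass \<kappa> (kernel P) A B + ennreal (c * k + 2 * r + 2 * s)" .
    show ?thesis
      using set_lebesgue_integral_diff_le_iff[OF P Q, of A B "c * k + 2 * r + 2 * s"] 1 2 that pos
      by (simp add: base)
  qed
  then have "cut_norm \<kappa> (\<lambda>p q. ext_kernel (kernel G) (fst p) (fst q) - ext_kernel (kernel H) (snd p) (snd q)) \<le> ereal (c * k + 2 * r + 2 * s)"
    unfolding cut_norm_def kernel_PQ by (intro SUP_least) auto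
  with \<kappa> show ?thesis
    by (auto simp: E1_def E2_def)
qed

section \<open>Convergence in the cut metric\<close>

text \<open>Rectangles for the image measure pull back to rectangles of the source, so the supremum
  on the right includes all values on the left.\<close>

lemma cut_norm_distr_le:
  assumes \<phi>[measurable]: "\<phi> \<in> measurable M N" and "sigma_finite_measure (distr M N \<phi>)"
    and [measurable]: "case_prod U \<in> borel_measurable (N \<Otimes>\<^sub>M N)"
  shows "cut_norm (distr M N \<phi>) U \<le> cut_norm M (\<lambda>p q. U (\<phi> p) (\<phi> q))"
  unfolding cut_norm_def
proof (intro SUP_least, clarify)
  fix A B assume "A \<in> sets (distr M N \<phi>)" "B \<in> sets (distr M N \<phi>)"
  then have [measurable]: "A \<in> sets N" "B \<in> sets N" by simp_all
  let ?A = "\<phi> -` A \<inter> space M" and ?B = "\<phi> -` B \<inter> space M"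
  have [measurable]: "?A \<in> sets M" "?B \<in> sets M" by measurable
  have prod: "distr M N \<phi> \<Otimes>\<^sub>M distr M N \<phi> = distr (M \<Otimes>\<^sub>M M) (N \<Otimes>\<^sub>M N) (\<lambda>(x, y). (\<phi> x, \<phi> y))"
    by (rule pair_measure_distr[OF \<phi> \<phi> assms(2)])
  have "(LINT p:A \<times> B|distr M N \<phi> \<Otimes>\<^sub>M distr M N \<phi>. case_prod U p)
      = (\<integral>p. indicator (A \<times> B) (case p of (x, y) \<Rightarrow> (\<phi> x, \<phi> y)) *\<^sub>R case_prod U (case p of (x, y) \<Rightarrow> (\<phi> x, \<phi> y)) \<partial>(M \<Otimes>\<^sub>M M))"
    unfolding set_lebesgue_integral_def prod by (rule integral_distr) measurable
  also have "\<dots> = (LINT p:?A \<times> ?B|M \<Otimes>\<^sub>M M. case_prod (\<lambda>p q. U (\<phi> p) (\<phi> q)) p)"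
    unfolding set_lebesgue_integral_def
    by (intro Bochner_Integration.integral_cong) (auto simp: indicator_def space_pair_measure)
  finally have eq: "(LINT p:A \<times> B|distr M N \<phi> \<Otimes>\<^sub>M distr M N \<phi>. case_prod U p)
      = (LINT p:?A \<times> ?B|M \<Otimes>\<^sub>M M. case_prod (\<lambda>p q. U (\<phi> p) (\<phi> q)) p)" .
  show "ereal \<bar>LINT p:A \<times> B|distr M N \<phi> \<Otimes>\<^sub>M distr M N \<phi>. case_prod U p\<bar>
      \<le> (SUP (A, B)\<in>sets M \<times> sets M. ereal \<bar>LINT p:A \<times> B|M \<Otimes>\<^sub>M M. case_prod (\<lambda>p q. U (\<phi> p) (\<phi> q)) p\<bar>)"
    unfolding eq by (rule SUP_upper2[of "(?A, ?B)"]) auto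
qed

lemma measure_preserving_ext:
  assumes "measure_preserving M N \<phi>"
  shows "measure_preserving (ext_space M) (ext_space N) (map_sum \<phi> (\<lambda>t. t))"
proof -
  have \<phi>[measurable]: "\<phi> \<in> measurable M N" and d: "distr M N \<phi> = N"
    using assms by (auto simp: measure_preserving_def)
  have m[measurable]: "map_sum \<phi> (\<lambda>t. t) \<in> measurable (ext_space M) (ext_space N)"
    by (simp add: measurable_ext_iff)
  have "distr (ext_space M) (ext_space N) (map_sum \<phi> (\<lambda>t. t)) = ext_space N"
  proof (rule measure_eqI)
    fix S assume "S \<in> sets (distr (ext_space M) (ext_space N) (map_sum \<phi> (\<lambda>t. t)))"
    then have S: "S \<in> sets (ext_space N)" by simp
    then have S': "Inl -` S \<in> sets N"
      by (simp add: sets_ext_space)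
    have "Inl -` (map_sum \<phi> (\<lambda>t. t) -` S \<inter> space (ext_space M)) = \<phi> -` (Inl -` S) \<inter> space M"
      "Inr -` (map_sum \<phi> (\<lambda>t. t) -` S \<inter> space (ext_space M)) = Inr -` S"
      by (auto simp: space_ext_space)
    then have "emeasure (distr (ext_space M) (ext_space N) (map_sum \<phi> (\<lambda>t. t))) S
        = emeasure (distr M N \<phi>) (Inl -` S) + emeasure lborel (Inr -` S)"
      using measurable_sets[OF m S] S S' by (simp add: emeasure_distr emeasure_ext_space)
    then show "emeasure (distr (ext_space M) (ext_space N) (map_sum \<phi> (\<lambda>t. t))) S = emeasure (ext_space N) S"
      using S by (simp add: d emeasure_ext_space)
  qed simp
  with m show ?thesis
    by (simp add: measure_preserving_def)
qed

lemma delta_cut_nonneg: "0 \<le> delta_cut M U N V"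
  unfolding delta_cut_def cut_norm_def
  by (intro INF_greatest SUP_upper2[of "({}, {})"]) auto

text \<open>Moves the second graphon to another carrier at no cost: the coupling is pushed forward
  along \<phi>, and V read through \<psi> takes the same values at corresponding points.\<close>

lemma delta_cut_embed_le:
  fixes M :: "'a measure" and N :: "'b measure"
  assumes M: "graphon M U" and N: "graphon N V" and \<kappa>: "\<kappa> \<in> couplings (ext_space M) (ext_space N)"
    and \<phi>: "measure_preserving N N' \<phi>" and \<psi>: "measure_preserving N' N \<psi>" and inv: "\<And>x. \<psi> (\<phi> x) = x"
  shows "delta_cut M U N' (\<lambda>x y. V (\<psi> x) (\<psi> y))
    \<le> cut_norm \<kappa> (\<lambda>p q. ext_kernel U (fst p) (fst q) - ext_kernel V (snd p) (snd q))"
proof -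
  let ?V = "\<lambda>x y. V (\<psi> x) (\<psi> y)"
  let ?j = "map_sum \<phi> (\<lambda>t::real. t)"
  let ?\<kappa> = "distr \<kappa> (ext_space M \<Otimes>\<^sub>M ext_space N') (map_prod (\<lambda>p. p) ?j)"
  have mgN: "measurable_graphex (graphon_graphex N V)"
    using N by (rule measurable_graphon_graphex)
  have "measurable_graphex (pullback N' \<psi> (graphon_graphex N V))"
    by (rule measurable_graphex_pullback[OF mgN]) (simp add: \<psi>)
  then have V': "graphon N' ?V"
    by (simp add: measurable_graphex_def)
  have j: "?j \<in> measurable (ext_space N) (ext_space N')" "distr (ext_space N) (ext_space N') ?j = ext_space N'"
    using measure_preserving_ext[OF \<phi>] by (simp_all add: measure_preserving_def)
  have id: "distr (ext_space M) (ext_space M) (\<lambda>p. p) = ext_space M"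
    by (rule distr_id)
  have \<kappa>': "?\<kappa> \<in> couplings (ext_space M) (ext_space N')"
    using couplings_distr[OF \<kappa> measurable_ident j(1)] by (simp add: id j(2) id_def)
  note mp = coupling_measure_preserving[OF \<kappa>] and mp' = coupling_measure_preserving[OF \<kappa>']
  have [measurable]: "fst \<in> measurable \<kappa> (ext_space M)" "snd \<in> measurable \<kappa> (ext_space N)"
    using mp by (simp_all add: measure_preserving_def)
  note [measurable] = j(1)
  have m: "map_prod (\<lambda>p. p) ?j \<in> measurable \<kappa> (ext_space M \<Otimes>\<^sub>M ext_space N')"
    unfolding map_prod_def case_prod_beta' by measurable
  have sf: "sigma_finite_measure ?\<kappa>"
    using measure_preserving_sigma_finite[OF mp'(1)] M by (simp add: graphon_def sigma_finite_ext_space)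
  have [measurable]: "case_prod (ext_kernel U) \<in> borel_measurable (ext_space M \<Otimes>\<^sub>M ext_space M)"
    "case_prod (ext_kernel ?V) \<in> borel_measurable (ext_space N' \<Otimes>\<^sub>M ext_space N')"
    using M V' by (simp_all add: graphon_def measurable_ext_kernel)
  have meas: "case_prod (\<lambda>p q. ext_kernel U (fst p) (fst q) - ext_kernel ?V (snd p) (snd q))
      \<in> borel_measurable ((ext_space M \<Otimes>\<^sub>M ext_space N') \<Otimes>\<^sub>M (ext_space M \<Otimes>\<^sub>M ext_space N'))"
    by measurable
  have k: "ext_kernel ?V (?j p) (?j q) = ext_kernel V p q" for p q
    by (cases p; cases q) (simp_all add: inv)
  have "delta_cut M U N' ?V \<le> cut_norm ?\<kappa> (\<lambda>p q. ext_kernel U (fst p) (fst q) - ext_kernel ?V (snd p) (snd q))"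
    unfolding delta_cut_def by (rule INF_lower[OF \<kappa>'])
  also have "\<dots> \<le> cut_norm \<kappa> (\<lambda>p q. ext_kernel U (fst (map_prod (\<lambda>p. p) ?j p)) (fst (map_prod (\<lambda>p. p) ?j q))
      - ext_kernel ?V (snd (map_prod (\<lambda>p. p) ?j p)) (snd (map_prod (\<lambda>p. p) ?j q)))"
    by (rule cut_norm_distr_le[OF m sf meas])
  also have "\<dots> = cut_norm \<kappa> (\<lambda>p q. ext_kernel U (fst p) (fst q) - ext_kernel V (snd p) (snd q))"
    by (simp add: k)
  finally show ?thesis .
qed

text \<open>The cut limit is the kernel of H itself, with \<delta> fixed by the capped masses on
  both sides, k and the tail levels fixed next, and c last.\<close>

lemma degree_tails_vanish_imp_delta_cut:
  fixes G :: "nat \<Rightarrow> 'a graphex" and H :: "'b graphex"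
  assumes G: "\<And>n. measurable_graphex (G n)" and H: "measurable_graphex H"
    and ui: "unif_integrable (range G)" and lim: "(\<lambda>n. delta_diamond (G n) H) \<longlonglongrightarrow> 0"
    and dtv: "degree_tails_vanish G"
  shows "\<exists>(M :: ('b + 'c) measure) U. integrable_graphon M U \<and>
           (\<lambda>n. delta_cut (base (G n)) (kernel (G n)) M U) \<longlonglongrightarrow> 0"
proof -
  have finG: "rho (G n) < \<infinity>" for n
    by (rule rho_G_finite[OF G H ui lim])
  have finH: "rho H < \<infinity>"
    by (rule rho_H_finite[OF G H ui lim])
  \<comment> \<open>The left injection carries the base of H to the type over which the limit is
    quantified, and \<open>projl\<close> undoes it.\<close>
  let ?M = "embed_measure (base H) (Inl :: 'b \<Rightarrow> 'b + 'c)"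
  let ?U = "\<lambda>x y. kernel H (projl x) (projl y)"
  have \<phi>: "measure_preserving (base H) ?M Inl"
    using embed_measure_eq_distr[of "Inl :: 'b \<Rightarrow> 'b + 'c" "base H"]
    by (simp add: measure_preserving_def measurable_embed_measure2)
  have pm: "projl \<in> measurable ?M (base H)"
    by (rule measurable_embed_measure1) simp
  have "distr ?M (base H) projl = distr (distr (base H) ?M Inl) (base H) projl"
    using \<phi> by (simp add: measure_preserving_def)
  also have "\<dots> = distr (base H) (base H) (\<lambda>x. x)"
    using \<phi> pm by (subst distr_distr) (simp_all add: measure_preserving_def comp_def)
  finally have \<psi>: "measure_preserving ?M (base H) projl"
    using pm by (simp add: measure_preserving_def distr_id)
  have "integrable_graphon ?M ?U"
    using integrable_graphon_kernel[OF measurable_graphex_pullback[OF H \<psi>]] rho_pullback[OF H \<psi>] finH by simp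
  moreover have "(\<lambda>n. delta_cut (base (G n)) (kernel (G n)) ?M ?U) \<longlonglongrightarrow> 0"
  proof (rule order_tendstoI)
    fix y :: ereal assume "y < 0"
    then show "\<forall>\<^sub>F n in sequentially. y < delta_cut (base (G n)) (kernel (G n)) ?M ?U"
      by (intro always_eventually allI) (rule less_le_trans[OF _ delta_cut_nonneg])
  next
    fix y :: ereal assume "0 < y"
    then obtain e where e: "0 < e" "ereal e < y"
      by (metis ereal_dense2 ereal_less(2))
    \<comment> \<open>The capped mass, K c^2 and the degree tail get e/32 each, so r = s = 3 e/32.
      With c k < e/8 the bound c k + 2 r + 2 s stays below e/8 + 3 e/8 = e/2.\<close>
    have e32: "0 < e / 32" "0 < ennreal (e / 32)"
      using e by simp_all
    obtain C where C: "\<And>n. rho (G n) \<le> ennreal C"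
      using uniform_degree_tail(1)[OF ui G] by blast
    have C0: "rho (G n) \<le> ennreal (max C 0)" for n
      using C[of n] by (rule order_trans) (simp add: ennreal_leI)
    obtain h where h: "rho H = ennreal h" "0 \<le> h"
      using finH by (cases "rho H") auto
    obtain \<delta>1 where \<delta>1: "0 < \<delta>1" "\<forall>\<^sub>F n in sequentially. capped (ennreal \<delta>1) (G n)
        + (star_mass (G n) + 2 * ennreal (dust (G n))) \<le> ennreal (e / 32)"
      using dtv[unfolded degree_tails_vanish_def, rule_format, OF e32(1)] by blast
    obtain \<delta>2 where \<delta>2: "0 < \<delta>2" "capped (ennreal \<delta>2) H < ennreal (e / 32)"
      using capped_vanishes[OF H finH e32(2)] by blast
    define \<delta> where "\<delta> = min \<delta>1 \<delta>2"
    have \<delta>: "0 < \<delta>" "\<delta> \<le> \<delta>1" "\<delta> \<le> \<delta>2"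
      using \<delta>1 \<delta>2 by (auto simp: \<delta>_def)
    obtain K where K: "0 \<le> K" "\<And>n. degree_tail K (G n) \<le> ennreal (e / 32)"
      using uniform_degree_tail(2)[OF ui G e32(1)] by blast
    obtain K' where K': "0 \<le> K'" "degree_tail K' H < ennreal (e / 32)"
      using degree_tail_vanishes[OF H finH e32(2)] by blast
    \<comment> \<open>A bound for the measure of the pairs in which some degree exceeds \<delta>,
      uniform in n; it precedes c so that c k can be made small.\<close>
    define k where "k = (max C 0 + h) / \<delta>"
    have k: "0 \<le> k" "\<delta> * k = max C 0 + h"
      using \<delta>(1) h(2) by (simp_all add: k_def)
    have "\<forall>\<^sub>F c in at_right 0. c * k < e / 8"
      by (rule order_tendstoD(2)[where y = 0]) (use e in \<open>auto intro!: tendsto_eq_intros\<close>)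
    moreover have "\<forall>\<^sub>F c in at_right 0. K * c\<^sup>2 < e / 32"
      by (rule order_tendstoD(2)[where y = 0]) (use e in \<open>auto intro!: tendsto_eq_intros\<close>)
    moreover have "\<forall>\<^sub>F c in at_right 0. K' * c\<^sup>2 < e / 32"
      by (rule order_tendstoD(2)[where y = 0]) (use e in \<open>auto intro!: tendsto_eq_intros\<close>)
    ultimately have "\<forall>\<^sub>F c in at_right 0. 0 < c \<and> c * k < e / 8 \<and> K * c\<^sup>2 < e / 32 \<and> K' * c\<^sup>2 < e / 32"
      using eventually_at_right_less[of "0::real"] by eventually_elim auto
    then obtain c where c: "0 < c" "c * k < e / 8" "K * c\<^sup>2 < e / 32" "K' * c\<^sup>2 < e / 32"
      using eventually_happens[of _ "at_right (0::real)"] by (auto simp: trivial_limit_at_right_real)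
    have sum: "x + (ennreal L * ennreal (c\<^sup>2) + z) \<le> ennreal (3 * (e / 32))"
      if "x \<le> ennreal (e / 32)" "0 \<le> L" "L * c\<^sup>2 < e / 32" "z \<le> ennreal (e / 32)" for x z L
    proof -
      have "ennreal L * ennreal (c\<^sup>2) \<le> ennreal (e / 32)"
        using that by (simp add: ennreal_leI flip: ennreal_mult)
      then have "x + (ennreal L * ennreal (c\<^sup>2) + z) \<le> ennreal (e / 32) + (ennreal (e / 32) + ennreal (e / 32))"
        using that by (intro add_mono)
      also have "\<dots> = ennreal (3 * (e / 32))"
        using e by (simp flip: ennreal_plus)
      finally show ?thesis .
    qed
    have "\<forall>\<^sub>F n in sequentially. delta_diamond (G n) H < ereal c"
      using c by (intro order_tendstoD(2)[OF lim]) simp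
    with \<delta>1(2) show "\<forall>\<^sub>F n in sequentially. delta_cut (base (G n)) (kernel (G n)) ?M ?U < y"
    proof eventually_elim
      case (elim n)
      have "capped (ennreal \<delta>) (G n) \<le> capped (ennreal \<delta>1) (G n)"
        using \<delta> by (intro capped_mono ennreal_leI)
      also have "\<dots> \<le> capped (ennreal \<delta>1) (G n)
        + (star_mass (G n) + 2 * ennreal (dust (G n)))"
        by simp
      also note elim(1)
      finally have r: "capped (ennreal \<delta>) (G n) + (ennreal K * ennreal (c\<^sup>2) + degree_tail K (G n)) \<le> ennreal (3 * (e / 32))"
        using K c by (intro sum)
      have "capped (ennreal \<delta>) H \<le> capped (ennreal \<delta>2) H"
        using \<delta> by (intro capped_mono ennreal_leI)
      also note less_imp_le[OF \<delta>2(2)]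
      finally have s: "capped (ennreal \<delta>) H + (ennreal K' * ennreal (c\<^sup>2) + degree_tail K' H) \<le> ennreal (3 * (e / 32))"
        using K' c by (intro sum) auto
      have le_rho_G: "degree_mass (G n) \<le> rho (G n)"
        and le_rho_H: "degree_mass H \<le> rho H"
        unfolding rho_eq[OF G] rho_eq[OF H] add.assoc by simp_all
      have "degree_mass (G n) + degree_mass H \<le> ennreal (max C 0) + ennreal h"
      proof (rule add_mono)
        show "degree_mass (G n) \<le> ennreal (max C 0)"
          using le_rho_G C0[of n] by (rule order_trans)
        show "degree_mass H \<le> ennreal h"
          using le_rho_H unfolding h(1) .
      qed
      also have "\<dots> = ennreal (\<delta> * k)"
        using h(2) k(2) by (simp flip: ennreal_plus)
      finally have kk: "degree_mass (G n) + degree_mass H \<le> ennreal (\<delta> * k)" .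
      have e3: "0 \<le> 3 * (e / 32)"
        using e by simp
      obtain \<kappa> where \<kappa>: "\<kappa> \<in> couplings (ext_space (base (G n))) (ext_space (base H))"
        "cut_norm \<kappa> (\<lambda>p q. ext_kernel (kernel (G n)) (fst p) (fst q) - ext_kernel (kernel H) (snd p) (snd q))
          \<le> ereal (c * k + 2 * (3 * (e / 32)) + 2 * (3 * (e / 32)))"
        using coupling_cut_norm_le[OF G finG H finH elim(2) c(1) \<delta>(1) k(1) e3 e3 kk r s] by blast
      have gr: "graphon (base (G n)) (kernel (G n))" "graphon (base H) (kernel H)"
        using G H by (simp_all add: measurable_graphex_def)
      have "delta_cut (base (G n)) (kernel (G n)) ?M ?U
          \<le> cut_norm \<kappa> (\<lambda>p q. ext_kernel (kernel (G n)) (fst p) (fst q) - ext_kernel (kernel H) (snd p) (snd q))"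
        by (rule delta_cut_embed_le[OF gr \<kappa>(1) \<phi> \<psi>]) simp
      also note \<kappa>(2)
      also have "ereal (c * k + 2 * (3 * (e / 32)) + 2 * (3 * (e / 32))) < ereal e"
        using c(2) e(1) by simp
      also note e(2)
      finally show ?case .
    qed
  qed
  ultimately show ?thesis
    by blast
qed

theorem theorem2p29:
  fixes G :: "nat \<Rightarrow> 'a graphex" and H :: "'b graphex"
  assumes "\<And>n. graphex (G n)" and "graphex H"
    and "unif_integrable (range G)"
    and "(\<lambda>n. delta_diamond (G n) H) \<longlonglongrightarrow> 0"
  shows
    "(((AE x in base H. star H x = 0) \<and> dust H = 0) \<longleftrightarrow>
        ((\<lambda>n. \<integral>\<^sup>+x. ennreal (star (G n) x) \<partial>base (G n)) \<longlonglongrightarrow> 0) \<and>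
        (\<lambda>n. dust (G n)) \<longlonglongrightarrow> 0 \<and>
        unif_tail_regular (range (\<lambda>n. (base (G n), kernel (G n))))) \<and>
     (((AE x in base H. star H x = 0) \<and> dust H = 0) \<longleftrightarrow>
        ((\<lambda>n. \<integral>\<^sup>+x. ennreal (star (G n) x) \<partial>base (G n)) \<longlonglongrightarrow> 0) \<and>
        (\<lambda>n. dust (G n)) \<longlonglongrightarrow> 0 \<and>
        (\<exists>(M :: ('b + 'c) measure) U. integrable_graphon M U \<and>
           (\<lambda>n. delta_cut (base (G n)) (kernel (G n)) M U) \<longlonglongrightarrow> 0))"
proof -
  have G: "\<And>n. measurable_graphex (G n)" and H: "measurable_graphex H"
    using assms(1,2) by (auto intro: graphex_imp_measurable)
  have fin: "\<And>n. rho (G n) < \<infinity>"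
    by (rule rho_G_finite[OF G H assms(3,4)])
  obtain C where C: "\<And>n. rho (G n) \<le> ennreal C"
    using uniform_degree_tail(1)[OF assms(3) G] by blast
  have H_iff: "((AE x in base H. star H x = 0) \<and> dust H = 0) \<longleftrightarrow> degree_tails_vanish G"
    using degree_tails_vanish_if[OF G H assms(3,4)] degree_tails_vanishD[OF G H assms(3,4)] by blast
  have tail_iff: "degree_tails_vanish G \<longleftrightarrow> ((\<lambda>n. \<integral>\<^sup>+x. ennreal (star (G n) x) \<partial>base (G n)) \<longlonglongrightarrow> 0) \<and>
      (\<lambda>n. dust (G n)) \<longlonglongrightarrow> 0 \<and> unif_tail_regular (range (\<lambda>n. (base (G n), kernel (G n))))"
    using degree_tails_vanish_imp_star_dust[of G, OF G fin] degree_tails_vanish_imp_tail_regular[of G, OF G fin _ C]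
      tail_regular_imp_degree_tails_vanish[of G, OF G fin] by blast
  have cut_iff: "degree_tails_vanish G \<longleftrightarrow> ((\<lambda>n. \<integral>\<^sup>+x. ennreal (star (G n) x) \<partial>base (G n)) \<longlonglongrightarrow> 0) \<and>
      (\<lambda>n. dust (G n)) \<longlonglongrightarrow> 0 \<and>
      (\<exists>(M :: ('b + 'c) measure) U. integrable_graphon M U \<and>
        (\<lambda>n. delta_cut (base (G n)) (kernel (G n)) M U) \<longlonglongrightarrow> 0)"
    using degree_tails_vanish_imp_star_dust[of G, OF G fin] degree_tails_vanish_imp_delta_cut[OF G H assms(3,4)]
      delta_cut_imp_degree_tails_vanish[of G, OF G fin] by blast
  show ?thesis
    unfolding H_iff using tail_iff cut_iff by blast
qed

end
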